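(* Let $\mathcal{R}_{a,b,c}$ be the lattice of congruent triangles with sides $a,b,c$ and opposite angles $\alpha,\beta,\gamma$, and let $\mathcal{C}$ be a planar convex body with perimeter $u$, area $F$, support function $s$ and width function $w$ (all as defined in the context). Assume that $\max_{0\le\phi<2\pi}c^*(\phi)\le c$, where $$c^*(\phi)=s(\phi)\csc\alpha+s(\phi+\alpha+\beta)\csc\beta+s(\phi+\alpha+\pi)(\cot\alpha+\cot\beta).$$ For real $x$ put $$I(x)=\int_0^{\pi}w(\phi)\,w(\phi+x)\,d\phi,\qquad J(x)=\int_0^{2\pi}s(\phi)\,s(\phi+x)\,d\phi,$$ $$f_1(x)=I(x)-J(x),\qquad f_2(x)=2I(x)-3J(x),\qquad f_3(x)=I(x)-3J(x).$$ Let $Q=ab\sin\gamma$. Then the probabilities $p(i)$ that the randomly thrown body $\mathcal{C}$ hits exactly $i$ triangles of $\mathcal{R}_{a,b,c}$ are $$p(1)=1-\frac{(a+b+c)u}{\pi Q}+\frac{(a^2+b^2+c^2)J(0)}{2\pi Q^2}+\frac{bc f_1(\alpha)+ca f_1(\beta)+ab f_1(\gamma)}{\pi Q^2},$$ $$p(2)=\frac{(a+b+c)u}{\pi Q}-\frac{3(a^2+b^2+c^2)J(0)}{2\pi Q^2}-\frac{bc f_2(\alpha)+ca f_2(\beta)+ab f_2(\gamma)}{\pi Q^2},$$ $$p(3)=\frac{3(a^2+b^2+c^2)J(0)}{2\pi Q^2}+\frac{bc f_3(\alpha)+ca f_3(\beta)+ab f_3(\gamma)}{\pi Q^2},$$ $$p(4)=\frac{bcJ(\alpha)+caJ(\beta)+abJ(\gamma)}{\pi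 Q^2}-\frac{(a^2+b^2+c^2)J(0)}{2\pi Q^2}-\frac{F}{Q},$$ $$p(5)=0,\qquad p(6)=\frac{F}{Q},$$ and the expectation of the random number $Z$ of hit triangles is $$\mathrm{E}(Z)=1+\frac{(a+b+c)u}{\pi Q}+\frac{2F}{Q}.$$
   Context: Lattice. Fix a triangle with sides $a,b,c$ and opposite angles $\alpha,\beta,\gamma$, and altitudes $h_a=b\sin\gamma=c\sin\beta$, $h_b=a\sin\gamma=c\sin\alpha$, $h_c=a\sin\beta=b\sin\alpha$. The lattice $\mathcal{R}_{a,b,c}$ is the union of the three families of parallel lines $\{x\sin\beta+y\cos\beta=kh_a\}$, $\{x\sin\alpha-y\cos\alpha=kh_b\}$, $\{y=kh_c\}$, $k\in\mathbb{Z}$, in $\mathbb{R}^2$. These lines cut the plane into triangles ("the triangles of $\mathcal{R}_{a,b,c}$"), all congruent to $\mathcal{T}=\{(x,y): 0\le y\le h_c,\ y\cot\alpha\le x\le c-y\cot\beta\}$. Two triangles form a parallelogram congruent to $\mathcal{Q}=\{(x,y): 0\le y\le h_c,\ y\cot\alpha\le x\le c+y\cot\alpha\}$, whose area is $Q=ab\sin\gamma=ac\sin\beta=bc\sin\alpha$. Body. The planar convex body $\mathcal{C}$ is provided with a fixed reference point $O$ in $\mathcal{C}$ and a fixed oriented line segment $\sigma$ starting in $O$, both moving rigidly with $\mathcal{C}$. Support function $s:\mathbb{R}\to\mathbb{R}$: place $\mathcal{C}$ with $O$ at the origin of a Cartesian coordinate system and rotated so that the (counterclockwise) angle from the positive $x$-axis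 to $\sigma$ is $\phi$; then $s(\phi)$ is the distance from the origin to the support line of $\mathcal{C}$ perpendicular to the $x$-axis on the side of the positive $x$-axis, i.e. $s(\phi)$ is the maximal $x$-coordinate of the points of $\mathcal{C}$ in this position. The width is $w(\phi)=s(\phi)+s(\phi+\pi)$. Random throw of $\mathcal{C}$ onto $\mathcal{R}_{a,b,c}$: only rotations and translations of $\mathcal{C}$ are used; the position $(x,y)$ of $O$ is uniformly distributed in $\mathcal{Q}$ (so $y$ is uniform in $[0,h_c]$ and, given $y$, $x$ is uniform in $[y\cot\alpha,\,h_b\csc\alpha+y\cot\alpha]$, where $h_b\csc\alpha=c$), and the angle $\phi$ from a fixed direction perpendicular to the sides $b$ to the segment $\sigma$ is uniformly distributed in $[0,2\pi]$ and independent of $(x,y)$. The body hits a triangle if it has nonempty intersection with it. $Z$ is the number of triangles of $\mathcal{R}_{a,b,c}$ hit and $p(i)=P(Z=i)$. The quantity $c^*(\phi)$ is the length of the side corresponding to $c$ of the triangle similar to $\mathcal{T}$ (with parallel sides) all of whose sides touch $\mathcal{C}$ in direction $\phi$; the condition $\max c^*\le c$ expresses that in every direction $\mathcal{C}$ fits into a single triangle of the lattice. *)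

theory Defs
  imports "HOL-Probability.Probability"
begin

text \<open>The Euclidean plane is \<^typ>\<open>complex\<close>, with \<open>x = Re z\<close> and \<open>y = Im z\<close>.\<close>

definition vertex_angle :: "complex \<Rightarrow> complex \<Rightarrow> complex \<Rightarrow> real" where
  "vertex_angle P V R = arccos (((P - V) \<bullet> (R - V)) / (norm (P - V) * norm (R - V)))"

definition triangle_data :: "real \<Rightarrow> real \<Rightarrow> real \<Rightarrow> real \<Rightarrow> real \<Rightarrow> real \<Rightarrow> bool" where
  "triangle_data a b c \<alpha> \<beta> \<gamma> \<longleftrightarrow>
     (\<exists>A B C :: complex. \<not> collinear {A, B, C} \<and>
        a = dist B C \<and> b = dist C A \<and> c = dist A B \<and>
        \<alpha> = vertex_angle B A C \<and> \<beta> = vertex_angle C B A \<and> \<gamma> = vertex_angle A C B)"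

definition lattice_lines ::
  "real \<Rightarrow> real \<Rightarrow> real \<Rightarrow> real \<Rightarrow> real \<Rightarrow> real \<Rightarrow> complex set" where
  "lattice_lines a b c \<alpha> \<beta> \<gamma> =
     (let h\<^sub>a = b * sin \<gamma>; h\<^sub>b = a * sin \<gamma>; h\<^sub>c = a * sin \<beta> in
        {z. \<exists>k::int. Re z * sin \<beta> + Im z * cos \<beta> = of_int k * h\<^sub>a} \<union>
        {z. \<exists>k::int. Re z * sin \<alpha> - Im z * cos \<alpha> = of_int k * h\<^sub>b} \<union>
        {z. \<exists>k::int. Im z = of_int k * h\<^sub>c})"

text \<open>The triangles of the lattice are closed.\<close>

definition lattice_triangles ::
  "real \<Rightarrow> real \<Rightarrow> real \<Rightarrow> real \<Rightarrow> real \<Rightarrow> real \<Rightarrow> complex set set" where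
  "lattice_triangles a b c \<alpha> \<beta> \<gamma> = closure ` components (- lattice_lines a b c \<alpha> \<beta> \<gamma>)"

text \<open>A period parallelogram, two triangles of the lattice; its height is \<open>h\<^sub>c = a sin \<beta>\<close>.\<close>

definition cell :: "real \<Rightarrow> real \<Rightarrow> real \<Rightarrow> real \<Rightarrow> complex set" where
  "cell a c \<alpha> \<beta> = {z. 0 \<le> Im z \<and> Im z \<le> a * sin \<beta> \<and>
                      Im z * cot \<alpha> \<le> Re z \<and> Re z \<le> c + Im z * cot \<alpha>}"

definition convex_body :: "complex set \<Rightarrow> bool" where
  "convex_body K \<longleftrightarrow> convex K \<and> compact K \<and> interior K \<noteq> {}"

text \<open>Arc length of a curve on \<open>[0,1]\<close>: the supremum of the lengths of inscribed polygons.\<close>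

definition has_curve_length :: "(real \<Rightarrow> complex) \<Rightarrow> real \<Rightarrow> bool" where
  "has_curve_length g l \<longleftrightarrow>
     (let S = {\<Sum>i<n. dist (g (t i)) (g (t (Suc i))) | (n::nat) (t :: nat \<Rightarrow> real).
                 mono t \<and> range t \<subseteq> {0..1}}
      in bdd_above S \<and> l = Sup S)"

definition perimeter :: "complex set \<Rightarrow> real" where
  "perimeter K = (THE l. \<exists>g. simple_path g \<and> pathfinish g = pathstart g \<and>
                           path_image g = frontier K \<and> has_curve_length g l)"

text \<open>The body \<open>K\<close> carries the reference point \<open>r\<close> and the oriented segment \<open>\<sigma>\<close> from \<open>r\<close> to \<open>e\<close>.
  \<open>placed K r e z d\<close> is the image of \<open>K\<close> under the orientation-preserving rigid motion
  that takes \<open>r\<close> to \<open>z\<close> and the direction of \<open>\<sigma>\<close> to the unit vector \<open>d\<close>.\<close>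

definition placed :: "complex set \<Rightarrow> complex \<Rightarrow> complex \<Rightarrow> complex \<Rightarrow> complex \<Rightarrow> complex set" where
  "placed K r e z d = (\<lambda>p. z + d * ((p - r) / sgn (e - r))) ` K"

definition support_function :: "complex set \<Rightarrow> complex \<Rightarrow> complex \<Rightarrow> real \<Rightarrow> real" where
  "support_function K r e \<phi> = Sup (Re ` placed K r e 0 (cis \<phi>))"

definition width :: "(real \<Rightarrow> real) \<Rightarrow> real \<Rightarrow> real" where
  "width s \<phi> = s \<phi> + s (\<phi> + pi)"

text \<open>Length of the side \<open>c\<close> of the triangle circumscribed about the body whose sides are parallel
  to those of a lattice triangle; \<open>\<phi>\<close> is the angle from the outward normal of its side \<open>b\<close> to \<open>\<sigma>\<close>.\<close>

definition c_star :: "(real \<Rightarrow> real) \<Rightarrow> real \<Rightarrow> real \<Rightarrow> real \<Rightarrow> real" where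
  "c_star s \<alpha> \<beta> \<phi> =
     s \<phi> * (1 / sin \<alpha>) + s (\<phi> + \<alpha> + \<beta>) * (1 / sin \<beta>) + s (\<phi> + \<alpha> + pi) * (cot \<alpha> + cot \<beta>)"

definition I_fun :: "(real \<Rightarrow> real) \<Rightarrow> real \<Rightarrow> real" where
  "I_fun s x = integral {0..pi} (\<lambda>\<phi>. width s \<phi> * width s (\<phi> + x))"

definition J_fun :: "(real \<Rightarrow> real) \<Rightarrow> real \<Rightarrow> real" where
  "J_fun s x = integral {0..2 * pi} (\<lambda>\<phi>. s \<phi> * s (\<phi> + x))"

text \<open>Joint law of the position of the reference point and of the angle of \<open>\<sigma>\<close>:
  both uniform, and independent of each other.\<close>

definition throw_law :: "real \<Rightarrow> real \<Rightarrow> real \<Rightarrow> real \<Rightarrow> (complex \<times> real) measure" where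
  "throw_law a c \<alpha> \<beta> =
     uniform_measure lborel (cell a c \<alpha> \<beta>) \<Otimes>\<^sub>M uniform_measure lborel {0..2 * pi}"

definition triangles_hit :: "complex set set \<Rightarrow> complex set \<Rightarrow> nat" where
  "triangles_hit \<T> K = card {T \<in> \<T>. K \<inter> T \<noteq> {}}"

end

theory Submission
  imports Defs
begin

text \<open>
  Use the affine coordinates \<open>pu\<close>, \<open>pv\<close> of the plane in which the sides \<open>b\<close> and \<open>c\<close> of the lattice lie on
  the integer levels of \<open>pu\<close> and of \<open>pv\<close>. Then the sides \<open>a\<close> lie on the integer levels of
  \<open>pw = pu + pv\<close>, the cell is the unit square, and a uniform position in the cell is a pair of independent uniform
  coordinates \<open>u, v\<close>.

  Any two lines of different families cross in a lattice vertex, and there the third family passes as well.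
  Hence a convex body in general position is cut by the lattice into one piece, plus one piece for every
  line that it meets, plus two pieces if it contains a vertex, and the pieces are the triangles hit. The
  hypothesis on \<open>c\<^sup>*\<close> says that in every direction the body fits into a lattice triangle, and in the opposite
  direction into a reflected one. So it meets at most one line of each family, and it meets three
  lines only if they run through one vertex (\<open>card_hit_index_generic\<close>). Therefore
  \<open>Z = 1 + [u-line] + [v-line] + [w-line] + 2 [vertex]\<close> almost surely, where a vertex forces all
  three lines, and the distribution of \<open>Z\<close> follows by inclusion and exclusion from the probabilities of
  these four events and of the intersections of the first three (\<open>count_distribution\<close>).

  Fix the direction of the body. It meets a line of a family if and only if the
  coordinate of the reference point lies, modulo 1, in an interval whose length is the width of the body in that
  coordinate. Two of the three coordinates are independent modulo 1, so two lines are met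
  with the product of the widths. Three lines are met on a rectangle from which two opposite corners are cut
  off; here it matters that the corners do not reappear on the other side of the period, which is again the
  hypothesis on \<open>c\<^sup>*\<close> (\<open>emeasure_hit_uvw\<close>). A vertex is met on the reflected body, whose
  area in these coordinates is \<open>F / Q\<close> (\<open>emeasure_vertex\<close>).

  The extents of the body in the three coordinates are multiples of its support function in the directions normal
  to the sides, so the average over the direction turns the products into the correlations \<open>I\<close> and
  \<open>J\<close>. The linear terms give the integral of the support function, which is the perimeter
  (\<open>perimeter_eq_integral_supp\<close>). That formula is proved for the length of an arbitrary simple closed
  curve along the boundary: the length of a segment is a mean of the lengths of its projections, and the projection of
  the boundary to a line runs back and forth just once.
\<close>

section \<open>The angles of a triangle\<close>

text \<open>With \<open>x\<close> and \<open>y\<close> the two sides at the first vertex, every cosine is an inner product and every sine is the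
  same number \<open>\<Delta>\<close>, twice the area, divided by the lengths of the adjacent sides. This gives the sine rule at once, and the
  angle sum because \<open>cos (\<alpha> + \<beta>) = - cos \<gamma>\<close> and \<open>sin (\<alpha> + \<beta>) > 0\<close>.\<close>
lemma triangle_data_facts:
  assumes "triangle_data a b c \<alpha> \<beta> \<gamma>"
  shows "0 < a" "0 < b" "0 < c" "0 < \<alpha>" "\<alpha> < pi" "0 < \<beta>" "\<beta> < pi" "0 < \<gamma>" "\<gamma> < pi"
    and "\<alpha> + \<beta> + \<gamma> = pi" and "a * sin \<beta> = b * sin \<alpha>" and "a * sin \<gamma> = c * sin \<alpha>"
proof -
  obtain A B C :: complex where nc: "\<not> collinear {A, B, C}"
    and abc: "a = dist B C" "b = dist C A" "c = dist A B"
    and ang: "\<alpha> = vertex_angle B A C" "\<beta> = vertex_angle C B A" "\<gamma> = vertex_angle A C B"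
    using assms unfolding triangle_data_def by blast
  show a: "0 < a" and b: "0 < b" and c: "0 < c"
    using nc abc by (auto simp: insert_commute)
  define x y where "x = B - A" and "y = C - A"
  define \<Delta> where "\<Delta> = \<bar>Re x * Im y - Im x * Re y\<bar>"
  have a2: "a\<^sup>2 = (x - y) \<bullet> (x - y)" and b2: "b\<^sup>2 = y \<bullet> y" and c2: "c\<^sup>2 = x \<bullet> x"
    by (simp_all add: abc x_def y_def dist_norm dot_square_norm norm_minus_commute)
  have D2: "\<Delta>\<^sup>2 + (x \<bullet> y)\<^sup>2 = (x \<bullet> x) * (y \<bullet> y)"
    unfolding \<Delta>_def power2_abs by (simp add: inner_complex_def power2_eq_square algebra_simps)
  have "\<Delta> \<noteq> 0"
  proof
    assume "\<Delta> = 0"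
    then have *: "Re x * Im y = Im x * Re y" unfolding \<Delta>_def by auto
    have "(x \<bullet> x) *\<^sub>R y = (x \<bullet> y) *\<^sub>R x"
      using * by (simp add: complex_eq_iff inner_complex_def) (auto simp: algebra_simps)
    moreover have "x \<bullet> x \<noteq> 0" using c c2 by auto
    ultimately have "y = ((x \<bullet> y) / (x \<bullet> x)) *\<^sub>R x"
      by (metis (no_types, lifting) divideR_right scaleR_scaleR divide_inverse mult.commute)
    then have "collinear {0, x, y}" unfolding collinear_lemma by blast
    then have "collinear {A, B, C}"
      using collinear_3[of B A C] collinear_3[of x 0 y] by (simp add: x_def y_def insert_commute)
    with nc show False by blast
  qed
  then have D: "\<Delta> > 0" unfolding \<Delta>_def by auto
  define X Y W where "X = (x \<bullet> y)" and "Y = x \<bullet> x - x \<bullet> y" and "W = y \<bullet> y - x \<bullet> y"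
  have key: "cos t = m / (p * q) \<and> sin t = \<Delta> / (p * q) \<and> 0 < t \<and> t < pi"
    if "t = arccos (m / (p * q))" "0 < p" "0 < q" "\<Delta>\<^sup>2 + m\<^sup>2 = p\<^sup>2 * q\<^sup>2" for t m p q :: real
  proof -
    have "(m / (p*q))\<^sup>2 + (\<Delta> / (p*q))\<^sup>2 = 1"
      using that by (simp add: power_divide power_mult_distrib add_divide_distrib[symmetric] add.commute)
    then have s1: "sqrt (1 - (m/(p*q))\<^sup>2) = \<Delta> / (p*q)"
      using D that by (intro real_sqrt_unique) auto
    have pos: "0 < \<Delta> / (p*q)" using D that by auto
    have "(m / (p*q))\<^sup>2 < 1" using \<open>_ = 1\<close> zero_less_power[OF pos, of 2] by linarith
    then have "\<bar>m / (p*q)\<bar> < 1" by (simp only: abs_square_less_1)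
    then have lt: "- 1 < m / (p*q)" "m / (p*q) < 1" by linarith+
    have "0 < t" "t < pi" using arccos_lt_bounded[OF lt] that(1) by simp_all
    with lt s1 that(1) show ?thesis by (simp add: sin_arccos)
  qed
  have "\<alpha> = arccos (X / (c * b))"
    by (simp add: ang vertex_angle_def abc X_def x_def y_def dist_norm norm_minus_commute)
  moreover have "X\<^sup>2 + \<Delta>\<^sup>2 = c\<^sup>2 * b\<^sup>2" using D2 by (simp add: b2 c2 X_def)
  ultimately have al: "cos \<alpha> = X / (c * b)" "sin \<alpha> = \<Delta> / (c * b)" "0 < \<alpha>" "\<alpha> < pi"
    using key[of \<alpha> X c b] b c by auto
  have "\<beta> = arccos (Y / (a * c))"
  proof -
    have "(C - B) \<bullet> (A - B) = Y" by (simp add: Y_def x_def y_def algebra_simps inner_commute)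
    then show ?thesis
      by (simp add: ang vertex_angle_def abc dist_norm norm_minus_commute)
  qed
  moreover have "\<Delta>\<^sup>2 + Y\<^sup>2 = a\<^sup>2 * c\<^sup>2"
    unfolding a2 c2 Y_def using D2 by (simp add: power2_eq_square algebra_simps inner_commute)
  ultimately have be: "cos \<beta> = Y / (a * c)" "sin \<beta> = \<Delta> / (a * c)" "0 < \<beta>" "\<beta> < pi"
    using key[of \<beta> Y a c] a c by auto
  have "\<gamma> = arccos (W / (b * a))"
  proof -
    have "(A - C) \<bullet> (B - C) = W" by (simp add: W_def x_def y_def algebra_simps inner_commute)
    then show ?thesis
      by (simp add: ang vertex_angle_def abc dist_norm norm_minus_commute)
  qed
  moreover have "\<Delta>\<^sup>2 + W\<^sup>2 = b\<^sup>2 * a\<^sup>2"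
    unfolding a2 b2 W_def using D2 by (simp add: power2_eq_square algebra_simps inner_commute)
  ultimately have ga: "cos \<gamma> = W / (b * a)" "sin \<gamma> = \<Delta> / (b * a)" "0 < \<gamma>" "\<gamma> < pi"
    using key[of \<gamma> W b a] a b by auto
  show "0 < \<alpha>" "\<alpha> < pi" "0 < \<beta>" "\<beta> < pi" "0 < \<gamma>" "\<gamma> < pi" by fact+
  show "a * sin \<beta> = b * sin \<alpha>" "a * sin \<gamma> = c * sin \<alpha>"
    using a b c by (auto simp: al be ga field_simps)
  have XY: "X + Y = c\<^sup>2" by (simp add: X_def Y_def c2)
  have "cos (\<alpha> + \<beta>) = (X * Y - \<Delta>\<^sup>2) / (a * b * c\<^sup>2)"
    by (simp add: cos_add al be diff_divide_distrib power2_eq_square mult.commute mult.left_commute)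
  also have "X * Y - \<Delta>\<^sup>2 = - W * c\<^sup>2"
    unfolding c2 X_def Y_def W_def using D2 by (simp add: power2_eq_square algebra_simps)
  also have "- W * c\<^sup>2 / (a * b * c\<^sup>2) = - cos \<gamma>" using c by (simp add: ga mult.commute)
  finally have 1: "cos (\<alpha> + \<beta>) = cos (pi - \<gamma>)" by (simp add: cos_diff)
  have "sin (\<alpha> + \<beta>) = \<Delta> * (X + Y) / (a * b * c\<^sup>2)"
    by (simp add: sin_add al be add_divide_distrib distrib_left power2_eq_square mult.commute mult.left_commute)
  then have "sin (\<alpha> + \<beta>) > 0" using D XY a b c by simp
  then have "\<alpha> + \<beta> < pi"
    using sin_le_zero[of "\<alpha> + \<beta>"] al(4) be(4) by linarith
  then have "\<alpha> + \<beta> = pi - \<gamma>" 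
    using cos_inj_pi[OF _ _ _ _ 1] al(3) be(3) ga(3,4) by simp
  then show "\<alpha> + \<beta> + \<gamma> = pi" by simp
qed

section \<open>Cauchy's formula for the perimeter of a convex body\<close>

text \<open>A line through an interior point of a convex set leaves the interior once in each direction: beyond a
  frontier point there is nothing left, since the open segment from an interior point to a point of the closure is interior.\<close>
lemma convex_frontier_line_two_points:
  fixes K :: "complex set"
  assumes K: "convex K" "compact K" and q: "q \<in> interior K" "q \<bullet> d = c"
    and P: "p1 \<in> frontier K" "p2 \<in> frontier K" "p3 \<in> frontier K"
      "p1 \<bullet> d = c" "p2 \<bullet> d = c" "p3 \<bullet> d = c" and d: "d \<noteq> 0"
  shows "p1 = p2 \<or> p1 = p3 \<or> p2 = p3"
proof -
  have par: "\<exists>l. l \<noteq> 0 \<and> p = q + l *\<^sub>R (\<i> * d)" if "p \<in> frontier K" "p \<bullet> d = c" for p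
  proof -
    have "(p - q) \<bullet> d = 0" using that q by (simp add: inner_diff_left)
    then have *: "Re (p - q) * Re d = - Im (p - q) * Im d" by (simp add: inner_complex_def algebra_simps)
    define l where "l = ((p - q) \<bullet> (\<i> * d)) / (d \<bullet> d)"
    have dd: "d \<bullet> d \<noteq> 0" using d by simp
    have "(d \<bullet> d) *\<^sub>R (p - q) = ((p - q) \<bullet> (\<i> * d)) *\<^sub>R (\<i> * d)"
      using * by (simp add: complex_eq_iff inner_complex_def) algebra
    then have "p - q = l *\<^sub>R (\<i> * d)"
      unfolding l_def using dd
      by (metis (no_types, lifting) divideR_right scaleR_scaleR divide_inverse mult.commute)
    then have "p = q + l *\<^sub>R (\<i> * d)" by (simp add: algebra_simps)
    moreover have "p \<noteq> q" using that q by (auto simp: frontier_def)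
    ultimately show ?thesis by (intro exI[of _ l]) auto
  qed
  have same: "l = m" if l: "q + l *\<^sub>R (\<i> * d) \<in> frontier K" and m: "q + m *\<^sub>R (\<i> * d) \<in> frontier K"
    and lm: "l * m > 0" "\<bar>l\<bar> \<le> \<bar>m\<bar>" for l m
  proof (rule ccontr)
    assume ne: "l \<noteq> m"
    define t where "t = l / m"
    have m0: "m \<noteq> 0" using lm by auto
    have t: "0 < t" "t < 1"
      using lm ne m0 by (auto simp: t_def divide_less_eq zero_less_divide_iff zero_less_mult_iff abs_if split: if_splits)
    have "q + l *\<^sub>R (\<i> * d) = (1 - t) *\<^sub>R q + t *\<^sub>R (q + m *\<^sub>R (\<i> * d))"
      using m0 by (simp add: t_def algebra_simps)
    then have "q + l *\<^sub>R (\<i> * d) \<in> open_segment q (q + m *\<^sub>R (\<i> * d))"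
      unfolding in_segment using t m0 d by auto
    moreover have "q + m *\<^sub>R (\<i> * d) \<in> closure K" using m by (auto simp: frontier_def)
    ultimately have "q + l *\<^sub>R (\<i> * d) \<in> interior K"
      using in_interior_closure_convex_segment[OF K(1) q(1)] by blast
    with l show False by (auto simp: frontier_def)
  qed
  have same': "l = m" if "q + l *\<^sub>R (\<i> * d) \<in> frontier K" "q + m *\<^sub>R (\<i> * d) \<in> frontier K" "l * m > 0" for l m
    using same[of l m] same[of m l] that by (cases "\<bar>l\<bar> \<le> \<bar>m\<bar>") (auto simp: mult.commute)
  obtain l1 l2 l3 where l: "l1 \<noteq> 0" "l2 \<noteq> 0" "l3 \<noteq> 0" "p1 = q + l1 *\<^sub>R (\<i> * d)"
    "p2 = q + l2 *\<^sub>R (\<i> * d)" "p3 = q + l3 *\<^sub>R (\<i> * d)"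
    using par P by metis
  have "l1 * l2 > 0 \<or> l1 * l3 > 0 \<or> l2 * l3 > 0"
    using l(1-3) by (auto simp: zero_less_mult_iff)
  then show ?thesis
    using same' P l by blast
qed

lemma interior_meets_level:
  fixes K :: "complex set"
  assumes K: "convex K" "compact K" "interior K \<noteq> {}" and p: "p \<in> K" "p' \<in> K" "p \<bullet> d < c" "c < p' \<bullet> d"
  shows "\<exists>q\<in>interior K. q \<bullet> d = c"
proof -
  have cl: "K \<subseteq> closure (interior K)"
    using K convex_closure_interior[of K] closure_subset by blast
  have "open {z. z \<bullet> d < c}" "open {z. c < z \<bullet> d}"
    by (auto intro!: open_Collect_less continuous_intros)
  then obtain x y where x: "x \<in> interior K" "x \<bullet> d < c" and y: "y \<in> interior K" "c < y \<bullet> d"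
    using p cl open_Int_closure_eq_empty[of "{z. z \<bullet> d < c}" "interior K"]
      open_Int_closure_eq_empty[of "{z. c < z \<bullet> d}" "interior K"] by (smt (verit) IntI disjoint_iff mem_Collect_eq subset_iff)
  have "connected ((\<lambda>z. z \<bullet> d) ` interior K)"
    using K by (intro connected_continuous_image continuous_intros convex_connected convex_interior)
  from connectedD_interval[OF this, of "x \<bullet> d" "y \<bullet> d" c] x y show ?thesis by auto
qed

lemma integral_shift_interval:
  fixes f :: "real \<Rightarrow> real"
  assumes "continuous_on UNIV f"
  shows "integral {a..b} (\<lambda>t. f (t + x)) = integral {a + x..b + x} f"
proof -
  have "f integrable_on {a + x..b + x}"
    using assms by (intro integrable_continuous_real) (auto intro: continuous_on_subset)
  then have "(f has_integral integral {a + x..b + x} f) (cbox (a + x) (b + x))"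
    by (simp add: has_integral_integral)
  then have "((f \<circ> (+) x) has_integral integral {a + x..b + x} f) (cbox a b)"
    by (subst has_integral_shift_cbox_iff)
  then show ?thesis by (auto simp: o_def add.commute intro!: integral_unique)
qed

lemma periodic_add_int:
  fixes f :: "real \<Rightarrow> 'a"
  assumes "\<And>x. f (x + p) = f x"
  shows "f (x + of_int k * p) = f x"
proof (induction k rule: int_induct[of _ 0])
  case (step1 i)
  then show ?case using assms[of "x + of_int i * p"] by (simp add: algebra_simps)
next
  case (step2 i)
  then show ?case using assms[of "x + of_int (i - 1) * p"] by (simp add: algebra_simps)
qed simp

lemma periodic_integral_shift:
  fixes f :: "real \<Rightarrow> real"
  assumes cont: "continuous_on UNIV f" and per: "\<And>x. f (x + p) = f x" and p: "0 < p"
  shows "integral {0..p} (\<lambda>t. f (t + x)) = integral {0..p} f"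
proof -
  have int: "f integrable_on {a..b}" for a b
    using cont by (intro integrable_continuous_real) (auto intro: continuous_on_subset)
  define y where "y = x - of_int \<lfloor>x / p\<rfloor> * p"
  have "y = p * frac (x / p)" using p by (simp add: y_def frac_def field_simps)
  then have y: "0 \<le> y" "y \<le> p"
    using p frac_lt_1[of "x / p"] by (auto simp: mult_left_le less_imp_le)
  have "f (t + x) = f (t + y)" for t
    using periodic_add_int[of f p "t + y" "\<lfloor>x / p\<rfloor>"] per by (simp add: y_def algebra_simps)
  then have "integral {0..p} (\<lambda>t. f (t + x)) = integral {0..p} (\<lambda>t. f (t + y))" by simp
  also have "\<dots> = integral {y..p + y} f" using integral_shift_interval[OF cont, of 0 p y] by simp
  also have "\<dots> = integral {y..p} f + integral {p..p + y} f"
    using y int by (intro Henstock_Kurzweil_Integration.integral_combine[symmetric]) auto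
  also have "integral {p..p + y} f = integral {0..y} f"
    using integral_shift_interval[OF cont, of 0 y p] per by (simp add: add.commute)
  also have "integral {y..p} f + integral {0..y} f = integral {0..p} f"
    using y int Henstock_Kurzweil_Integration.integral_combine[of 0 y p f] by simp
  finally show ?thesis .
qed

lemma integral_abs_cos: "integral {0..2*pi} (\<lambda>t. \<bar>cos (t + x)\<bar>) = 4"
proof -
  have c: "continuous_on A (\<lambda>t::real. \<bar>sin t\<bar>)" for A by (intro continuous_intros)
  have "integral {0..2*pi} (\<lambda>t. \<bar>cos (t + x)\<bar>) = integral {0..2*pi} (\<lambda>t. \<bar>sin (t + (x + pi/2))\<bar>)"
    by (simp add: sin_add[of "_ + x" "pi/2", simplified] add.assoc[symmetric])
  also have "\<dots> = integral {0..2*pi} (\<lambda>t. \<bar>sin t\<bar>)"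
    using c by (intro periodic_integral_shift) auto
  also have "\<dots> = integral {0..pi} (\<lambda>t. \<bar>sin t\<bar>) + integral {pi..2*pi} (\<lambda>t. \<bar>sin t\<bar>)"
    by (intro Henstock_Kurzweil_Integration.integral_combine[symmetric] integrable_continuous_real c) auto
  also have "integral {pi..2*pi} (\<lambda>t. \<bar>sin t\<bar>) = integral {0..pi} (\<lambda>t. \<bar>sin t\<bar>)"
    using integral_shift_interval[OF c, of 0 pi pi] by simp
  also have "integral {0..pi} (\<lambda>t. \<bar>sin t\<bar>) = integral {0..pi} sin"
    by (intro integral_cong) (auto simp: sin_ge_zero)
  also have "(sin has_integral (- cos pi - - cos 0)) {0..pi}"
    by (intro fundamental_theorem_of_calculus) (auto intro!: derivative_eq_intros simp flip: has_real_derivative_iff_has_vector_derivative)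
  then have "integral {0..pi} sin = 2" by (auto dest: integral_unique)
  finally show ?thesis by simp
qed

lemma Re_cis_mult_polar: "Re (cis \<phi> * z) = norm z * cos (\<phi> + Arg z)"
proof -
  have "cis \<phi> * z = rcis 1 \<phi> * rcis (norm z) (Arg z)" by (simp add: rcis_cmod_Arg cis_rcis_eq)
  then show ?thesis by (simp only: rcis_mult Re_rcis mult_1)
qed

text \<open>The formula of Cauchy for a segment; the factor 4 is the integral of \<open>\<bar>cos\<bar>\<close> over a period.\<close>
lemma norm_eq_mean_projection:
  "norm z = integral {0..2*pi} (\<lambda>\<phi>. \<bar>Re (cis \<phi> * z)\<bar>) / 4"
  unfolding Re_cis_mult_polar by (simp add: abs_mult integral_abs_cos)

text \<open>A function that takes every value strictly between \<open>m\<close> and \<open>M\<close> at most twice has variation at most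
  \<open>2 * (M - m)\<close>. Indeed \<open>\<bar>f (t (Suc i)) - f (t i)\<bar>\<close> is the measure of the levels between the two values; such a level is attained
  between the two parameters, so that at most two steps contain a given level, and integration over the level gives the bound.\<close>
lemma variation_le_two_crossings:
  fixes f t :: "_ \<Rightarrow> real" and n :: nat
  assumes cont: "continuous_on {0..1} f" and t: "mono t" "range t \<subseteq> {0..1}"
    and bnd: "\<And>x. x \<in> {0..1} \<Longrightarrow> m \<le> f x \<and> f x \<le> M"
    and two: "\<And>c x y z. m < c \<Longrightarrow> c < M \<Longrightarrow> x \<in> {0<..<1} \<Longrightarrow> y \<in> {0<..<1} \<Longrightarrow> z \<in> {0<..<1} \<Longrightarrow>
       f x = c \<Longrightarrow> f y = c \<Longrightarrow> f z = c \<Longrightarrow> x = y \<or> x = z \<or> y = z"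
  shows "(\<Sum>i<n. \<bar>f (t (Suc i)) - f (t i)\<bar>) \<le> 2 * (M - m)"
proof -
  define A where "A i = {min (f (t i)) (f (t (Suc i)))..max (f (t i)) (f (t (Suc i)))}" for i
  have mM: "m \<le> M" using bnd[of 0] by auto
  have t01: "t i \<in> {0..1}" for i using t(2) by blast
  have cnt: "(\<Sum>i<n. indicator (A i) c) \<le> (2 * indicator {m..M} c :: real)"
    if c: "c \<notin> f ` t ` {..n}" for c
  proof -
    define S where "S = {i. i < n \<and> c \<in> A i}"
    have "\<exists>x. t i < x \<and> x < t (Suc i) \<and> f x = c" if i: "i \<in> S" for i
    proof -
      have ti: "t i \<le> t (Suc i)" using t by (auto simp: mono_def)
      have ne: "f (t i) \<noteq> c" "f (t (Suc i)) \<noteq> c" using c i by (auto simp: S_def)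
      have "continuous_on {t i..t (Suc i)} f"
        using t01 by (intro continuous_on_subset[OF cont]) (meson atLeastAtMost_iff atLeastatMost_subset_iff)
      moreover have "f (t i) \<le> c \<and> c \<le> f (t (Suc i)) \<or> f (t (Suc i)) \<le> c \<and> c \<le> f (t i)"
        using i by (auto simp: S_def A_def)
      ultimately obtain x where "t i \<le> x" "x \<le> t (Suc i)" "f x = c"
        using IVT'[of f "t i" c "t (Suc i)"] IVT2'[of f "t (Suc i)" c "t i"] ti by auto
      with ne show ?thesis by (metis order_le_less)
    qed
    then obtain x where x: "\<And>i. i \<in> S \<Longrightarrow> t i < x i \<and> x i < t (Suc i) \<and> f (x i) = c" by metis
    have lt: "x i < x j" if "i \<in> S" "j \<in> S" "i < j" for i j
    proof -
      have "t (Suc i) \<le> t j" using that t by (auto simp: mono_def)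
      then show ?thesis using x[of i] x[of j] that by auto
    qed
    have x01: "x i \<in> {0<..<1}" if "i \<in> S" for i
      using x[OF that] t01[of i] t01[of "Suc i"] by auto
    have "card S \<le> 2" if "m < c" "c < M"
    proof (rule ccontr)
      assume "\<not> card S \<le> 2"
      then obtain S' where "S' \<subseteq> S" "card S' = 3" using obtain_subset_with_card_n[of 3 S] by auto
      then obtain i j k where "i \<in> S" "j \<in> S" "k \<in> S" "i \<noteq> j" "i \<noteq> k" "j \<noteq> k"
        by (auto simp: card_3_iff)
      moreover have "x i = x j \<or> x i = x k \<or> x j = x k"
        using two[OF that, of "x i" "x j" "x k"] calculation x x01 by blast
      ultimately show False using lt by (metis less_irrefl linorder_neqE_nat)
    qed
    moreover have "m < c \<and> c < M" if "S \<noteq> {}"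
    proof -
      from that obtain i where i: "i \<in> S" by auto
      then have "f (t i) \<noteq> c" "f (t (Suc i)) \<noteq> c" using c by (auto simp: S_def)
      moreover have "c \<in> A i" using i by (auto simp: S_def)
      ultimately show ?thesis
        using bnd[OF t01[of i]] bnd[OF t01[of "Suc i"]] by (auto simp: A_def min_def max_def split: if_splits)
    qed
    ultimately have "real (card S) \<le> 2 * indicator {m..M} c"
      by (cases "S = {}") (auto simp: indicator_def)
    moreover have "(\<Sum>i<n. indicator (A i) c) = real (card S)"
      unfolding S_def indicator_def by (simp add: sum.If_cases Int_def)
    ultimately show ?thesis by simp
  qed
  have intA: "integrable lborel (indicator (A i) :: real \<Rightarrow> real)" for i
    by (simp add: A_def)
  have intM: "integrable lborel (indicator {m..M} :: real \<Rightarrow> real)"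
    by (rule integrable_real_indicator) (use mM in auto)
  have "(\<Sum>i<n. \<bar>f (t (Suc i)) - f (t i)\<bar>) = (\<Sum>i<n. integral\<^sup>L lborel (indicator (A i)))"
    by (intro sum.cong refl) (auto simp: A_def min_def max_def)
  also have "\<dots> = (\<integral>c. (\<Sum>i<n. indicator (A i) c) \<partial>lborel)"
    by (intro Bochner_Integration.integral_sum[symmetric] intA)
  also have "\<dots> \<le> (\<integral>c. 2 * indicator {m..M} c \<partial>lborel)"
  proof (intro integral_mono_AE Bochner_Integration.integrable_sum intA)
    have "AE c in lborel. c \<notin> f ` t ` {..n}"
      by (intro AE_not_in finite_imp_null_set_lborel) auto
    then show "AE c in lborel. (\<Sum>i<n. indicator (A i) c) \<le> (2 * indicator {m..M} c :: real)"
      using cnt by (auto elim: eventually_mono)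
  qed (use intM in simp)
  also have "\<dots> = 2 * (M - m)" using mM by simp
  finally show ?thesis .
qed

text \<open>A closed sequence must travel from one value to any other and return.\<close>
lemma variation_closed_ge:
  fixes F :: "nat \<Rightarrow> real"
  assumes "F 0 = F n" "i \<le> n" "j \<le> n"
  shows "2 * (F i - F j) \<le> (\<Sum>k<n. \<bar>F (Suc k) - F k\<bar>)"
proof -
  define V where "V k = (\<Sum>k<k. \<bar>F (Suc k) - F k\<bar>)" for k
  have V: "\<bar>F q - F p\<bar> \<le> V q - V p" if "p \<le> q" for p q
    using that by (induction q rule: dec_induct) (auto simp: V_def)
  have "V 0 = 0" by (simp add: V_def)
  then have "\<bar>F i - F j\<bar> * 2 \<le> V n"
    using V[of i j] V[of j i] V[of 0 i] V[of 0 j] V[of i n] V[of j n] assms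
    by (cases "i \<le> j") (simp_all add: abs_if split: if_splits)
  moreover have "2 * (F i - F j) \<le> \<bar>F i - F j\<bar> * 2"
    unfolding mult.commute[of 2] by (intro mult_right_mono abs_ge_self) simp
  ultimately have "2 * (F i - F j) \<le> V n" by (rule order_trans[rotated])
  then show ?thesis by (simp only: V_def)
qed

text \<open>The support function in the direction of \<open>cis (- \<phi>)\<close>: the largest abscissa after a rotation by \<open>\<phi>\<close>. The sign of the
  angle is the one of \<^const>\<open>support_function\<close>.\<close>
definition supp :: "complex set \<Rightarrow> real \<Rightarrow> real" where
  "supp A \<phi> = Sup ((\<lambda>z. Re (cis \<phi> * z)) ` A)"

lemma supp_attained:
  assumes "compact A" "A \<noteq> {}"
  obtains z where "z \<in> A" "Re (cis \<phi> * z) = supp A \<phi>"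
proof -
  have "compact ((\<lambda>z. Re (cis \<phi> * z)) ` A)"
    using assms by (intro compact_continuous_image continuous_intros)
  then have "supp A \<phi> \<in> (\<lambda>z. Re (cis \<phi> * z)) ` A"
    unfolding supp_def using assms
    by (intro closed_contains_Sup bounded_imp_bdd_above) (auto simp: compact_eq_bounded_closed)
  with that show ?thesis by auto
qed

lemma supp_ge:
  assumes "compact A" "z \<in> A"
  shows "Re (cis \<phi> * z) \<le> supp A \<phi>"
proof -
  have "compact ((\<lambda>z. Re (cis \<phi> * z)) ` A)"
    using assms by (intro compact_continuous_image continuous_intros)
  then show ?thesis
    unfolding supp_def using assms
    by (intro cSup_upper bounded_imp_bdd_above) (auto simp: compact_eq_bounded_closed)
qed

lemma supp_ge_opposite:
  assumes "compact A" "z \<in> A"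
  shows "- supp A (\<phi> + pi) \<le> Re (cis \<phi> * z)"
  using supp_ge[OF assms, of "\<phi> + pi"] by (simp add: cis_mult[symmetric])

lemma supp_periodic: "supp A (\<phi> + 2 * pi) = supp A \<phi>"
  by (simp add: supp_def cis_mult[symmetric])

text \<open>The support function of a set bounded by \<open>B\<close> changes by at most \<open>B\<close> times the change of the direction.\<close>
lemma supp_continuous:
  assumes "compact A" "A \<noteq> {}"
  shows "continuous_on X (supp A)"
proof -
  obtain B where B: "\<And>z. z \<in> A \<Longrightarrow> norm z \<le> B" 
    using compact_imp_bounded[OF assms(1)] by (auto simp: bounded_iff)
  have B0: "0 \<le> B" using assms B norm_ge_zero order_trans by blast
  have *: "supp A \<phi> \<le> supp A \<psi> + B * norm (cis \<phi> - cis \<psi>)" for \<phi> \<psi>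
  proof -
    obtain z where z: "z \<in> A" "Re (cis \<phi> * z) = supp A \<phi>" using supp_attained[OF assms] .
    have "Re (cis \<phi> * z) = Re (cis \<psi> * z) + Re ((cis \<phi> - cis \<psi>) * z)" by (simp add: algebra_simps)
    also have "Re ((cis \<phi> - cis \<psi>) * z) \<le> norm (cis \<phi> - cis \<psi>) * norm z"
      by (metis complex_Re_le_cmod norm_mult)
    also have "\<dots> \<le> norm (cis \<phi> - cis \<psi>) * B" using B z by (intro mult_left_mono) auto
    also have "Re (cis \<psi> * z) \<le> supp A \<psi>" using supp_ge assms z by auto
    finally show ?thesis using z by (simp add: mult.commute)
  qed
  have "isCont (supp A) x" for x
  proof -
    have "((\<lambda>\<phi>. B * norm (cis \<phi> - cis x)) \<longlongrightarrow> B * norm (cis x - cis x)) (at x)"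
      by (intro tendsto_intros continuous_on_tendsto_compose isCont_tendsto_compose[of _ cis] continuous_intros) (auto intro!: tendsto_eq_intros simp: isCont_def)
    then have "((\<lambda>\<phi>. B * norm (cis \<phi> - cis x)) \<longlongrightarrow> 0) (at x)" by simp
    then have "((\<lambda>\<phi>. supp A \<phi> - supp A x) \<longlongrightarrow> 0) (at x)"
    proof (rule Lim_null_comparison[rotated])
      show "\<forall>\<^sub>F \<phi> in at x. norm (supp A \<phi> - supp A x) \<le> B * norm (cis \<phi> - cis x)"
      proof (intro always_eventually allI)
        fix \<phi>
        show "norm (supp A \<phi> - supp A x) \<le> B * norm (cis \<phi> - cis x)"
          using *[of x \<phi>] *[of \<phi> x] by (simp add: abs_le_iff norm_minus_commute[of "cis x"])
      qed
    qed
    then show ?thesis unfolding isCont_def using LIM_zero_cancel by blast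
  qed
  then show ?thesis by (simp add: continuous_at_imp_continuous_on)
qed

lemma supp_attained_frontier:
  assumes "compact A" "A \<noteq> {}"
  obtains z where "z \<in> frontier A" "Re (cis \<phi> * z) = supp A \<phi>"
proof -
  obtain z where z: "z \<in> A" "Re (cis \<phi> * z) = supp A \<phi>" using supp_attained[OF assms] .
  have "z \<notin> interior A"
  proof
    assume "z \<in> interior A"
    then obtain e where e: "e > 0" "cball z e \<subseteq> A"
      by (meson mem_interior_cball)
    have "z + e *\<^sub>R cis (-\<phi>) \<in> A"
      using e by (intro subsetD[OF e(2)]) (simp add: dist_norm)
    from supp_ge[OF assms(1) this, of \<phi>] have "Re (cis \<phi> * z) + e * Re (cis \<phi> * cis (-\<phi>)) \<le> supp A \<phi>"
      by (simp add: algebra_simps)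
    then show False using z e by (simp add: cis_mult)
  qed
  then show ?thesis using that[OF _ z(2)] z(1) assms(1)
    by (simp add: frontier_def compact_imp_closed)
qed

text \<open>A convex body is homeomorphic to the disc, and its frontier corresponds to the circle.\<close>
lemma convex_boundary_is_simple_closed_curve:
  fixes K :: "complex set"
  assumes "convex K" "compact K" "interior K \<noteq> {}"
  shows "\<exists>g. simple_path g \<and> pathfinish g = pathstart g \<and> path_image g = frontier K"
proof -
  have "aff_dim K = aff_dim (cball (0::complex) 1)"
    using assms by (simp add: aff_dim_nonempty_interior aff_dim_cball)
  then have "rel_frontier (cball (0::complex) 1) homeomorphic rel_frontier K"
    using assms by (intro homeomorphic_rel_frontiers_convex_bounded_sets) (auto simp: compact_imp_bounded)
  then have "sphere (0::complex) 1 homeomorphic frontier K"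
    using assms by (simp add: rel_frontier_nonempty_interior)
  then obtain h k where h: "homeomorphism (sphere (0::complex) 1) (frontier K) h k"
    unfolding homeomorphic_def by blast
  define g where "g = (\<lambda>t. cis (2 * pi * t))"
  have g: "simple_path g"
    unfolding simple_path_def loop_free_def
  proof (intro conjI ballI impI)
    show "path g" unfolding path_def g_def by (intro continuous_intros)
    fix x y :: real assume xy: "x \<in> {0..1}" "y \<in> {0..1}" "g x = g y"
    then have "cis (2 * pi * (x - y)) = 1"
      by (simp add: g_def cis_divide[symmetric] right_diff_distrib)
    then have "cos (2 * pi * (x - y)) = 1" by (simp add: complex_eq_iff)
    then obtain n :: int where "2 * pi * (x - y) = of_int n * 2 * pi" by (auto simp: cos_one_2pi_int)
    then have n: "x - y = of_int n" by simp
    then have "-1 \<le> n" "n \<le> 1" using xy by auto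
    then have "n = -1 \<or> n = 0 \<or> n = 1" by auto
    then show "x = y \<or> x = 0 \<and> y = 1 \<or> x = 1 \<and> y = 0" using n xy by auto
  qed
  have im: "path_image g = sphere 0 1"
  proof
    show "path_image g \<subseteq> sphere 0 1" by (auto simp: path_image_def g_def)
    show "sphere 0 1 \<subseteq> path_image g"
    proof
      fix z :: complex assume "z \<in> sphere 0 1"
      then have "z = cis (Arg2pi z)" using complex_norm_eq_1_exp[of z] by (simp add: cis_conv_exp)
      then have "z = g (Arg2pi z / (2*pi))" by (simp add: g_def)
      then show "z \<in> path_image g"
        using Arg2pi_ge_0[of z] Arg2pi_lt_2pi[of z] by (auto simp: path_image_def intro!: image_eqI[of _ g "Arg2pi z / (2*pi)"])
    qed
  qed
  have "simple_path (h \<circ> g)"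
  proof (rule simple_path_continuous_image[OF g])
    show "continuous_on (path_image g) h" using h by (simp add: im homeomorphism_def)
    show "inj_on h (path_image g)" 
      by (rule inj_on_inverseI[of _ k]) (use h in \<open>auto simp: im homeomorphism_def\<close>)
  qed
  moreover have "pathfinish (h \<circ> g) = pathstart (h \<circ> g)"
    by (simp add: pathfinish_def pathstart_def g_def)
  moreover have "path_image (h \<circ> g) = frontier K"
    using h by (simp add: path_image_compose im homeomorphism_def)
  ultimately show ?thesis by blast
qed

text \<open>Both bounds come from integrating the variation of the projections. It is at most twice the width
  in every direction, since a line through the interior meets the boundary in two points. Conversely a fine
  partition comes close to the extreme points of all projections simultaneously, by uniform continuity.\<close>
lemma cauchy_crofton_length:
  assumes K: "convex K" "compact K" "interior K \<noteq> {}"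
    and g: "simple_path g" "pathfinish g = pathstart g" "path_image g = frontier K"
  shows "has_curve_length g (integral {0..2*pi} (supp K))"
proof -
  let ?L = "integral {0..2*pi} (supp K)"
  have ne: "K \<noteq> {}" using K by auto
  have cont: "continuous_on {0..1} g" using g(1) by (simp add: simple_path_def path_def)
  have gK: "g x \<in> K" "g x \<in> frontier K" if "x \<in> {0..1}" for x
  proof -
    show "g x \<in> frontier K" using g(3) that by (auto simp: path_image_def)
    then show "g x \<in> K" using K by (metis compact_imp_closed frontier_subset_closed subsetD)
  qed
  have cs: "continuous_on X (\<lambda>x. supp K (x + y))" for X y
    by (intro continuous_on_compose2[OF supp_continuous[OF K(2) ne, of UNIV]] continuous_intros) auto
  have intw: "integral {0..2*pi} (\<lambda>\<phi>. supp K \<phi> + supp K (\<phi> + pi)) = 2 * ?L"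
  proof -
    have "integral {0..2*pi} (\<lambda>\<phi>. supp K \<phi> + supp K (\<phi> + pi))
        = ?L + integral {0..2*pi} (\<lambda>\<phi>. supp K (\<phi> + pi))"
      using cs[of _ 0] cs[of _ pi] by (intro integral_add integrable_continuous_real) auto
    also have "integral {0..2*pi} (\<lambda>\<phi>. supp K (\<phi> + pi)) = ?L"
      using cs[of _ 0] by (intro periodic_integral_shift supp_periodic) auto
    finally show ?thesis by simp
  qed
  then have intw2: "integral {0..2*pi} (\<lambda>\<phi>. 2 * (supp K \<phi> + supp K (\<phi> + pi))) = 4 * ?L"
    by (simp only: integral_mult_right)
  define proj where "proj \<phi> x = Re (cis \<phi> * g x)" for \<phi> x
  have proj_diff: "proj \<phi> x - proj \<phi> y = Re (cis \<phi> * (g x - g y))" for \<phi> x y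
    by (simp add: proj_def right_diff_distrib)
  \<comment> \<open>The length of an inscribed polygon is a quarter of the integral of the variations of its projections.\<close>
  have len: "(\<Sum>i<n. dist (g (t i)) (g (t (Suc i))))
      = integral {0..2*pi} (\<lambda>\<phi>. \<Sum>i<n. \<bar>proj \<phi> (t (Suc i)) - proj \<phi> (t i)\<bar>) / 4" for n and t :: "nat \<Rightarrow> real"
  proof -
    have "dist (g (t i)) (g (t (Suc i)))
        = integral {0..2*pi} (\<lambda>\<phi>. \<bar>proj \<phi> (t (Suc i)) - proj \<phi> (t i)\<bar>) / 4" for i
      unfolding proj_diff using norm_eq_mean_projection[of "g (t (Suc i)) - g (t i)"]
      by (simp add: dist_norm norm_minus_commute)
    then have "(\<Sum>i<n. dist (g (t i)) (g (t (Suc i))))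
        = (\<Sum>i<n. integral {0..2*pi} (\<lambda>\<phi>. \<bar>proj \<phi> (t (Suc i)) - proj \<phi> (t i)\<bar>)) / 4"
      by (simp only: sum_divide_distrib)
    also have "(\<Sum>i<n. integral {0..2*pi} (\<lambda>\<phi>. \<bar>proj \<phi> (t (Suc i)) - proj \<phi> (t i)\<bar>))
        = integral {0..2*pi} (\<lambda>\<phi>. \<Sum>i<n. \<bar>proj \<phi> (t (Suc i)) - proj \<phi> (t i)\<bar>)"
      by (intro integral_sum[symmetric] integrable_continuous_real continuous_intros finite_lessThan)
        (auto simp: proj_def intro!: continuous_intros)
    finally show ?thesis .
  qed
  have intvar: "(\<lambda>\<phi>. \<Sum>i<n. \<bar>proj \<phi> (t (Suc i)) - proj \<phi> (t i)\<bar>) integrable_on {0..2*pi}" for n and t :: "nat \<Rightarrow> real"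
    unfolding proj_def by (intro integrable_continuous_real continuous_intros)
  have upper: "(\<Sum>i<n. dist (g (t i)) (g (t (Suc i)))) \<le> ?L"
    if t: "mono t" "range t \<subseteq> {0..1}" for n and t :: "nat \<Rightarrow> real"
  proof -
    have "(\<Sum>i<n. \<bar>proj \<phi> (t (Suc i)) - proj \<phi> (t i)\<bar>) \<le> 2 * (supp K \<phi> - - supp K (\<phi> + pi))" for \<phi>
    proof (rule variation_le_two_crossings[OF _ t])
      show "continuous_on {0..1} (proj \<phi>)"
        unfolding proj_def by (intro continuous_intros cont)
      show "- supp K (\<phi> + pi) \<le> proj \<phi> x \<and> proj \<phi> x \<le> supp K \<phi>" if "x \<in> {0..1}" for x
        unfolding proj_def using supp_ge supp_ge_opposite gK[OF that] K by blast
      fix c x y z assume c: "- supp K (\<phi> + pi) < c" "c < supp K \<phi>"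
        and xyz: "x \<in> {0<..<1}" "y \<in> {0<..<1}" "z \<in> {0<..<1}" "proj \<phi> x = c" "proj \<phi> y = c" "proj \<phi> z = c"
      have Re_inner: "Re (cis \<phi> * p) = p \<bullet> cis (-\<phi>)" for p
        by (simp add: inner_complex_def algebra_simps)
      obtain p where p: "p \<in> K" "Re (cis \<phi> * p) = supp K \<phi>" using supp_attained[OF K(2) ne] .
      obtain p' where p': "p' \<in> K" "Re (cis (\<phi> + pi) * p') = supp K (\<phi> + pi)" using supp_attained[OF K(2) ne] .
      have "Re (cis \<phi> * p') = - supp K (\<phi> + pi)" using p' by (simp add: cis_mult[symmetric])
      then have "p' \<bullet> cis (-\<phi>) < c" "c < p \<bullet> cis (-\<phi>)" using c p(2) unfolding Re_inner by linarith+
      then obtain q where q: "q \<in> interior K" "q \<bullet> cis (-\<phi>) = c"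
        using interior_meets_level[OF K p'(1) p(1), of "cis (-\<phi>)" c] by blast
      have "g x \<bullet> cis (-\<phi>) = c" "g y \<bullet> cis (-\<phi>) = c" "g z \<bullet> cis (-\<phi>) = c"
        using xyz(4-6) unfolding proj_def Re_inner by auto
      moreover have "g x \<in> frontier K" "g y \<in> frontier K" "g z \<in> frontier K"
        using gK(2) xyz(1-3) by auto
      ultimately have "g x = g y \<or> g x = g z \<or> g y = g z"
        using convex_frontier_line_two_points[OF K(1,2) q] by (metis cis_neq_zero)
      then show "x = y \<or> x = z \<or> y = z"
        using simple_path_inj_on[OF g(1)] xyz by (auto simp: inj_on_def)
    qed
    then have "integral {0..2*pi} (\<lambda>\<phi>. \<Sum>i<n. \<bar>proj \<phi> (t (Suc i)) - proj \<phi> (t i)\<bar>)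
      \<le> integral {0..2*pi} (\<lambda>\<phi>. 2 * (supp K \<phi> + supp K (\<phi> + pi)))"
      using cs[of _ 0] cs[of _ pi]
      by (intro integral_le intvar integrable_continuous_real continuous_intros) auto
    then show ?thesis unfolding len intw2 by simp
  qed
  have lower: "\<exists>n t. mono t \<and> range t \<subseteq> {0..1} \<and> ?L - 2 * pi * \<epsilon> \<le> (\<Sum>i<n. dist (g (t i)) (g (t (Suc i))))"
    if "\<epsilon> > 0" for \<epsilon>
  proof -
    have "uniformly_continuous_on {0..1} g" using cont by (intro compact_uniformly_continuous) auto
    then obtain \<delta> where \<delta>: "\<delta> > 0" "\<And>x y. x \<in> {0..1} \<Longrightarrow> y \<in> {0..1} \<Longrightarrow> dist y x < \<delta> \<Longrightarrow> dist (g y) (g x) < \<epsilon>"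
      using \<open>\<epsilon> > 0\<close> unfolding uniformly_continuous_on_def by metis
    obtain n where n: "n > 0" "1 / real n < \<delta>"
      using ex_inverse_of_nat_less[OF \<delta>(1)] by (auto simp: inverse_eq_divide)
    \<comment> \<open>The equidistant partition into \<open>n\<close> parts, constant after the end point.\<close>
    define t where "t i = min (real i / real n) 1" for i
    have t: "mono t" "range t \<subseteq> {0..1}"
      by (auto simp: t_def mono_def min_le_iff_disj divide_right_mono)
    have near: "\<exists>i\<le>n. dist (g x) (g (t i)) < \<epsilon>" if "x \<in> {0..1}" for x
    proof -
      define i where "i = nat \<lfloor>x * n\<rfloor>"
      have i: "real i \<le> x * n" "x * n < real i + 1" using that n by (auto simp: i_def)
      have "real i \<le> real n" using i(1) that n by (smt (verit) atLeastAtMost_iff mult_left_le_one_le of_nat_0_le_iff)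
      then have ti: "t i = real i / n" "i \<le> n" using n by (auto simp: t_def)
      have "dist x (t i) < 1 / n + 0 \<or> dist x (t i) < \<delta>"
        using i n by (auto simp: ti dist_real_def abs_if field_simps)
      then have "dist x (t i) < \<delta>" using n by auto
      then have "dist (g x) (g (t i)) < \<epsilon>" using \<delta>(2)[of "t i" x] that subsetD[OF t(2) rangeI, of i] by simp
      with ti show ?thesis by auto
    qed
    have "2 * (supp K \<phi> + supp K (\<phi> + pi)) - 4 * \<epsilon> \<le> (\<Sum>i<n. \<bar>proj \<phi> (t (Suc i)) - proj \<phi> (t i)\<bar>)" for \<phi>
    proof -
      have app: "\<exists>i\<le>n. supp K \<psi> - \<epsilon> \<le> Re (cis \<psi> * g (t i))" for \<psi>
      proof -
        obtain z where z: "z \<in> frontier K" "Re (cis \<psi> * z) = supp K \<psi>"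
          using supp_attained_frontier[OF K(2) ne] .
        then have "z \<in> g ` {0..1}" using g(3) by (simp add: path_image_def)
        then obtain x where x: "x \<in> {0..1}" "z = g x" by blast
        obtain i where i: "i \<le> n" "dist (g x) (g (t i)) < \<epsilon>" using near[OF x(1)] by blast
        have "Re (cis \<psi> * (z - g (t i))) \<le> norm (cis \<psi> * (z - g (t i)))" by (rule complex_Re_le_cmod)
        also have "\<dots> < \<epsilon>" using i x by (simp add: norm_mult dist_norm)
        finally have "supp K \<psi> - \<epsilon> \<le> Re (cis \<psi> * g (t i))" using z by (simp add: right_diff_distrib)
        with i show ?thesis by blast
      qed
      obtain i where i: "i \<le> n" "supp K \<phi> - \<epsilon> \<le> proj \<phi> (t i)" using app[of \<phi>] by (auto simp: proj_def)
      obtain j where j: "j \<le> n" "supp K (\<phi> + pi) - \<epsilon> \<le> - proj \<phi> (t j)"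
        using app[of "\<phi> + pi"] by (auto simp: proj_def cis_mult[symmetric])
      have "proj \<phi> (t 0) = proj \<phi> (t n)"
        using g(2) n by (simp add: proj_def t_def pathfinish_def pathstart_def)
      from variation_closed_ge[where F = "\<lambda>i. proj \<phi> (t i)", OF this i(1) j(1)] i j show ?thesis by simp
    qed
    then have "integral {0..2*pi} (\<lambda>\<phi>. 2 * (supp K \<phi> + supp K (\<phi> + pi)) - 4 * \<epsilon>)
        \<le> integral {0..2*pi} (\<lambda>\<phi>. \<Sum>i<n. \<bar>proj \<phi> (t (Suc i)) - proj \<phi> (t i)\<bar>)"
      using cs[of _ 0] cs[of _ pi]
      by (intro integral_le intvar integrable_continuous_real continuous_intros) auto
    also have "integral {0..2*pi} (\<lambda>\<phi>. 2 * (supp K \<phi> + supp K (\<phi> + pi)) - 4 * \<epsilon>)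
       = integral {0..2*pi} (\<lambda>\<phi>. 2 * (supp K \<phi> + supp K (\<phi> + pi))) - integral {0..2*pi} (\<lambda>\<phi>. 4 * \<epsilon>)"
      using cs[of _ 0] cs[of _ pi]
      by (intro integral_diff integrable_continuous_real continuous_intros) auto
    finally have "?L - 2 * pi * \<epsilon> \<le> (\<Sum>i<n. dist (g (t i)) (g (t (Suc i))))"
      unfolding len intw2 by simp
    with t show ?thesis by blast
  qed
  define S where "S = {\<Sum>i<n. dist (g (t i)) (g (t (Suc i))) | (n::nat) (t :: nat \<Rightarrow> real). mono t \<and> range t \<subseteq> {0..1}}"
  have up: "x \<le> ?L" if "x \<in> S" for x using that upper unfolding S_def by auto
  have "?L = Sup S"
  proof (rule antisym)
    show "Sup S \<le> ?L"
    proof (rule cSup_least[OF _ up])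
      have "0 \<in> S" unfolding S_def
        by (rule CollectI, rule exI[of _ 0], rule exI[of _ "\<lambda>_. 0"]) (auto simp: mono_def)
      then show "S \<noteq> {}" by auto
    qed
    show "?L \<le> Sup S"
    proof (rule field_le_epsilon)
      fix e :: real assume "e > 0"
      then obtain n t where "mono t" "range t \<subseteq> {0..1}"
         "?L - e \<le> (\<Sum>i<n. dist (g (t i)) (g (t (Suc i))))"
        using lower[of "e / (2 * pi)"] by auto
      then obtain x where "x \<in> S" "?L - e \<le> x" unfolding S_def by blast
      moreover have "bdd_above S" using up by (auto simp: bdd_above_def)
      ultimately show "?L \<le> Sup S + e" using cSup_upper[of x S] by auto
    qed
  qed
  moreover have "bdd_above S" using up by (auto simp: bdd_above_def)
  ultimately show ?thesis unfolding has_curve_length_def S_def Let_def by blast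
qed

text \<open>The length does not depend on the parametrisation, so the definite description in
  \<^const>\<open>perimeter\<close> denotes it.\<close>
lemma perimeter_eq_integral_supp:
  assumes K: "convex K" "compact K" "interior K \<noteq> {}"
  shows "perimeter K = integral {0..2*pi} (supp K)"
proof -
  have uniq: "l = l'" if "has_curve_length g l" "has_curve_length g l'" for g l l'
    using that by (simp add: has_curve_length_def Let_def)
  show ?thesis unfolding perimeter_def
    using convex_boundary_is_simple_closed_curve[OF K] cauchy_crofton_length[OF K] uniq
    by (intro the_equality) blast+
qed

section \<open>The lattice in affine coordinates\<close>

text \<open>A triangle is named by the integer parts \<open>(i, j, k)\<close> of the three coordinates in its interior. As the
  third coordinate is the sum of the first two, \<open>k - i - j\<close> is 0 or 1, and this distinguishes the two
  triangles in a parallelogram.\<close>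
definition tri_index :: "(int \<times> int \<times> int) set" where
  "tri_index = {(i, j, k). k = i + j \<or> k = i + j + 1}"

locale triangle_lattice =
  fixes a b c \<alpha> \<beta> \<gamma> :: real
  assumes data: "triangle_data a b c \<alpha> \<beta> \<gamma>"
begin

lemmas triangle_facts = triangle_data_facts[OF data]

definition area :: real where "area = a * b * sin \<gamma>"

lemma sin_pos: "0 < sin \<alpha>" "0 < sin \<beta>" "0 < sin \<gamma>"
  using triangle_facts by (auto intro: sin_gt_zero)

lemma area_pos: "0 < area"
  using triangle_facts sin_pos by (simp add: area_def)

lemma area_eq: "area = b * c * sin \<alpha>" "area = c * a * sin \<beta>"
proof -
  show "area = b * c * sin \<alpha>" using triangle_facts by (simp add: area_def)
  then show "area = c * a * sin \<beta>" using triangle_facts by simp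
qed

text \<open>The foot of the altitude divides the side \<open>c\<close>. This relation is what makes the three families of lines
  meet in common vertices.\<close>
lemma projection_law: "c = a * cos \<beta> + b * cos \<alpha>"
proof -
  have "\<gamma> = pi - (\<alpha> + \<beta>)" using triangle_facts by simp
  then have "sin \<gamma> = sin \<alpha> * cos \<beta> + cos \<alpha> * sin \<beta>" by (simp add: sin_add)
  then have "c * sin \<alpha> = a * (sin \<alpha> * cos \<beta>) + cos \<alpha> * (a * sin \<beta>)"
    using triangle_facts(12) by (simp add: algebra_simps)
  then have "c * sin \<alpha> = (a * cos \<beta> + b * cos \<alpha>) * sin \<alpha>"
    using triangle_facts(11) by (simp add: algebra_simps)
  then show ?thesis using sin_pos by simp
qed

definition pu :: "complex \<Rightarrow> real" where "pu z = b * (Re z * sin \<alpha> - Im z * cos \<alpha>) / area"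
definition pv :: "complex \<Rightarrow> real" where "pv z = c * Im z / area"
definition pw :: "complex \<Rightarrow> real" where "pw z = a * (Re z * sin \<beta> + Im z * cos \<beta>) / area"

text \<open>The lines of the first family are the level lines of the sum of the other two coordinates; the whole
  combinatorics of the lattice rests on this.\<close>
lemma pw_eq: "pw z = pu z + pv z"
proof -
  have "a * (Re z * sin \<beta> + Im z * cos \<beta>) = b * (Re z * sin \<alpha>) + Im z * (a * cos \<beta>)"
    using triangle_facts(11) by (simp add: algebra_simps)
  also have "a * cos \<beta> = c - b * cos \<alpha>" using projection_law by simp
  finally show ?thesis by (simp add: pw_def pu_def pv_def add_divide_distrib[symmetric] algebra_simps)
qed

definition point :: "real \<Rightarrow> real \<Rightarrow> complex" where
  "point u v = Complex (c * u + v * area / c * cot \<alpha>) (v * area / c)"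

lemma pu_point [simp]: "pu (point u v) = u"
  using area_pos sin_pos triangle_facts area_eq(1)
  by (simp add: pu_def point_def cot_def field_simps)

lemma pv_point [simp]: "pv (point u v) = v"
  using area_pos triangle_facts by (simp add: pv_def point_def)

lemma pw_point [simp]: "pw (point u v) = u + v"
  by (simp add: pw_eq)

lemma coordinates_inject: "pu z = pu z' \<Longrightarrow> pv z = pv z' \<Longrightarrow> z = z'"
  using area_pos sin_pos triangle_facts by (auto simp: pu_def pv_def complex_eq_iff)

lemma point_coordinates [simp]: "point (pu z) (pv z) = z"
  by (rule coordinates_inject) simp_all

lemma linear_coordinates: "linear pu" "linear pv" "linear pw"
  by (auto intro!: linearI simp: pu_def pv_def pw_def algebra_simps add_divide_distrib diff_divide_distrib)

lemma pu_add [simp]: "pu (x + y) = pu x + pu y" and pv_add [simp]: "pv (x + y) = pv x + pv y"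
  and pw_add [simp]: "pw (x + y) = pw x + pw y"
  using linear_coordinates by (auto simp: linear_add)

lemma pu_scale [simp]: "pu (t *\<^sub>R x) = t * pu x" and pv_scale [simp]: "pv (t *\<^sub>R x) = t * pv x"
  and pw_scale [simp]: "pw (t *\<^sub>R x) = t * pw x"
  using linear_coordinates by (auto simp: linear_cmul)

lemma continuous_coordinates [continuous_intros]:
  "continuous_on X f \<Longrightarrow> continuous_on X (\<lambda>x. pu (f x))"
  "continuous_on X f \<Longrightarrow> continuous_on X (\<lambda>x. pv (f x))"
  "continuous_on X f \<Longrightarrow> continuous_on X (\<lambda>x. pw (f x))"
  unfolding pu_def pv_def pw_def by (intro continuous_intros; simp add: area_pos less_imp_neq[symmetric])+

definition tri :: "int \<times> int \<times> int \<Rightarrow> complex set" where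
  "tri = (\<lambda>(i :: int, j :: int, k :: int). {z. i \<le> pu z \<and> pu z \<le> i + 1 \<and> j \<le> pv z \<and> pv z \<le> j + 1 \<and> k \<le> pw z \<and> pw z \<le> k + 1})"

definition open_tri :: "int \<times> int \<times> int \<Rightarrow> complex set" where
  "open_tri = (\<lambda>(i :: int, j :: int, k :: int). {z. i < pu z \<and> pu z < i + 1 \<and> j < pv z \<and> pv z < j + 1 \<and> k < pw z \<and> pw z < k + 1})"

lemma lattice_lines_eq:
  "lattice_lines a b c \<alpha> \<beta> \<gamma> = {z. pu z \<in> \<int> \<or> pv z \<in> \<int> \<or> pw z \<in> \<int>}"
proof -
  have [simp]: "b * sin \<gamma> = area / a" "a * sin \<gamma> = area / b" "a * sin \<beta> = area / c"
    using triangle_facts area_eq by (simp_all add: area_def field_simps)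
  have u: "(Re z * sin \<alpha> - Im z * cos \<alpha> = of_int k * (area / b)) = (pu z = of_int k)"
   and v: "(Im z = of_int k * (area / c)) = (pv z = of_int k)"
   and w: "(Re z * sin \<beta> + Im z * cos \<beta> = of_int k * (area / a)) = (pw z = of_int k)" for z k
    using area_pos triangle_facts(1-3) by (auto simp: pu_def pv_def pw_def field_simps)
  show ?thesis
    unfolding lattice_lines_def Let_def \<open>b * sin \<gamma> = _\<close> \<open>a * sin \<gamma> = _\<close> \<open>a * sin \<beta> = _\<close> u v w
    by (auto simp: Ints_def)
qed

definition centre :: "int \<times> int \<times> int \<Rightarrow> complex" where
  "centre = (\<lambda>(i :: int, j :: int, k :: int). if k = i + j then point (i + 1/3) (j + 1/3) else point (i + 2/3) (j + 2/3))"

lemma centre_in: "x \<in> tri_index \<Longrightarrow> centre x \<in> open_tri x"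
  by (auto simp: tri_index_def centre_def open_tri_def)

lemma tri_eq_if_meets_open:
  assumes "z \<in> open_tri x" "z \<in> tri y"
  shows "x = y"
proof -
  obtain i j k i' j' k' where x: "x = (i, j, k)" and y: "y = (i', j', k')" by (metis surj_pair)
  show ?thesis
    using assms unfolding x y open_tri_def tri_def by auto
qed

lemma open_tri_subset: "open_tri x \<subseteq> tri x"
  by (auto simp: open_tri_def tri_def split: prod.splits)

lemma Union_open_tri: "\<Union> (open_tri ` tri_index) = - lattice_lines a b c \<alpha> \<beta> \<gamma>"
proof -
  have int: "x \<notin> \<int>" if "of_int i < x" "x < of_int i + 1" for x :: real and i
    using that by (auto elim!: Ints_cases)
  have fl: "of_int \<lfloor>x\<rfloor> < x" "x < of_int \<lfloor>x\<rfloor> + 1" if "x \<notin> \<int>" for x :: real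
    using that of_int_floor_le[of x] Ints_of_int[of "\<lfloor>x\<rfloor>"] real_of_int_floor_add_one_gt[of x]
    by (auto simp: less_le)
  have "z \<in> \<Union> (open_tri ` tri_index)" if "pu z \<notin> \<int>" "pv z \<notin> \<int>" "pw z \<notin> \<int>" for z
  proof -
    have *: "of_int \<lfloor>pu z\<rfloor> < pu z" "pu z < of_int \<lfloor>pu z\<rfloor> + 1" "of_int \<lfloor>pv z\<rfloor> < pv z" "pv z < of_int \<lfloor>pv z\<rfloor> + 1"
       "of_int \<lfloor>pw z\<rfloor> < pw z" "pw z < of_int \<lfloor>pw z\<rfloor> + 1"
      using fl that by auto
    have "real_of_int \<lfloor>pw z\<rfloor> < of_int (\<lfloor>pu z\<rfloor> + \<lfloor>pv z\<rfloor> + 2)" "real_of_int (\<lfloor>pu z\<rfloor> + \<lfloor>pv z\<rfloor> - 1) < of_int \<lfloor>pw z\<rfloor>"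
      using * pw_eq[of z] by (simp_all only: of_int_add of_int_diff of_int_numeral of_int_1)
    then have "\<lfloor>pw z\<rfloor> < \<lfloor>pu z\<rfloor> + \<lfloor>pv z\<rfloor> + 2" "\<lfloor>pu z\<rfloor> + \<lfloor>pv z\<rfloor> - 1 < \<lfloor>pw z\<rfloor>"
      unfolding of_int_less_iff by auto
    then have "(\<lfloor>pu z\<rfloor>, \<lfloor>pv z\<rfloor>, \<lfloor>pw z\<rfloor>) \<in> tri_index"
      by (auto simp: tri_index_def)
    moreover have "z \<in> open_tri (\<lfloor>pu z\<rfloor>, \<lfloor>pv z\<rfloor>, \<lfloor>pw z\<rfloor>)"
      using * by (simp add: open_tri_def)
    ultimately show ?thesis by blast
  qed
  moreover have "pu z \<notin> \<int> \<and> pv z \<notin> \<int> \<and> pw z \<notin> \<int>" if "z \<in> open_tri x" for z x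
    using that int by (cases x) (auto simp: open_tri_def)
  ultimately show ?thesis unfolding lattice_lines_eq by blast
qed

lemma open_open_tri: "open (open_tri x)"
  by (cases x) (auto simp: open_tri_def intro!: open_Collect_conj open_Collect_less continuous_intros continuous_on_id)

lemma closed_tri: "closed (tri x)"
  by (cases x) (auto simp: tri_def intro!: closed_Collect_conj closed_Collect_le continuous_intros continuous_on_id)

lemma strict_convex_combination:
  fixes x y l t :: real
  assumes "0 < t" "t \<le> 1"
  shows "l \<le> x \<Longrightarrow> l < y \<Longrightarrow> l < (1 - t) * x + t * y"
    and "x \<le> l \<Longrightarrow> y < l \<Longrightarrow> (1 - t) * x + t * y < l"
proof -
  assume "l \<le> x" "l < y"
  then have "0 \<le> (1 - t) * (x - l)" "0 < t * (y - l)" using assms by auto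
  then show "l < (1 - t) * x + t * y" by (auto simp: algebra_simps)
next
  assume "x \<le> l" "y < l"
  then have "0 \<le> (1 - t) * (l - x)" "0 < t * (l - y)" using assms by auto
  then show "(1 - t) * x + t * y < l" by (auto simp: algebra_simps)
qed

lemma open_tri_segment:
  assumes "z \<in> tri x" "q \<in> open_tri x" "0 < t" "t \<le> 1"
  shows "(1 - t) *\<^sub>R z + t *\<^sub>R q \<in> open_tri x"
proof -
  obtain i j k where x: "x = (i, j, k)" by (metis surj_pair)
  show ?thesis
    using assms unfolding x tri_def open_tri_def
    by (simp del: of_int_add add: strict_convex_combination)
qed

lemma convex_open_tri: "convex (open_tri x)"
proof (rule convexI)
  fix y z and s t :: real
  assume yz: "y \<in> open_tri x" "z \<in> open_tri x" and st: "0 \<le> s" "0 \<le> t" "s + t = 1"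
  show "s *\<^sub>R y + t *\<^sub>R z \<in> open_tri x"
  proof (cases "t = 0")
    case True then show ?thesis using yz st by simp
  next
    case False
    then show ?thesis using open_tri_segment[of y x z t] yz st open_tri_subset[of x]
      by (metis add_diff_cancel_right' le_add_same_cancel2 order_le_less subsetD)
  qed
qed

lemma closure_open_tri:
  assumes "x \<in> tri_index" shows "closure (open_tri x) = tri x"
proof
  show "closure (open_tri x) \<subseteq> tri x"
    by (intro closure_minimal open_tri_subset closed_tri)
  show "tri x \<subseteq> closure (open_tri x)"
  proof
    fix z assume z: "z \<in> tri x"
    define f where "f t = (1 - t) *\<^sub>R z + t *\<^sub>R centre x" for t :: real
    have "(f \<longlongrightarrow> f 0) (at_right 0)"
      unfolding f_def by (intro tendsto_intros)
    moreover have "\<forall>\<^sub>F t in at_right 0. f t \<in> closure (open_tri x)"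
    proof -
      have "\<forall>\<^sub>F t in at_right (0::real). t \<in> {0<..<1}" by (rule eventually_at_right_real) simp
      then show ?thesis
      proof eventually_elim
        case (elim t)
        then show ?case using open_tri_segment[OF z centre_in[OF assms], of t] closure_subset[of "open_tri x"]
          by (auto simp: f_def)
      qed
    qed
    ultimately have "f 0 \<in> closure (open_tri x)"
      by (intro Lim_in_closed_set[of _ f]) auto
    then show "z \<in> closure (open_tri x)" by (simp add: f_def)
  qed
qed

text \<open>The open triangles are connected, disjoint, and exhaust the complement of the lines; so they are
  its components, and the triangles of the lattice are their closures.\<close>
lemma lattice_triangles_eq: "lattice_triangles a b c \<alpha> \<beta> \<gamma> = tri ` tri_index"
proof -
  have "components (- lattice_lines a b c \<alpha> \<beta> \<gamma>) = open_tri ` tri_index"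
  proof (rule components_open_unique[OF _ Union_open_tri])
    show "pairwise disjnt (open_tri ` tri_index)"
    proof (rule pairwiseI)
      fix X Y assume XY: "X \<in> open_tri ` tri_index" "Y \<in> open_tri ` tri_index" "X \<noteq> Y"
      then obtain x y where "X = open_tri x" "Y = open_tri y" by blast
      with XY(3) have "X = open_tri x" "Y = open_tri y" "x \<noteq> y" by auto
      then show "disjnt X Y"
        using tri_eq_if_meets_open open_tri_subset unfolding disjnt_def by blast
    qed
    fix X assume "X \<in> open_tri ` tri_index"
    then show "open X \<and> connected X \<and> X \<noteq> {}"
      using centre_in open_open_tri convex_open_tri convex_connected by blast
  qed
  moreover have "closure ` open_tri ` tri_index = tri ` tri_index"
    unfolding image_image by (intro image_cong refl closure_open_tri)
  ultimately show ?thesis by (simp only: lattice_triangles_def)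
qed

lemma inj_on_tri: "inj_on tri tri_index"
  using centre_in open_tri_subset tri_eq_if_meets_open by (intro inj_onI) blast

definition hit_index :: "complex set \<Rightarrow> (int \<times> int \<times> int) set" where
  "hit_index S = {x \<in> tri_index. S \<inter> tri x \<noteq> {}}"

lemma triangles_hit_eq: "triangles_hit (lattice_triangles a b c \<alpha> \<beta> \<gamma>) S = card (hit_index S)"
proof -
  have "{T \<in> tri ` tri_index. S \<inter> T \<noteq> {}} = tri ` hit_index S" by (auto simp: hit_index_def)
  moreover have "inj_on tri (hit_index S)"
    using inj_on_tri by (rule inj_on_subset) (auto simp: hit_index_def)
  ultimately show ?thesis
    unfolding triangles_hit_def lattice_triangles_eq by (simp add: card_image)
qed

end

section \<open>Counting the triangles met by a convex set\<close>

text \<open>A set in general position either lies strictly between two consecutive levels of a coordinate, or reaches strictly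
  beyond both sides of one level and of no other.\<close>
definition misses :: "('a \<Rightarrow> real) \<Rightarrow> 'a set \<Rightarrow> int \<Rightarrow> bool" where
  "misses f S k \<longleftrightarrow> (\<forall>z\<in>S. k < f z \<and> f z < k + 1)"

definition crosses :: "('a \<Rightarrow> real) \<Rightarrow> 'a set \<Rightarrow> int \<Rightarrow> bool" where
  "crosses f S k \<longleftrightarrow> (\<forall>z\<in>S. k - 1 < f z \<and> f z < k + 1) \<and>
     (\<exists>z\<in>S. f z < k) \<and> (\<exists>z\<in>S. f z = k) \<and> (\<exists>z\<in>S. k < f z)"

text \<open>The triangles met by \<open>S\<close>, with two arbitrary functions in place of the lattice coordinates. In this
  generality the symmetries of the lattice that permute the three families of lines act on the statements.\<close>
definition cells_met :: "('a \<Rightarrow> real) \<Rightarrow> ('a \<Rightarrow> real) \<Rightarrow> 'a set \<Rightarrow> (int \<times> int \<times> int) set" where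
  "cells_met f g S = {(i, j, k) \<in> tri_index. \<exists>z\<in>S. of_int i \<le> f z \<and> f z \<le> of_int i + 1 \<and>
     of_int j \<le> g z \<and> g z \<le> of_int j + 1 \<and> of_int k \<le> f z + g z \<and> f z + g z \<le> of_int k + 1}"

lemma cells_metI:
  "z \<in> S \<Longrightarrow> i \<le> f z \<Longrightarrow> f z \<le> i + 1 \<Longrightarrow> j \<le> g z \<Longrightarrow> g z \<le> j + 1 \<Longrightarrow> k \<le> f z + g z \<Longrightarrow> f z + g z \<le> k + 1
    \<Longrightarrow> k = i + j \<or> k = i + j + 1 \<Longrightarrow> (i, j, k) \<in> cells_met f g S" for f g :: "'a \<Rightarrow> real" and i j k :: int
  by (auto simp: cells_met_def tri_index_def)

lemma misses_index_bound:
  assumes "misses f S k"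
  shows "\<forall>z\<in>S. \<forall>m. of_int m \<le> f z \<and> f z \<le> of_int m + 1 \<longrightarrow> m \<in> {k}"
proof (intro ballI allI impI)
  fix z m assume z: "z \<in> S" and m: "of_int m \<le> f z \<and> f z \<le> of_int m + 1"
  from assms z have "of_int k < f z \<and> f z < of_int k + 1" by (simp add: misses_def)
  with m have "real_of_int m < of_int (k + 1)" "real_of_int k < of_int (m + 1)"
    unfolding of_int_add of_int_1 by linarith+
  then show "m \<in> {k}" unfolding of_int_less_iff by simp
qed

lemma crosses_index_bound:
  assumes "crosses f S k"
  shows "\<forall>z\<in>S. \<forall>m. of_int m \<le> f z \<and> f z \<le> of_int m + 1 \<longrightarrow> m \<in> {k, k - 1}"
proof (intro ballI allI impI)
  fix z m assume z: "z \<in> S" and m: "of_int m \<le> f z \<and> f z \<le> of_int m + 1"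
  from assms z have "of_int k - 1 < f z \<and> f z < of_int k + 1" by (simp add: crosses_def)
  with m have "real_of_int m < of_int (k + 1)" "real_of_int (k - 1) < of_int (m + 1)"
    unfolding of_int_add of_int_diff of_int_1 by linarith+
  then show "m \<in> {k, k - 1}" unfolding of_int_less_iff by auto
qed

lemma cells_met_bound:
  assumes "\<forall>z\<in>S. \<forall>m. of_int m \<le> f z \<and> f z \<le> of_int m + 1 \<longrightarrow> m \<in> I"
    and "\<forall>z\<in>S. \<forall>m. of_int m \<le> g z \<and> g z \<le> of_int m + 1 \<longrightarrow> m \<in> J"
    and "\<forall>z\<in>S. \<forall>m. of_int m \<le> f z + g z \<and> f z + g z \<le> of_int m + 1 \<longrightarrow> m \<in> K"
  shows "cells_met f g S \<subseteq> I \<times> J \<times> K \<inter> tri_index"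
  using assms by (fastforce simp: cells_met_def)

lemma misses_uminus: "misses f S k \<Longrightarrow> misses (\<lambda>z. - f z) S (- k - 1)"
  by (force simp: misses_def)

lemma crosses_uminus: "crosses f S k \<Longrightarrow> crosses (\<lambda>z. - f z) S (- k)"
  unfolding crosses_def by force

lemma card_cells_met_swap: "card (cells_met g f S) = card (cells_met f g S)"
proof -
  have "bij_betw (\<lambda>(i, j, k). (j, i, k)) (cells_met g f S) (cells_met f g S)"
    by (rule bij_betw_byWitness[where f' = "\<lambda>(i, j, k). (j, i, k)"])
      (auto simp: cells_met_def tri_index_def add.commute)
  then show ?thesis by (rule bij_betw_same_card)
qed

text \<open>The coordinates \<open>f + g\<close> and \<open>- g\<close> have the sum \<open>f\<close>, so this symmetry permutes the three families of lines
  cyclically, up to orientation. The reflection turns the interval from \<open>j\<close> to \<open>j + 1\<close> into the one that starts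
  at \<open>- j - 1\<close>.\<close>
lemma card_cells_met_rotate: "card (cells_met (\<lambda>z. f z + g z) (\<lambda>z. - g z) S) = card (cells_met f g S)"
proof -
  have "bij_betw (\<lambda>(i, j, k). (k, - j - 1, i)) (cells_met f g S) (cells_met (\<lambda>z. f z + g z) (\<lambda>z. - g z) S)"
    by (rule bij_betw_byWitness[where f' = "\<lambda>(i, j, k). (k, - j - 1, i)"])
      (auto simp: cells_met_def tri_index_def; force)+
  then show ?thesis by (rule bij_betw_same_card[symmetric])
qed

lemma cells_met_no_line:
  assumes "S \<noteq> {}" and u: "misses f S i" and v: "misses g S j" and w: "misses (\<lambda>z. f z + g z) S k"
  shows "card (cells_met f g S) = 1"
proof -
  note bound = cells_met_bound[OF misses_index_bound[OF u] misses_index_bound[OF v] misses_index_bound[OF w]]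
  obtain z where z: "z \<in> S" using assms(1) by auto
  have zz: "i < f z" "f z < i + 1" "j < g z" "g z < j + 1" "k < f z + g z" "f z + g z < k + 1"
    using z u v w by (auto simp: misses_def)
  have "real_of_int k < of_int (i + j + 2)" "real_of_int (i + j) < of_int (k + 1)"
    unfolding of_int_add of_int_numeral of_int_1 using zz by linarith+
  then have k: "k = i + j \<or> k = i + j + 1" unfolding of_int_less_iff by linarith
  have "cells_met f g S = {(i, j, k)}"
  proof (intro equalityI subsetI)
    fix x assume "x \<in> cells_met f g S"
    then show "x \<in> {(i, j, k)}" using bound k by (auto simp: tri_index_def)
  next
    fix x assume "x \<in> {(i, j, k)}"
    then show "x \<in> cells_met f g S" using zz k by (auto intro!: cells_metI[OF z])
  qed
  then show ?thesis by simp
qed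

lemma cells_met_one_line:
  assumes u: "crosses f S i" and v: "misses g S j" and w: "misses (\<lambda>z. f z + g z) S k"
  shows "card (cells_met f g S) = 2"
proof -
  note bound = cells_met_bound[OF crosses_index_bound[OF u] misses_index_bound[OF v] misses_index_bound[OF w]]
  obtain z z' z0 where z: "z \<in> S" "f z < i" and z': "z' \<in> S" "i < f z'" and z0: "z0 \<in> S" "f z0 = i"
    using u by (auto simp: crosses_def)
  have B: "i - 1 < f y" "f y < i + 1" "j < g y" "g y < j + 1" "k < f y + g y" "f y + g y < k + 1"
    if "y \<in> S" for y
    using that u v w by (auto simp: misses_def crosses_def)
  have "real_of_int k < of_int (i + j + 1)" "real_of_int (i + j) < of_int (k + 1)"
    unfolding of_int_add of_int_numeral of_int_1 using B[OF z0(1)] z0 by linarith+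
  then have k: "k = i + j" unfolding of_int_less_iff by linarith
  have "cells_met f g S = {(i, j, k), (i - 1, j, k)}"
  proof (intro equalityI subsetI)
    fix x assume "x \<in> cells_met f g S"
    then show "x \<in> {(i, j, k), (i - 1, j, k)}" using bound k by (auto simp: tri_index_def)
  next
    have "(i, j, k) \<in> cells_met f g S" using k z'(2) B[OF z'(1)] by (intro cells_metI[OF z'(1)]) auto
    moreover have "(i - 1, j, k) \<in> cells_met f g S" using k z(2) B[OF z(1)] by (intro cells_metI[OF z(1)]) auto
    moreover fix x assume "x \<in> {(i, j, k), (i - 1, j, k)}"
    ultimately show "x \<in> cells_met f g S" by auto
  qed
  then show ?thesis by simp
qed

text \<open>The two lines cross in the vertex \<open>(i, j)\<close>, through which the level \<open>i + j\<close> of the sum passes. It is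
  not met, so the set lies on one side of it, and there the quadrant beyond the vertex is out of reach.\<close>
lemma cells_met_two_lines:
  assumes u: "crosses f S i" and v: "crosses g S j" and w: "misses (\<lambda>z. f z + g z) S k"
  shows "card (cells_met f g S) = 3"
proof -
  note bound = cells_met_bound[OF crosses_index_bound[OF u] crosses_index_bound[OF v] misses_index_bound[OF w]]
  obtain a1 a2 a0 where a: "a1 \<in> S" "f a1 < i" "a2 \<in> S" "i < f a2" "a0 \<in> S" "f a0 = i"
    using u by (auto simp: crosses_def)
  obtain b1 b2 b0 where b: "b1 \<in> S" "g b1 < j" "b2 \<in> S" "j < g b2" "b0 \<in> S" "g b0 = j"
    using v by (auto simp: crosses_def)
  have B: "i - 1 < f y" "f y < i + 1" "j - 1 < g y" "g y < j + 1" "k < f y + g y" "f y + g y < k + 1"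
    if "y \<in> S" for y
    using that u v w by (auto simp: misses_def crosses_def)
  have "real_of_int k < of_int (i + j + 1)" "real_of_int (i + j - 1) < of_int (k + 1)"
    unfolding of_int_add of_int_diff of_int_numeral of_int_1 using B[OF a(5)] a(6) by linarith+
  then consider "k = i + j" | "k = i + j - 1" unfolding of_int_less_iff by linarith
  then show ?thesis
  proof cases
    case 1
    have "cells_met f g S = {(i, j, k), (i - 1, j, k), (i, j - 1, k)}"
    proof (intro equalityI subsetI)
      fix x assume "x \<in> cells_met f g S"
      then show "x \<in> {(i, j, k), (i - 1, j, k), (i, j - 1, k)}" using bound 1 by (auto simp: tri_index_def)
    next
      have "(i, j, k) \<in> cells_met f g S" using 1 a B[OF a(5)] by (intro cells_metI[OF a(5)]) auto
      moreover have "(i - 1, j, k) \<in> cells_met f g S" using 1 a B[OF a(1)] by (intro cells_metI[OF a(1)]) auto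
      moreover have "(i, j - 1, k) \<in> cells_met f g S" using 1 b B[OF b(1)] by (intro cells_metI[OF b(1)]) auto
      moreover fix x assume "x \<in> {(i, j, k), (i - 1, j, k), (i, j - 1, k)}"
      ultimately show "x \<in> cells_met f g S" by auto
    qed
    then show ?thesis by simp
  next
    case 2
    have "cells_met f g S = {(i - 1, j - 1, k), (i - 1, j, k), (i, j - 1, k)}"
    proof (intro equalityI subsetI)
      fix x assume "x \<in> cells_met f g S"
      then show "x \<in> {(i - 1, j - 1, k), (i - 1, j, k), (i, j - 1, k)}" using bound 2 by (auto simp: tri_index_def)
    next
      have "(i - 1, j - 1, k) \<in> cells_met f g S" using 2 a B[OF a(5)] by (intro cells_metI[OF a(5)]) auto
      moreover have "(i - 1, j, k) \<in> cells_met f g S" using 2 b B[OF b(3)] by (intro cells_metI[OF b(3)]) auto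
      moreover have "(i, j - 1, k) \<in> cells_met f g S" using 2 a B[OF a(3)] by (intro cells_metI[OF a(3)]) auto
      moreover fix x assume "x \<in> {(i - 1, j - 1, k), (i - 1, j, k), (i, j - 1, k)}"
      ultimately show "x \<in> cells_met f g S" by auto
    qed
    then show ?thesis by simp
  qed
qed

text \<open>Reduced to the previous case by the symmetries, applied so that the missed family becomes the sum.\<close>
lemma cells_met_two_lines_sum:
  assumes f: "crosses f S i" and g: "misses g S j" and h: "crosses (\<lambda>z. f z + g z) S k"
  shows "card (cells_met f g S) = 3"
proof -
  let ?h = "\<lambda>z. f z + g z"
  have "card (cells_met f (\<lambda>z. - ?h z) S) = 3"
    using f crosses_uminus[OF h] misses_uminus[OF g] by (intro cells_met_two_lines) simp_all
  also have "card (cells_met f (\<lambda>z. - ?h z) S) = card (cells_met (\<lambda>z. - g z) ?h S)"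
    using card_cells_met_rotate[of "\<lambda>z. - g z" ?h S] by simp
  also have "\<dots> = card (cells_met f g S)"
    unfolding card_cells_met_swap[of "\<lambda>z. - g z"] by (rule card_cells_met_rotate)
  finally show ?thesis by simp
qed

context triangle_lattice begin

lemma hit_index_eq: "hit_index S = cells_met pu pv S"
  by (auto simp: hit_index_def cells_met_def tri_def pw_eq)

lemma pw_fun: "pw = (\<lambda>z. pu z + pv z)" "pw = (\<lambda>z. pv z + pu z)"
  by (auto simp: pw_eq)

lemmas hit_indexI = cells_metI[where f = pu and g = pv, folded hit_index_eq]
lemmas hit_index_bound = cells_met_bound[where f = pu and g = pv, folded hit_index_eq, folded pw_eq]

lemma count_no_line:
  "S \<noteq> {} \<Longrightarrow> misses pu S i \<Longrightarrow> misses pv S j \<Longrightarrow> misses pw S k \<Longrightarrow> card (hit_index S) = 1"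
  unfolding hit_index_eq pw_fun by (rule cells_met_no_line)

lemma count_one_line:
  "crosses pu S i \<Longrightarrow> misses pv S j \<Longrightarrow> misses pw S k \<Longrightarrow> card (hit_index S) = 2"
  "misses pu S i \<Longrightarrow> crosses pv S j \<Longrightarrow> misses pw S k \<Longrightarrow> card (hit_index S) = 2"
  "misses pu S i \<Longrightarrow> misses pv S j \<Longrightarrow> crosses pw S k \<Longrightarrow> card (hit_index S) = 2"
proof -
  show "card (hit_index S) = 2" if "crosses pu S i" "misses pv S j" "misses pw S k"
    using that unfolding hit_index_eq pw_fun(1) by (rule cells_met_one_line)
  show "card (hit_index S) = 2" if "misses pu S i" "crosses pv S j" "misses pw S k"
    using that unfolding hit_index_eq pw_fun(2) card_cells_met_swap[of pu pv]
    by (intro cells_met_one_line)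
  show "card (hit_index S) = 2" if "misses pu S i" "misses pv S j" "crosses pw S k"
    unfolding hit_index_eq card_cells_met_rotate[of pu pv, symmetric] pw_fun(1)[symmetric]
    using that misses_uminus[OF that(2)] by (intro cells_met_one_line) (simp_all add: pw_eq)
qed

lemma count_two_lines:
  "crosses pu S i \<Longrightarrow> crosses pv S j \<Longrightarrow> misses pw S k \<Longrightarrow> card (hit_index S) = 3"
  "crosses pu S i \<Longrightarrow> misses pv S j \<Longrightarrow> crosses pw S k \<Longrightarrow> card (hit_index S) = 3"
  "misses pu S i \<Longrightarrow> crosses pv S j \<Longrightarrow> crosses pw S k \<Longrightarrow> card (hit_index S) = 3"
proof -
  show "card (hit_index S) = 3" if "crosses pu S i" "crosses pv S j" "misses pw S k"
    using that unfolding hit_index_eq pw_fun(1) by (rule cells_met_two_lines)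
  show "card (hit_index S) = 3" if "crosses pu S i" "misses pv S j" "crosses pw S k"
    using that unfolding hit_index_eq pw_fun(1) by (rule cells_met_two_lines_sum)
  show "card (hit_index S) = 3" if "misses pu S i" "crosses pv S j" "crosses pw S k"
    using that unfolding hit_index_eq pw_fun(2) card_cells_met_swap[of pu pv]
    by (intro cells_met_two_lines_sum)
qed

text \<open>The vertex lies in all six triangles around it, and no other triangle is within reach.\<close>
lemma count_three_lines_vertex:
  assumes u: "crosses pu S i" and v: "crosses pv S j" and w: "crosses pw S (i + j)"
    and p: "p \<in> S" "pu p = i" "pv p = j"
  shows "card (hit_index S) = 6"
proof -
  note bound = hit_index_bound[OF crosses_index_bound[OF u] crosses_index_bound[OF v] crosses_index_bound[OF w]]
  let ?H = "{(i, j, i + j), (i - 1, j, i + j), (i - 1, j, i + j - 1),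
      (i, j - 1, i + j), (i, j - 1, i + j - 1), (i - 1, j - 1, i + j - 1)}"
  have "hit_index S = ?H"
  proof (intro equalityI subsetI)
    fix x assume "x \<in> hit_index S"
    then show "x \<in> ?H" using bound by (auto simp: tri_index_def)
  next
    fix x assume "x \<in> ?H"
    then show "x \<in> hit_index S"
      using p by (auto intro!: hit_indexI[OF p(1)])
  qed
  then show ?thesis by simp
qed

end

context triangle_lattice begin

text \<open>A hyperplane that separates the vertex from the set, written in lattice coordinates.\<close>
lemma separating_functional:
  assumes S: "convex S" "closed S" and o: "point x0 y0 \<notin> S"
  shows "\<exists>p q. \<forall>z\<in>S. 0 < p * (pu z - x0) + q * (pv z - y0)"
proof -
  obtain d e where d: "d \<bullet> point x0 y0 < e" "\<And>z. z \<in> S \<Longrightarrow> e < d \<bullet> z"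
    using separating_hyperplane_closed_point[OF S o] by auto
  have split: "z - point x0 y0 = (pu z - x0) *\<^sub>R point 1 0 + (pv z - y0) *\<^sub>R point 0 1" for z
    by (rule coordinates_inject) (simp_all add: linear_diff linear_coordinates)
  have "d \<bullet> z - d \<bullet> point x0 y0 = (d \<bullet> point 1 0) * (pu z - x0) + (d \<bullet> point 0 1) * (pv z - y0)" for z
    unfolding inner_diff_right[symmetric] split by (simp add: inner_add_right)
  note eq = this
  have "0 < (d \<bullet> point 1 0) * (pu z - x0) + (d \<bullet> point 0 1) * (pv z - y0)" if "z \<in> S" for z
    using d(2)[OF that] d(1) eq[of z] by linarith
  then show ?thesis by blast
qed

text \<open>The form in which the signs of a separating functional decide whether a sector is met.\<close>
lemma eq_disj_if_covered:
  assumes "P' \<Longrightarrow> Q' \<Longrightarrow> \<not> A" "P \<Longrightarrow> A" "Q \<Longrightarrow> A" "P \<or> P'" "Q \<or> Q'"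
  shows "A \<longleftrightarrow> P \<or> Q"
  using assms by blast

text \<open>Three lines through a vertex cut the plane into six sectors, separated by six rays. If the set misses the
  vertex, it lies in an open half plane bounded by a line through the vertex. Of each of the three lines it meets the
  ray in that half plane. These three rays are consecutive and border four sectors, and the other two sectors
  lie outside the half plane.\<close>
lemma count_three_lines_no_vertex:
  assumes S: "convex S" "closed S"
    and u: "crosses pu S i" and v: "crosses pv S j" and w: "crosses pw S (i + j)"
    and no: "point i j \<notin> S"
  shows "card (hit_index S) = 4"
proof -
  obtain p q where "\<forall>z\<in>S. 0 < p * (pu z - i) + q * (pv z - j)"
    using separating_functional[OF S no] by blast
  then have sep: "0 < p * (pu z - i) + q * (pv z - j)" if "z \<in> S" for z using that by blast
  note bound = hit_index_bound[OF crosses_index_bound[OF u] crosses_index_bound[OF v] crosses_index_bound[OF w]]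
  have B: "i - 1 < pu y" "pu y < i + 1" "j - 1 < pv y" "pv y < j + 1" "i + j - 1 < pu y + pv y" "pu y + pv y < i + j + 1"
    if "y \<in> S" for y
    using that u v w by (auto simp: crosses_def pw_eq)
  have sepw: "0 < (p - q) * (pu z - i) + q * (pu z + pv z - i - j)"
      "0 < p * (pu z + pv z - i - j) + (q - p) * (pv z - j)" if "z \<in> S" for z
    using sep[OF that] by (simp_all add: algebra_simps)
  obtain x where x: "x \<in> S" "pu x = i" using u by (auto simp: crosses_def)
  obtain y where y: "y \<in> S" "pv y = j" using v by (auto simp: crosses_def)
  obtain z where z: "z \<in> S" "pu z + pv z = i + j" using w by (auto simp: crosses_def pw_eq)
  have sx: "0 < q * (pv x - j)" using sep[OF x(1)] x by simp
  have sy: "0 < p * (pu y - i)" using sep[OF y(1)] y by simp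
  have sz: "0 < (p - q) * (pu z - i)" using sepw(1)[OF z(1)] z by simp
  have zv: "pv z = j - (pu z - i)" using z by simp
  have sgn: "p \<noteq> 0" "q \<noteq> 0" "p \<noteq> q" using sx sy sz by auto
  have H: "(i', j', k') \<in> hit_index S \<longleftrightarrow> (k' = i' + j' \<or> k' = i' + j' + 1) \<and> 
    (\<exists>z\<in>S. i' \<le> pu z \<and> pu z \<le> i' + 1 \<and> j' \<le> pv z \<and> pv z \<le> j' + 1 \<and> k' \<le> pu z + pv z \<and> pu z + pv z \<le> k' + 1)" for i' j' k' :: int
    by (auto simp: hit_index_def tri_def tri_index_def pw_eq)
  have e1: "(i, j, i + j) \<notin> hit_index S" if "p < 0" "q < 0"
  proof
    assume "(i, j, i + j) \<in> hit_index S"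
    then obtain t where t: "t \<in> S" "i \<le> pu t" "j \<le> pv t" unfolding H by auto
    have "p * (pu t - i) \<le> 0" using that t by (simp add: mult_le_0_iff)
    moreover have "q * (pv t - j) \<le> 0" using that t by (simp add: mult_le_0_iff)
    ultimately show False using sep[OF t(1)] by linarith
  qed
  have e2: "(i - 1, j - 1, i + j - 1) \<notin> hit_index S" if "p > 0" "q > 0"
  proof
    assume "(i - 1, j - 1, i + j - 1) \<in> hit_index S"
    then obtain t where t: "t \<in> S" "pu t \<le> i" "pv t \<le> j" unfolding H by auto
    have "p * (pu t - i) \<le> 0" using that t by (simp add: mult_le_0_iff)
    moreover have "q * (pv t - j) \<le> 0" using that t by (simp add: mult_le_0_iff)
    ultimately show False using sep[OF t(1)] by linarith
  qed
  have e3: "(i - 1, j, i + j) \<notin> hit_index S" if "p - q > 0" "q < 0"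
  proof
    assume "(i - 1, j, i + j) \<in> hit_index S"
    then obtain t where t: "t \<in> S" "pu t \<le> i" "i + j \<le> pu t + pv t" unfolding H by auto
    have "(p - q) * (pu t - i) \<le> 0" using that t by (simp add: mult_le_0_iff)
    moreover have "q * (pu t + pv t - i - j) \<le> 0" using that t by (simp add: mult_le_0_iff)
    ultimately show False using sepw(1)[OF t(1)] by linarith
  qed
  have e4: "(i, j - 1, i + j - 1) \<notin> hit_index S" if "p - q < 0" "q > 0"
  proof
    assume "(i, j - 1, i + j - 1) \<in> hit_index S"
    then obtain t where t: "t \<in> S" "i \<le> pu t" "pu t + pv t \<le> i + j" unfolding H by auto
    have "(p - q) * (pu t - i) \<le> 0" using that t by (simp add: mult_le_0_iff)
    moreover have "q * (pu t + pv t - i - j) \<le> 0" using that t by (simp add: mult_le_0_iff)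
    ultimately show False using sepw(1)[OF t(1)] by linarith
  qed
  have e5: "(i - 1, j, i + j - 1) \<notin> hit_index S" if "p > 0" "p - q > 0"
  proof
    assume "(i - 1, j, i + j - 1) \<in> hit_index S"
    then obtain t where t: "t \<in> S" "j \<le> pv t" "pu t + pv t \<le> i + j" unfolding H by auto
    have "p * (pu t + pv t - i - j) \<le> 0" using that t by (simp add: mult_le_0_iff)
    moreover have "(q - p) * (pv t - j) \<le> 0" using that t by (simp add: mult_le_0_iff)
    ultimately show False using sepw(2)[OF t(1)] by linarith
  qed
  have e6: "(i, j - 1, i + j) \<notin> hit_index S" if "p < 0" "p - q < 0"
  proof
    assume "(i, j - 1, i + j) \<in> hit_index S"
    then obtain t where t: "t \<in> S" "pv t \<le> j" "i + j \<le> pu t + pv t" unfolding H by auto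
    have "p * (pu t + pv t - i - j) \<le> 0" using that t by (simp add: mult_le_0_iff)
    moreover have "(q - p) * (pv t - j) \<le> 0" using that t by (simp add: mult_le_0_iff)
    ultimately show False using sepw(2)[OF t(1)] by linarith
  qed
  have h1: "(i, j, i + j) \<in> hit_index S \<and> (i - 1, j, i + j) \<in> hit_index S" if "q > 0"
    using that sx x B[OF x(1)] by (auto intro!: hit_indexI[OF x(1)] simp: zero_less_mult_iff)
  have h2: "(i - 1, j - 1, i + j - 1) \<in> hit_index S \<and> (i, j - 1, i + j - 1) \<in> hit_index S" if "q < 0"
    using that sx x B[OF x(1)] by (auto intro!: hit_indexI[OF x(1)] simp: zero_less_mult_iff)
  have h3: "(i, j, i + j) \<in> hit_index S \<and> (i, j - 1, i + j) \<in> hit_index S" if "p > 0"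
    using that sy y B[OF y(1)] by (auto intro!: hit_indexI[OF y(1)] simp: zero_less_mult_iff)
  have h4: "(i - 1, j - 1, i + j - 1) \<in> hit_index S \<and> (i - 1, j, i + j - 1) \<in> hit_index S" if "p < 0"
    using that sy y B[OF y(1)] by (auto intro!: hit_indexI[OF y(1)] simp: zero_less_mult_iff)
  have h5: "(i, j - 1, i + j - 1) \<in> hit_index S \<and> (i, j - 1, i + j) \<in> hit_index S" if "p - q > 0"
    using that sz zv B[OF z(1)] by (auto intro!: hit_indexI[OF z(1)] simp: zero_less_mult_iff)
  have h6: "(i - 1, j, i + j - 1) \<in> hit_index S \<and> (i - 1, j, i + j) \<in> hit_index S" if "p - q < 0"
    using that sz zv B[OF z(1)] by (auto intro!: hit_indexI[OF z(1)] simp: zero_less_mult_iff)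
  \<comment> \<open>The signs of \<open>p\<close>, \<open>q\<close> and \<open>p - q\<close> tell on which of its two rays each line is met.\<close>
  have dich: "p > 0 \<or> p < 0" "q > 0 \<or> q < 0" "p - q > 0 \<or> p - q < 0" using sgn by linarith+
  have signs:
    "(i, j, i + j) \<in> hit_index S \<longleftrightarrow> p > 0 \<or> q > 0"
    "(i - 1, j - 1, i + j - 1) \<in> hit_index S \<longleftrightarrow> p < 0 \<or> q < 0"
    "(i - 1, j, i + j) \<in> hit_index S \<longleftrightarrow> p - q < 0 \<or> q > 0"
    "(i, j - 1, i + j - 1) \<in> hit_index S \<longleftrightarrow> p - q > 0 \<or> q < 0"
    "(i - 1, j, i + j - 1) \<in> hit_index S \<longleftrightarrow> p < 0 \<or> p - q < 0"
    "(i, j - 1, i + j) \<in> hit_index S \<longleftrightarrow> p > 0 \<or> p - q > 0"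
    subgoal by (rule eq_disj_if_covered[OF e1 h3[THEN conjunct1] h1[THEN conjunct1] dich(1) dich(2)])
    subgoal by (rule eq_disj_if_covered[OF e2 h4[THEN conjunct1] h2[THEN conjunct1] dich(1)[THEN disj_commute[THEN iffD1]] dich(2)[THEN disj_commute[THEN iffD1]]])
    subgoal by (rule eq_disj_if_covered[OF e3 h6[THEN conjunct2] h1[THEN conjunct2] dich(3)[THEN disj_commute[THEN iffD1]] dich(2)])
    subgoal by (rule eq_disj_if_covered[OF e4 h5[THEN conjunct1] h2[THEN conjunct2] dich(3) dich(2)[THEN disj_commute[THEN iffD1]]])
    subgoal by (rule eq_disj_if_covered[OF e5 h4[THEN conjunct2] h6[THEN conjunct1] dich(1)[THEN disj_commute[THEN iffD1]] dich(3)[THEN disj_commute[THEN iffD1]]])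
    subgoal by (rule eq_disj_if_covered[OF e6 h3[THEN conjunct2] h5[THEN conjunct2] dich(1) dich(3)])
    done
  let ?six = "{(i, j, i + j), (i - 1, j, i + j), (i - 1, j, i + j - 1),
      (i - 1, j - 1, i + j - 1), (i, j - 1, i + j - 1), (i, j - 1, i + j)}"
  have "hit_index S \<subseteq> ?six"
  proof
    fix x assume "x \<in> hit_index S"
    then show "x \<in> ?six" using bound by (auto simp: tri_index_def)
  qed
  then have "hit_index S = {x \<in> ?six. x \<in> hit_index S}" by blast
  also have "\<dots> = (if p > 0 \<or> q > 0 then {(i, j, i + j)} else {}) \<union>
      (if p - q < 0 \<or> q > 0 then {(i - 1, j, i + j)} else {}) \<union>
      (if p < 0 \<or> p - q < 0 then {(i - 1, j, i + j - 1)} else {}) \<union>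
      (if p < 0 \<or> q < 0 then {(i - 1, j - 1, i + j - 1)} else {}) \<union>
      (if p - q > 0 \<or> q < 0 then {(i, j - 1, i + j - 1)} else {}) \<union>
      (if p > 0 \<or> p - q > 0 then {(i, j - 1, i + j)} else {})"
    unfolding signs[symmetric] by (simp split: if_split) blast
  finally have *: "hit_index S = \<dots>" .
  \<comment> \<open>The functional is positive on three consecutive of the six rays; there are six ways to choose them.\<close>
  consider "p > 0" "q > 0" "p - q > 0" | "p > 0" "q > 0" "p - q < 0" | "p > 0" "q < 0" "p - q > 0"
    | "p < 0" "q < 0" "p - q > 0" | "p < 0" "q < 0" "p - q < 0" | "p < 0" "q > 0" "p - q < 0"
    using sgn by linarith
  then show ?thesis unfolding * by cases simp_all
qed

text \<open>Since lattice lines cross in vertices only, one more piece arises for every line met, and two more if three of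
  the lines meet inside the set.\<close>
lemma card_hit_index:
  assumes S: "convex S" "closed S" "S \<noteq> {}"
    and u: "(\<exists>i. misses pu S i) \<or> (\<exists>i. crosses pu S i)"
    and v: "(\<exists>j. misses pv S j) \<or> (\<exists>j. crosses pv S j)"
    and w: "(\<exists>k. misses pw S k) \<or> (\<exists>k. crosses pw S k)"
    and uvw: "\<And>i j k. crosses pu S i \<Longrightarrow> crosses pv S j \<Longrightarrow> crosses pw S k \<Longrightarrow> k = i + j"
  shows "card (hit_index S) = 1 + of_bool (\<exists>i. crosses pu S i) + of_bool (\<exists>j. crosses pv S j)
    + of_bool (\<exists>k. crosses pw S k) + 2 * of_bool (\<exists>(i :: int) (j :: int). point i j \<in> S)"
proof -
  have nomiss: "\<not> misses pu S i' \<and> \<not> misses pv S i' \<and> \<not> misses pw S i'" if "point (of_int i) (of_int j) \<in> S" for i j i' :: int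
  proof -
    have no: "\<not> misses f S k" if f: "f (point (of_int i) (of_int j)) = of_int m" for f k m
    proof
      assume "misses f S k"
      then have "real_of_int k < of_int m" "real_of_int m < of_int (k + 1)"
        using f \<open>point _ _ \<in> S\<close> by (force simp: misses_def)+
      then show False unfolding of_int_less_iff by linarith
    qed
    show ?thesis using no[of pu i] no[of pv j] no[of pw "i + j"] by simp
  qed
  show ?thesis
  proof (cases "(\<exists>i. crosses pu S i) \<and> (\<exists>j. crosses pv S j) \<and> (\<exists>k. crosses pw S k)")
    case True
    then obtain i j where c: "crosses pu S i" "crosses pv S j" "crosses pw S (i + j)"
      using uvw by blast
    have "i' = i \<and> j' = j" if "point (of_int i') (of_int j') \<in> S" for i' j' :: int
    proof -
      have "real_of_int (i - 1) < of_int i'" "real_of_int i' < of_int (i + 1)"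
        "real_of_int (j - 1) < of_int j'" "real_of_int j' < of_int (j + 1)"
        using c(1,2) that by (force simp: crosses_def)+
      then show ?thesis unfolding of_int_less_iff by linarith
    qed
    then have vertex: "(\<exists>(i :: int) (j :: int). point i j \<in> S) = (point (of_int i) (of_int j) \<in> S)" by blast
    have ex: "(\<exists>i. crosses pu S i) = True" "(\<exists>j. crosses pv S j) = True" "(\<exists>k. crosses pw S k) = True"
      using True by blast+
    have "card (hit_index S) = (if point (of_int i) (of_int j) \<in> S then 6 else 4)"
      using count_three_lines_vertex[OF c, of "point i j"] count_three_lines_no_vertex[OF S(1,2) c]
      by simp
    then show ?thesis unfolding ex vertex by simp
  next
    case False
    then have no_vertex: "(\<exists>(i :: int) (j :: int). point i j \<in> S) = False"
      using nomiss u v w by meson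
    define cu cv cw where "cu \<longleftrightarrow> (\<exists>i. crosses pu S i)" and "cv \<longleftrightarrow> (\<exists>j. crosses pv S j)"
      and "cw \<longleftrightarrow> (\<exists>k. crosses pw S k)"
    have c1: "\<not> cu \<Longrightarrow> \<not> cv \<Longrightarrow> \<not> cw \<Longrightarrow> card (hit_index S) = 1"
      unfolding cu_def cv_def cw_def using count_no_line[OF S(3)] u v w by metis
    have c2: "cu \<Longrightarrow> \<not> cv \<Longrightarrow> \<not> cw \<Longrightarrow> card (hit_index S) = 2"
      unfolding cu_def cv_def cw_def using count_one_line(1) v w by metis
    have c3: "\<not> cu \<Longrightarrow> cv \<Longrightarrow> \<not> cw \<Longrightarrow> card (hit_index S) = 2"
      unfolding cu_def cv_def cw_def using count_one_line(2) u w by metis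
    have c4: "\<not> cu \<Longrightarrow> \<not> cv \<Longrightarrow> cw \<Longrightarrow> card (hit_index S) = 2"
      unfolding cu_def cv_def cw_def using count_one_line(3) u v by metis
    have c5: "cu \<Longrightarrow> cv \<Longrightarrow> \<not> cw \<Longrightarrow> card (hit_index S) = 3"
      unfolding cu_def cv_def cw_def using count_two_lines(1) w by metis
    have c6: "cu \<Longrightarrow> \<not> cv \<Longrightarrow> cw \<Longrightarrow> card (hit_index S) = 3"
      unfolding cu_def cv_def cw_def using count_two_lines(2) v by metis
    have c7: "\<not> cu \<Longrightarrow> cv \<Longrightarrow> cw \<Longrightarrow> card (hit_index S) = 3"
      unfolding cu_def cv_def cw_def using count_two_lines(3) u by metis
    have c8: "\<not> (cu \<and> cv \<and> cw)" using False unfolding cu_def cv_def cw_def .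
    have "card (hit_index S) = 1 + of_bool cu + of_bool cv + of_bool cw"
    proof (cases cu)
      case True
      then show ?thesis using c2 c5 c6 c8 by (cases cv; cases cw) simp_all
    next
      case False
      then show ?thesis using c1 c3 c4 c7 by (cases cv; cases cw) simp_all
    qed
    then show ?thesis using no_vertex unfolding cu_def cv_def cw_def by (simp only: of_bool_eq mult_0_right add_0_right)
  qed
qed

end

section \<open>Lebesgue measure and lattice coordinates\<close>

lemma measurable_Complex [measurable (raw)]:
  assumes [measurable]: "f \<in> borel_measurable M" "g \<in> borel_measurable M"
  shows "(\<lambda>x. Complex (f x) (g x)) \<in> borel_measurable M"
  by (simp add: borel_measurable_complex_iff)

lemma lborel_complex_eq_distr:
  "(lborel :: complex measure) = distr (lborel \<Otimes>\<^sub>M lborel) borel (\<lambda>(x, y). Complex x y)"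
proof (rule lborel_eqI)
  fix l u :: complex
  assume le: "\<And>b. b \<in> Basis \<Longrightarrow> l \<bullet> b \<le> u \<bullet> b"
  have lu: "Re l \<le> Re u" "Im l \<le> Im u" using le[of 1] le[of \<i>] by (auto simp: Basis_complex_def)
  have "emeasure (distr (lborel \<Otimes>\<^sub>M lborel) borel (\<lambda>(x, y). Complex x y)) (box l u)
    = emeasure (lborel \<Otimes>\<^sub>M lborel) ((\<lambda>(x, y). Complex x y) -` box l u \<inter> space (lborel \<Otimes>\<^sub>M lborel))"
    by (intro emeasure_distr) auto
  also have "(\<lambda>(x, y). Complex x y) -` box l u \<inter> space (lborel \<Otimes>\<^sub>M lborel) = {Re l<..<Re u} \<times> {Im l<..<Im u}"
    by (auto simp: in_box_complex_iff space_pair_measure)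
  also have "emeasure (lborel \<Otimes>\<^sub>M lborel) \<dots> = ennreal (Re u - Re l) * ennreal (Im u - Im l)"
    using lu by (subst lborel.emeasure_pair_measure_Times) auto
  also have "\<dots> = (\<Prod>b\<in>Basis. (u - l) \<bullet> b)"
    using lu by (simp add: Basis_complex_def ennreal_mult inner_complex_def)
  finally show "emeasure (distr (lborel \<Otimes>\<^sub>M lborel) borel (\<lambda>(x, y). Complex x y)) (box l u) = (\<Prod>b\<in>Basis. (u - l) \<bullet> b)" .
qed simp

lemma nn_integral_complex:
  assumes [measurable]: "f \<in> borel_measurable borel"
  shows "(\<integral>\<^sup>+z. f z \<partial>lborel) = (\<integral>\<^sup>+y. (\<integral>\<^sup>+x. f (Complex x y) \<partial>lborel) \<partial>lborel)"
proof -
  have "(\<integral>\<^sup>+z. f z \<partial>lborel) = (\<integral>\<^sup>+p. f (case p of (x, y) \<Rightarrow> Complex x y) \<partial>(lborel \<Otimes>\<^sub>M lborel))"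
    by (subst lborel_complex_eq_distr, rule nn_integral_distr) auto
  also have "\<dots> = (\<integral>\<^sup>+y. (\<integral>\<^sup>+x. f (Complex x y) \<partial>lborel) \<partial>lborel)"
    by (subst lborel_pair.nn_integral_snd[symmetric]) auto
  finally show ?thesis .
qed

lemma nn_integral_lborel_swap:
  fixes f :: "real \<Rightarrow> real \<Rightarrow> ennreal"
  assumes "case_prod f \<in> borel_measurable (borel \<Otimes>\<^sub>M borel)"
  shows "(\<integral>\<^sup>+y. (\<integral>\<^sup>+x. f x y \<partial>lborel) \<partial>lborel) = (\<integral>\<^sup>+x. (\<integral>\<^sup>+y. f x y \<partial>lborel) \<partial>lborel)"
  using assms by (intro lborel_pair.Fubini') (simp cong: measurable_cong_sets sets_pair_measure_cong)

lemma nn_integral_complex_translation: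
  assumes [measurable]: "f \<in> borel_measurable borel"
  shows "(\<integral>\<^sup>+z. f (t + z) \<partial>lborel) = (\<integral>\<^sup>+(z::complex). f z \<partial>lborel)"
proof -
  have "(\<integral>\<^sup>+z. f z \<partial>distr lborel borel ((+) t)) = (\<integral>\<^sup>+z. f (t + z) \<partial>lborel)"
    by (rule nn_integral_distr) auto
  then show ?thesis by (simp add: lborel_distr_plus)
qed

text \<open>A rotation with \<open>cos \<theta> \<noteq> 0\<close> is a product of two shears along the axes with stretching by \<open>cos \<theta>\<close> and
  its inverse, so two applications of Fubini suffice; a rotation with \<open>cos \<theta> = 0\<close> exchanges the axes.\<close>
lemma nn_integral_complex_rotation:
  assumes f[measurable]: "f \<in> borel_measurable borel"
  shows "(\<integral>\<^sup>+z. f (cis \<theta> * z) \<partial>lborel) = (\<integral>\<^sup>+z. f z \<partial>lborel)"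
proof -
  define C S where "C = cos \<theta>" and "S = sin \<theta>"
  have CS: "C\<^sup>2 + S\<^sup>2 = 1" by (simp add: C_def S_def)
  have mult: "cis \<theta> * Complex x y = Complex (C * x - S * y) (S * x + C * y)" for x y
    by (simp add: complex_eq_iff C_def S_def)
  have "(\<integral>\<^sup>+z. f (cis \<theta> * z) \<partial>lborel) = (\<integral>\<^sup>+y. (\<integral>\<^sup>+x. f (Complex (C * x - S * y) (S * x + C * y)) \<partial>lborel) \<partial>lborel)"
    by (subst nn_integral_complex) (auto simp: mult)
  also have "\<dots> = (\<integral>\<^sup>+y. (\<integral>\<^sup>+x. f (Complex x y) \<partial>lborel) \<partial>lborel)"
  proof (cases "C = 0")
    case True
    then have S: "S \<noteq> 0" "\<bar>S\<bar> = 1" using CS by (auto simp: power2_eq_1_iff)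
    have "(\<integral>\<^sup>+y. (\<integral>\<^sup>+x. f (Complex (C * x - S * y) (S * x + C * y)) \<partial>lborel) \<partial>lborel)
      = (\<integral>\<^sup>+y. (\<integral>\<^sup>+x. f (Complex (0 + (- S) * y) (0 + S * x)) \<partial>lborel) \<partial>lborel)"
      using True by simp
    also have "\<dots> = (\<integral>\<^sup>+y. (\<integral>\<^sup>+x. f (Complex (0 + (- S) * y) x) \<partial>lborel) \<partial>lborel)"
      using nn_integral_real_affine[of "\<lambda>x. f (Complex (0 + (- S) * y) x)" S 0 for y] S by simp
    also have "\<dots> = (\<integral>\<^sup>+y. (\<integral>\<^sup>+x. f (Complex y x) \<partial>lborel) \<partial>lborel)"
      using nn_integral_real_affine[of "\<lambda>y. (\<integral>\<^sup>+x. f (Complex y x) \<partial>lborel)" "- S" 0] S by simp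
    also have "\<dots> = (\<integral>\<^sup>+y. (\<integral>\<^sup>+x. f (Complex x y) \<partial>lborel) \<partial>lborel)"
      by (rule nn_integral_lborel_swap) measurable
    finally show ?thesis .
  next
    case C: False
    have inner: "(\<integral>\<^sup>+x. f (Complex x (S / C * x + y / C)) \<partial>lborel)
       = \<bar>C\<bar> * (\<integral>\<^sup>+x. f (Complex (C * x - S * y) (S * x + C * y)) \<partial>lborel)" for y
    proof -
      have "y * (C\<^sup>2 + S\<^sup>2) = y" using CS by simp
      then have "S * (- S * y + C * x) + y = C * (S * x + C * y)" for x
        by (simp add: power2_eq_square algebra_simps)
      then have "(S * (- S * y + C * x) + y) / C = S * x + C * y" for x using C by simp
      then have *: "S / C * (- S * y + C * x) + y / C = S * x + C * y" for x
        by (simp add: add_divide_distrib)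
      have "(\<integral>\<^sup>+x. f (Complex x (S / C * x + y / C)) \<partial>lborel)
        = \<bar>C\<bar> * (\<integral>\<^sup>+x. f (Complex (- S * y + C * x) (S / C * (- S * y + C * x) + y / C)) \<partial>lborel)"
        using C by (intro nn_integral_real_affine) auto
      then show ?thesis unfolding * by simp
    qed
    have "\<bar>C\<bar> * (\<integral>\<^sup>+y. (\<integral>\<^sup>+x. f (Complex (C * x - S * y) (S * x + C * y)) \<partial>lborel) \<partial>lborel)
      = (\<integral>\<^sup>+y. (\<integral>\<^sup>+x. f (Complex x (S / C * x + y / C)) \<partial>lborel) \<partial>lborel)"
      unfolding inner by (rule nn_integral_cmult[symmetric]) measurable
    also have "\<dots> = (\<integral>\<^sup>+x. (\<integral>\<^sup>+y. f (Complex x (S / C * x + y / C)) \<partial>lborel) \<partial>lborel)"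
      by (rule nn_integral_lborel_swap) measurable
    also have "\<dots> = (\<integral>\<^sup>+x. \<bar>C\<bar> * (\<integral>\<^sup>+y. f (Complex x y) \<partial>lborel) \<partial>lborel)"
    proof (intro nn_integral_cong)
      fix x
      have "(\<integral>\<^sup>+y. f (Complex x (S / C * x + y / C)) \<partial>lborel)
        = \<bar>C\<bar> * (\<integral>\<^sup>+y. f (Complex x (S / C * x + (- S * x + C * y) / C)) \<partial>lborel)"
        using C by (intro nn_integral_real_affine) auto
      moreover have "S / C * x + (- S * x + C * y) / C = y" for y using C by (simp add: field_simps)
      ultimately show "(\<integral>\<^sup>+y. f (Complex x (S / C * x + y / C)) \<partial>lborel) = \<bar>C\<bar> * (\<integral>\<^sup>+y. f (Complex x y) \<partial>lborel)"
        by (simp only:)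
    qed
    also have "\<dots> = \<bar>C\<bar> * (\<integral>\<^sup>+x. (\<integral>\<^sup>+y. f (Complex x y) \<partial>lborel) \<partial>lborel)"
      by (rule nn_integral_cmult) measurable
    also have "(\<integral>\<^sup>+x. (\<integral>\<^sup>+y. f (Complex x y) \<partial>lborel) \<partial>lborel) = (\<integral>\<^sup>+y. (\<integral>\<^sup>+x. f (Complex x y) \<partial>lborel) \<partial>lborel)"
      by (rule nn_integral_lborel_swap[symmetric]) measurable
    finally show ?thesis
      using C by (simp add: ennreal_mult_cancel_left)
  qed
  also have "\<dots> = (\<integral>\<^sup>+z. f z \<partial>lborel)" by (rule nn_integral_complex[symmetric]) simp
  finally show ?thesis .
qed

text \<open>Any interval of length 1 is a period: cut at an integer and move one part by 1.\<close>
lemma nn_integral_periodic: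
  fixes f :: "real \<Rightarrow> ennreal"
  assumes [measurable]: "f \<in> borel_measurable borel" and per: "\<And>x. f (x + 1) = f x"
  shows "(\<integral>\<^sup>+x. f x * indicator {a..a + 1} x \<partial>lborel) = (\<integral>\<^sup>+x. f x * indicator {0..1} x \<partial>lborel)"
proof -
  have shift: "(\<integral>\<^sup>+x. f x * indicator {l..<r} x \<partial>lborel) = (\<integral>\<^sup>+x. f x * indicator {l + of_int k..<r + of_int k} x \<partial>lborel)" for l r k
  proof -
    have "(\<integral>\<^sup>+x. f x * indicator {l + of_int k..<r + of_int k} x \<partial>lborel)
      = ennreal \<bar>1\<bar> * (\<integral>\<^sup>+x. f (of_int k + 1 * x) * indicator {l + of_int k..<r + of_int k} (of_int k + 1 * x) \<partial>lborel)"
      by (intro nn_integral_real_affine) auto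
    also have "\<dots> = (\<integral>\<^sup>+x. f x * indicator {l..<r} x \<partial>lborel)"
      using periodic_add_int[of f 1, OF per] by (auto simp: add.commute indicator_def intro!: nn_integral_cong)
    finally show ?thesis by simp
  qed
  have join: "(\<integral>\<^sup>+x. f x * indicator {l..<m} x \<partial>lborel) + (\<integral>\<^sup>+x. f x * indicator {m..<r} x \<partial>lborel)
     = (\<integral>\<^sup>+x. f x * indicator {l..<r} x \<partial>lborel)" if "l \<le> m" "m \<le> r" for l m r
    using that by (subst nn_integral_add[symmetric]) (auto intro!: nn_integral_cong simp: indicator_def)
  have close: "(\<integral>\<^sup>+x. f x * indicator {l..r} x \<partial>lborel) = (\<integral>\<^sup>+x. f x * indicator {l..<r} x \<partial>lborel)" for l r
  proof (rule nn_integral_cong_AE)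
    have "AE x in lborel. x \<noteq> r" by (rule AE_lborel_singleton)
    then show "AE x in lborel. f x * indicator {l..r} x = f x * indicator {l..<r} x"
      by eventually_elim (simp add: indicator_def less_le)
  qed
  define m where "m = real_of_int \<lceil>a\<rceil>"
  have m: "a \<le> m" "m \<le> a + 1" unfolding m_def by linarith+
  have "(\<integral>\<^sup>+x. f x * indicator {a..a + 1} x \<partial>lborel)
    = (\<integral>\<^sup>+x. f x * indicator {a..<m} x \<partial>lborel) + (\<integral>\<^sup>+x. f x * indicator {m..<a + 1} x \<partial>lborel)"
    unfolding close using m by (simp add: join)
  also have "(\<integral>\<^sup>+x. f x * indicator {a..<m} x \<partial>lborel) = (\<integral>\<^sup>+x. f x * indicator {a + 1..<m + 1} x \<partial>lborel)"
    using shift[of a m 1] by simp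
  also have "\<dots> + (\<integral>\<^sup>+x. f x * indicator {m..<a + 1} x \<partial>lborel) = (\<integral>\<^sup>+x. f x * indicator {m..<m + 1} x \<partial>lborel)"
    using m by (subst add.commute) (simp add: join)
  also have "\<dots> = (\<integral>\<^sup>+x. f x * indicator {0..<1} x \<partial>lborel)"
    using shift[of 0 1 "\<lceil>a\<rceil>"] by (simp add: m_def add.commute)
  finally show ?thesis unfolding close .
qed

text \<open>The positions \<open>x\<close> from which an interval reaching \<open>l\<close> to the left and \<open>r\<close> to the right contains an integer.\<close>
definition band :: "real \<Rightarrow> real \<Rightarrow> real set" where
  "band l r = {x. \<exists>k::int. x - l \<le> k \<and> k \<le> x + r}"

lemma band_periodic: "x + 1 \<in> band l r \<longleftrightarrow> x \<in> band l r"
proof -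
  have "x + of_int j \<in> band l r" if "x \<in> band l r" for x j
  proof -
    from that obtain k :: int where "x - l \<le> k" "k \<le> x + r" by (auto simp: band_def)
    then show ?thesis by (auto simp: band_def intro!: exI[of _ "k + j"])
  qed
  from this[of x 1] this[of "x + 1" "-1"] show ?thesis by auto
qed

lemma band_eq_UN: "band l r = (\<Union>k::int. {k - r..k + l})"
  by (auto simp: band_def algebra_simps)

lemma band_measurable [measurable]: "band l r \<in> sets borel"
  unfolding band_eq_UN by (intro sets.countable_UN) auto

lemma band_window:
  assumes "- r \<le> x" "x < 1 - r" "l + r \<le> 1" "x \<noteq> -r"
  shows "x \<in> band l r \<longleftrightarrow> x \<le> l"
proof
  assume "x \<in> band l r"
  then obtain k :: int where k: "x - l \<le> k" "k \<le> x + r" by (auto simp: band_def)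
  then have "real_of_int k < 1" "- 1 < real_of_int k" using assms by linarith+
  then have "k = 0" by linarith
  then show "x \<le> l" using k by simp
next
  assume "x \<le> l"
  then show "x \<in> band l r" using assms by (auto simp: band_def intro!: exI[of _ 0])
qed

text \<open>In the period that starts at \<open>- r\<close> the band is the single interval from \<open>- r\<close> to \<open>l\<close>.\<close>
lemma nn_integral_band:
  assumes "0 \<le> l + r" "l + r \<le> 1"
  shows "(\<integral>\<^sup>+x. indicator (band l r) (x + y) * indicator {0..1} x \<partial>lborel) = ennreal (l + r)"
proof -
  have "(\<integral>\<^sup>+x. indicator (band l r) (x + y) * indicator {0..1} x \<partial>lborel)
    = (\<integral>\<^sup>+x. indicator (band l r) (x + y) * indicator {- r - y..- r - y + 1} x \<partial>lborel)"
  proof (rule nn_integral_periodic[symmetric])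
    show "(indicator (band l r) (x + 1 + y) :: ennreal) = indicator (band l r) (x + y)" for x
      using band_periodic[of "x + y" l r] by (simp add: indicator_def add_ac)
  qed simp
  also have "\<dots> = (\<integral>\<^sup>+x. indicator {- r - y..l - y} x \<partial>lborel)"
  proof (intro nn_integral_cong_AE)
    have "AE x in lborel. x \<noteq> - r - y \<and> x \<noteq> 1 - r - y" by (intro AE_conjI AE_lborel_singleton)
    then show "AE x in lborel. (indicator (band l r) (x + y) * indicator {- r - y..- r - y + 1} x :: ennreal)
       = indicator {- r - y..l - y} x"
    proof eventually_elim
      case (elim x)
      then show ?case using band_window[of r "x + y" l] assms by (auto simp: indicator_def)
    qed
  qed
  also have "\<dots> = ennreal (l + r)" using assms by (simp add: algebra_simps)
  finally show ?thesis .
qed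

context triangle_lattice begin

abbreviation "position_measure \<equiv> uniform_measure lborel (cell a c \<alpha> \<beta>)"

text \<open>The change to lattice coordinates is a shear followed by a stretching, with determinant the area of the cell.\<close>
lemma nn_integral_point:
  assumes [measurable]: "f \<in> borel_measurable borel"
  shows "(\<integral>\<^sup>+z. f z \<partial>lborel) = area * (\<integral>\<^sup>+v. (\<integral>\<^sup>+u. f (point u v) \<partial>lborel) \<partial>lborel)"
proof -
  have c: "0 < c" by (rule triangle_facts)
  have inner: "(\<integral>\<^sup>+x. f (Complex x y) \<partial>lborel) = c * (\<integral>\<^sup>+u. f (Complex (c * u + y * cot \<alpha>) y) \<partial>lborel)" for y
    using c by (subst nn_integral_real_affine[of _ c "y * cot \<alpha>"]) (simp_all add: add.commute)
  have "(\<integral>\<^sup>+z. f z \<partial>lborel) = (\<integral>\<^sup>+y. c * (\<integral>\<^sup>+u. f (Complex (c * u + y * cot \<alpha>) y) \<partial>lborel) \<partial>lborel)"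
    unfolding nn_integral_complex[OF assms] inner ..
  also have "\<dots> = c * (\<integral>\<^sup>+y. (\<integral>\<^sup>+u. f (Complex (c * u + y * cot \<alpha>) y) \<partial>lborel) \<partial>lborel)"
    by (rule nn_integral_cmult) measurable
  also have "(\<integral>\<^sup>+y. (\<integral>\<^sup>+u. f (Complex (c * u + y * cot \<alpha>) y) \<partial>lborel) \<partial>lborel)
     = (area / c) * (\<integral>\<^sup>+v. (\<integral>\<^sup>+u. f (point u v) \<partial>lborel) \<partial>lborel)"
    using c area_pos
    by (subst nn_integral_real_affine[of _ "area / c" 0]) (simp_all add: point_def mult.commute)
  also have "c * ((area / c) * (\<integral>\<^sup>+v. (\<integral>\<^sup>+u. f (point u v) \<partial>lborel) \<partial>lborel)) = area * (\<integral>\<^sup>+v. (\<integral>\<^sup>+u. f (point u v) \<partial>lborel) \<partial>lborel)"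
    using c area_pos by (simp add: mult.assoc[symmetric] ennreal_mult[symmetric])
  finally show ?thesis .
qed

lemma point_in_cell: "point u v \<in> cell a c \<alpha> \<beta> \<longleftrightarrow> u \<in> {0..1} \<and> v \<in> {0..1}"
proof -
  have h: "a * sin \<beta> = area / c" "0 < area / c" "0 < c"
  proof -
    show c: "0 < c" by (rule triangle_facts)
    show "a * sin \<beta> = area / c" using c area_eq(2) by (simp add: field_simps)
    show "0 < area / c" using c area_pos by simp
  qed
  have "0 \<le> v * area / c \<longleftrightarrow> 0 \<le> v" "v * area / c \<le> area / c \<longleftrightarrow> v \<le> 1"
    "c * u + v * area / c * cot \<alpha> \<le> c + v * area / c * cot \<alpha> \<longleftrightarrow> u \<le> 1"
    "v * area / c * cot \<alpha> \<le> c * u + v * area / c * cot \<alpha> \<longleftrightarrow> 0 \<le> u"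
    using h area_pos by (simp_all add: zero_le_divide_iff zero_le_mult_iff divide_le_cancel)
  then show ?thesis unfolding cell_def point_def h by auto
qed

lemma cell_measurable [measurable]: "cell a c \<alpha> \<beta> \<in> sets borel"
  unfolding cell_def by measurable

lemma emeasure_cell_Int:
  assumes [measurable]: "A \<in> sets borel"
  shows "emeasure lborel (cell a c \<alpha> \<beta> \<inter> A) = area *
    (\<integral>\<^sup>+v. (\<integral>\<^sup>+u. indicator A (point u v) * indicator {0..1} u \<partial>lborel) * indicator {0..1} v \<partial>lborel)"
proof -
  have "emeasure lborel (cell a c \<alpha> \<beta> \<inter> A) = (\<integral>\<^sup>+z. indicator (cell a c \<alpha> \<beta> \<inter> A) z \<partial>lborel)" by simp
  also have "\<dots> = area * (\<integral>\<^sup>+v. (\<integral>\<^sup>+u. indicator (cell a c \<alpha> \<beta> \<inter> A) (point u v) \<partial>lborel) \<partial>lborel)"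
    by (rule nn_integral_point) simp
  also have "(\<lambda>v. \<integral>\<^sup>+u. indicator (cell a c \<alpha> \<beta> \<inter> A) (point u v) \<partial>lborel)
     = (\<lambda>v. (\<integral>\<^sup>+u. indicator A (point u v) * indicator {0..1} u \<partial>lborel) * indicator {0..1} v)"
    by (rule ext) (auto simp: point_in_cell indicator_def intro!: nn_integral_cong)
  finally show ?thesis .
qed

lemma emeasure_cell: "emeasure lborel (cell a c \<alpha> \<beta>) = area"
proof -
  have "(\<integral>\<^sup>+v. (\<integral>\<^sup>+u. indicator UNIV (point u v) * indicator {0..1::real} u \<partial>lborel) * indicator {0..1::real} v \<partial>lborel) = 1"
    by simp
  then show ?thesis using emeasure_cell_Int[of UNIV] by simp
qed

lemma emeasure_uniform_cell:
  assumes [measurable]: "A \<in> sets borel"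
  shows "emeasure (position_measure) A =
    (\<integral>\<^sup>+v. (\<integral>\<^sup>+u. indicator A (point u v) * indicator {0..1} u \<partial>lborel) * indicator {0..1} v \<partial>lborel)"
proof -
  have "ennreal area * x / ennreal area = x" for x
    using area_pos mult_divide_eq_ennreal[of "ennreal area" x] by (simp add: mult.commute)
  then show ?thesis
    by (subst emeasure_uniform_measure) (simp_all add: emeasure_cell emeasure_cell_Int)
qed

end

section \<open>A body in a fixed direction at a random position\<close>

lemma AE_add_not_Ints: "AE x in lborel. x + y \<notin> (\<int> :: real set)"
proof -
  have "countable ((\<lambda>k. k - y) ` (\<int> :: real set))"
    by (intro countable_image) (simp add: Ints_def)
  then have "(\<lambda>k. k - y) ` \<int> \<in> null_sets lborel" by (rule countable_imp_null_set_lborel)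
  then have "AE x in lborel. x \<notin> (\<lambda>k. k - y) ` \<int>" by (rule AE_not_in)
  then show ?thesis by eventually_elim (force simp: image_iff)
qed

lemma has_integral_max_increasing:
  fixes p q d :: real
  assumes "p + d \<le> 0" "0 \<le> q + d"
  shows "((\<lambda>x. max 0 (x + d)) has_integral (q + d)\<^sup>2 / 2) {p..q}"
proof -
  have "((\<lambda>x. max 0 (x + d)) has_integral 0) {p..- d}"
    by (rule has_integral_is_0) auto
  moreover have "((\<lambda>x. x + d) has_integral ((q + d)\<^sup>2 / 2 - (- d + d)\<^sup>2 / 2)) {- d..q}"
    using assms by (intro fundamental_theorem_of_calculus)
      (auto intro!: derivative_eq_intros simp flip: has_real_derivative_iff_has_vector_derivative)
  then have "((\<lambda>x. max 0 (x + d)) has_integral (q + d)\<^sup>2 / 2) {- d..q}"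
    by (subst has_integral_cong[where g = "\<lambda>x. x + d"]) auto
  ultimately have "((\<lambda>x. max 0 (x + d)) has_integral (0 + (q + d)\<^sup>2 / 2)) {p..q}"
    using assms by (intro has_integral_combine[of p "- d" q]) auto
  then show ?thesis by simp
qed

lemma has_integral_max_decreasing:
  fixes p q d :: real
  assumes "0 \<le> d - p" "d - q \<le> 0"
  shows "((\<lambda>x. max 0 (d - x)) has_integral (d - p)\<^sup>2 / 2) {p..q}"
proof -
  have "((\<lambda>x. max 0 (d - x)) has_integral 0) {d..q}"
    by (rule has_integral_is_0) auto
  moreover have "((\<lambda>x. d - x) has_integral (- (d - d)\<^sup>2 / 2 - - (d - p)\<^sup>2 / 2)) {p..d}"
    using assms by (intro fundamental_theorem_of_calculus)
      (auto intro!: derivative_eq_intros simp: field_simps simp flip: has_real_derivative_iff_has_vector_derivative)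
  then have "((\<lambda>x. max 0 (d - x)) has_integral (d - p)\<^sup>2 / 2) {p..d}"
    by (subst has_integral_cong[where g = "\<lambda>x. d - x"]) auto
  ultimately have "((\<lambda>x. max 0 (d - x)) has_integral ((d - p)\<^sup>2 / 2 + 0)) {p..q}"
    using assms by (intro has_integral_combine[of p d q]) auto
  then show ?thesis by simp
qed

text \<open>For a doubly periodic function the unit square may be moved anywhere. Below it is placed so that the body meets no
  lattice line but those of level 0.\<close>
lemma unit_square_shift:
  fixes F :: "real \<times> real \<Rightarrow> ennreal"
  assumes F[measurable]: "F \<in> borel_measurable (borel \<Otimes>\<^sub>M borel)"
    and per: "\<And>u v. F (u + 1, v) = F (u, v)" "\<And>u v. F (u, v + 1) = F (u, v)"
  shows "(\<integral>\<^sup>+v. (\<integral>\<^sup>+u. F (u, v) * indicator {0..1} u \<partial>lborel) * indicator {0..1} v \<partial>lborel)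
    = (\<integral>\<^sup>+v. (\<integral>\<^sup>+u. F (u, v) * indicator {a..a + 1} u \<partial>lborel) * indicator {b..b + 1} v \<partial>lborel)"
proof -
  have "(\<integral>\<^sup>+u. F (u, v) * indicator {a..a + 1} u \<partial>lborel) = (\<integral>\<^sup>+u. F (u, v) * indicator {0..1} u \<partial>lborel)" for v
    by (rule nn_integral_periodic) (simp_all add: per)
  moreover have "(\<integral>\<^sup>+v. (\<integral>\<^sup>+u. F (u, v) * indicator {0..1} u \<partial>lborel) * indicator {b..b + 1} v \<partial>lborel)
     = (\<integral>\<^sup>+v. (\<integral>\<^sup>+u. F (u, v) * indicator {0..1} u \<partial>lborel) * indicator {0..1} v \<partial>lborel)"
    by (rule nn_integral_periodic) (simp_all add: per)
  ultimately show ?thesis by simp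
qed

context triangle_lattice begin

text \<open>If the extent of \<open>S\<close> is at most 1 and does not end at an integer, at most one integer
  lies in it, and then strictly inside.\<close>
lemma crosses_iff_band:
  assumes f: "f ` S = {x - l..x + r}" and gen: "x - l \<notin> \<int>" "x + r \<notin> \<int>" and l: "- l \<le> r" "l + r \<le> 1"
  shows "(\<exists>k. crosses f S k) \<longleftrightarrow> x \<in> band l r" and "(\<exists>k. misses f S k) \<or> (\<exists>k. crosses f S k)"
proof -
  have rng: "x - l \<le> f z" "f z \<le> x + r" if "z \<in> S" for z
    using f that by (metis atLeastAtMost_iff imageI)+
  have att: "\<exists>z\<in>S. f z = y" if "x - l \<le> y" "y \<le> x + r" for y
    using f that by (metis atLeastAtMost_iff imageE)
  have 1: "\<exists>k. crosses f S k" if "x \<in> band l r"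
  proof -
    from that obtain k :: int where k: "x - l \<le> k" "k \<le> x + r" by (auto simp: band_def)
    have "x - l \<noteq> of_int k" "x + r \<noteq> of_int k" using gen by (metis Ints_of_int)+
    with k have k': "x - l < k" "k < x + r" by auto
    have "crosses f S k"
      unfolding crosses_def
    proof (intro conjI ballI)
      show "k - 1 < f z" "f z < k + 1" if "z \<in> S" for z using rng[OF that] k' l by auto
      have "\<exists>z\<in>S. f z = x - l" using att[of "x - l"] l by auto
      then show "\<exists>z\<in>S. f z < k" using k'(1) by metis
      show "\<exists>z\<in>S. f z = k" using att[of k] k' by auto
      have "\<exists>z\<in>S. f z = x + r" using att[of "x + r"] l by auto
      then show "\<exists>z\<in>S. k < f z" using k'(2) by metis
    qed
    then show ?thesis by blast
  qed
  moreover have "x \<in> band l r" if cr: "crosses f S k" for k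
  proof -
    obtain z where "z \<in> S" "f z = k" using cr unfolding crosses_def by blast
    then show ?thesis using rng[of z] by (auto simp: band_def intro!: exI[of _ k])
  qed
  ultimately show iff: "(\<exists>k. crosses f S k) \<longleftrightarrow> x \<in> band l r" by blast
  have "\<exists>k. misses f S k" if no: "x \<notin> band l r"
  proof -
    define k where "k = \<lfloor>x - l\<rfloor>"
    have k1: "of_int k < x - l" "x - l < of_int k + 1"
      using gen(1) Ints_of_int[of k] of_int_floor_le[of "x - l"] real_of_int_floor_add_one_gt[of "x - l"]
      by (auto simp: k_def less_le)
    have "\<not> (x - l \<le> of_int (k + 1) \<and> of_int (k + 1) \<le> x + r)" using no unfolding band_def by blast
    then have "x + r < of_int k + 1" using k1 by auto
    then have "misses f S k" using rng k1 unfolding misses_def by force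
    then show ?thesis by blast
  qed
  then show "(\<exists>k. misses f S k) \<or> (\<exists>k. crosses f S k)" using iff by blast
qed

end

text \<open>A body \<open>D\<close> in a fixed direction, with the reference point at the origin. Its extents in the three coordinates
  satisfy \<open>fits\<close>: the triangles circumscribed about it, of either orientation, have sides of at most the lattice length.\<close>
locale placed_body = triangle_lattice +
  fixes D :: "complex set" and lu ru lv rv lw rw :: real
  assumes D: "convex D" "compact D" "D \<noteq> {}"
    and extent: "pu ` D = {- lu..ru}" "pv ` D = {- lv..rv}" "pw ` D = {- lw..rw}"
    and fits: "lu + lv + rw \<le> 1" "ru + rv + lw \<le> 1"
begin

lemma extent_mem:
  assumes "z \<in> D"
  shows "- lu \<le> pu z" "pu z \<le> ru" "- lv \<le> pv z" "pv z \<le> rv" "- lw \<le> pu z + pv z" "pu z + pv z \<le> rw"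
  using extent assms imageI[of z D pu] imageI[of z D pv] imageI[of z D pw] by (auto simp: pw_eq)

lemma extent_nonneg: "- lu \<le> ru" "- lv \<le> rv" "- lw \<le> rw"
proof -
  obtain z where "z \<in> D" using D by auto
  from extent_mem[OF this] show "- lu \<le> ru" "- lv \<le> rv" "- lw \<le> rw" by auto
qed

lemma extent_attained:
  "\<exists>z\<in>D. pu z = - lu" "\<exists>z\<in>D. pu z = ru" "\<exists>z\<in>D. pv z = - lv" "\<exists>z\<in>D. pv z = rv"
  "\<exists>z\<in>D. pu z + pv z = - lw" "\<exists>z\<in>D. pu z + pv z = rw"
proof -
  have *: "\<exists>z\<in>D. f z = y" if "f ` D = {p..q}" "p \<le> y" "y \<le> q" for f :: "complex \<Rightarrow> real" and p q y
  proof -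
    have "y \<in> f ` D" using that by simp
    then show ?thesis by blast
  qed
  show "\<exists>z\<in>D. pu z = - lu" "\<exists>z\<in>D. pu z = ru" "\<exists>z\<in>D. pv z = - lv" "\<exists>z\<in>D. pv z = rv"
    using *[OF extent(1)] *[OF extent(2)] extent_nonneg by auto
  show "\<exists>z\<in>D. pu z + pv z = - lw" "\<exists>z\<in>D. pu z + pv z = rw"
    using *[OF extent(3)] extent_nonneg by (auto simp: pw_eq)
qed

text \<open>Since \<open>pw = pu + pv\<close>, an extreme point in one coordinate bounds the extents in the other two.\<close>
lemma extent_triangle:
  "rw \<le> ru + rv" "lw \<le> lu + lv" "lu \<le> lw + rv" "lv \<le> lw + ru" "ru \<le> rw + lv" "rv \<le> rw + lu"
proof -
  show "rw \<le> ru + rv" using extent_attained(6) extent_mem by fastforce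
  show "lw \<le> lu + lv" using extent_attained(5) extent_mem by fastforce
  show "lu \<le> lw + rv" using extent_attained(1) extent_mem by fastforce
  show "lv \<le> lw + ru" using extent_attained(3) extent_mem by fastforce
  show "ru \<le> rw + lv" using extent_attained(2) extent_mem by fastforce
  show "rv \<le> rw + lu" using extent_attained(4) extent_mem by fastforce
qed

lemma extent_width: "lu + ru \<le> 1" "lv + rv \<le> 1" "lw + rw \<le> 1"
  using extent_triangle fits by linarith+

text \<open>No lattice line touches the body without cutting it.\<close>
definition generic :: "real \<Rightarrow> real \<Rightarrow> bool" where
  "generic u v \<longleftrightarrow> u - lu \<notin> \<int> \<and> u + ru \<notin> \<int> \<and> v - lv \<notin> \<int> \<and> v + rv \<notin> \<int> \<and>
     u + v - lw \<notin> \<int> \<and> u + v + rw \<notin> \<int>"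

abbreviation vertex_inside :: "real \<Rightarrow> real \<Rightarrow> bool" where
  "vertex_inside u v \<equiv> (\<exists>(i :: int) (j :: int). point i j \<in> (\<lambda>z. point u v + z) ` D)"

lemma vertex_inside_iff: "vertex_inside u v \<longleftrightarrow> (\<exists>(i :: int) (j :: int). point (i - u) (j - v) \<in> D)"
proof -
  have "point i j \<in> (\<lambda>z. point u v + z) ` D \<longleftrightarrow> point (i - u) (j - v) \<in> D" for i j
  proof -
    have *: "point i j = point u v + point (i - u) (j - v)"
      by (rule coordinates_inject) simp_all
    show ?thesis unfolding * by (auto simp: image_iff)
  qed
  then show ?thesis by simp
qed

lemma vertex_inside_in_bands:
  assumes "vertex_inside u v"
  shows "u \<in> band lu ru" "v \<in> band lv rv" "u + v \<in> band lw rw"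
proof -
  obtain i j :: int where "point (i - u) (j - v) \<in> D" using assms unfolding vertex_inside_iff by blast
  note m = extent_mem[OF this, simplified]
  show "u \<in> band lu ru" unfolding band_def using m by (intro CollectI exI[of _ i]) auto
  show "v \<in> band lv rv" unfolding band_def using m by (intro CollectI exI[of _ j]) auto
  show "u + v \<in> band lw rw" unfolding band_def using m by (intro CollectI exI[of _ "i + j"]) auto
qed

text \<open>If the lines \<open>i\<close>, \<open>j\<close> and \<open>k\<close> of the three families are all met, then \<open>k\<close> differs from
  \<open>i + j\<close> by less than 1 because the circumscribed triangles are small; so the lines are concurrent.\<close>
lemma card_hit_index_generic:
  assumes "generic u v"
  shows "card (hit_index ((\<lambda>z. point u v + z) ` D)) = 1 + of_bool (u \<in> band lu ru) + of_bool (v \<in> band lv rv)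
    + of_bool (u + v \<in> band lw rw) + 2 * of_bool (vertex_inside u v)"
proof -
  let ?S = "(\<lambda>z. point u v + z) ` D"
  have S: "convex ?S" "closed ?S" "?S \<noteq> {}"
    using D convex_translation[OF D(1)] compact_imp_closed[OF compact_translation[OF D(2)]] by simp_all
  have im: "(\<lambda>z. x + f z) ` D = {x - l..x + r}" if "f ` D = {- l..r}" for f :: "complex \<Rightarrow> real" and x l r
  proof -
    have "(\<lambda>z. x + f z) ` D = (+) x ` f ` D" by (simp add: image_image)
    then show ?thesis unfolding that by simp
  qed
  have imS: "pu ` ?S = {u - lu..u + ru}" "pv ` ?S = {v - lv..v + rv}" "pw ` ?S = {u + v - lw..u + v + rw}"
    unfolding image_image using im[OF extent(1)] im[OF extent(2)] im[OF extent(3)] by simp_all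
  note cu = crosses_iff_band[OF imS(1)] and cv = crosses_iff_band[OF imS(2)] and cw = crosses_iff_band[OF imS(3)]
  note g = assms[unfolded generic_def] extent_nonneg extent_width
  have "k = i + j" if c: "crosses pu ?S i" "crosses pv ?S j" "crosses pw ?S k" for i j k
  proof -
    have strict: "x - l < m \<and> m < x + r" if cr: "crosses f ?S m" "f ` ?S = {x - l..x + r}" for f :: "complex \<Rightarrow> real" and x l r :: real and m :: int
    proof -
      obtain z z' where "z \<in> ?S" "f z < m" "z' \<in> ?S" "m < f z'" using cr(1) unfolding crosses_def by blast
      moreover have "f z \<in> {x - l..x + r}" "f z' \<in> {x - l..x + r}"
        using \<open>z \<in> ?S\<close> \<open>z' \<in> ?S\<close> cr(2) by blast+
      ultimately show ?thesis by auto
    qed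
    have "real_of_int k < of_int (i + j + 1)" "real_of_int (i + j - 1) < of_int k"
      unfolding of_int_add of_int_diff of_int_1
      using strict[OF c(1) imS(1)] strict[OF c(2) imS(2)] strict[OF c(3) imS(3)] fits by linarith+
    then show ?thesis unfolding of_int_less_iff by linarith
  qed
  from card_hit_index[OF S cu(2) cv(2) cw(2) this] show ?thesis
    using g cu(1) cv(1) cw(1) by simp
qed

lemma AE_generic: "AE v in lborel. AE u in lborel. generic u v"
proof -
  have "AE v in lborel. v + (- lv) \<notin> \<int> \<and> v + rv \<notin> \<int>"
    by (intro AE_conjI AE_add_not_Ints)
  then show ?thesis
  proof eventually_elim
    case v: (elim v)
    have "AE u in lborel. u + (- lu) \<notin> \<int> \<and> u + ru \<notin> \<int> \<and> u + (v - lw) \<notin> \<int> \<and> u + (v + rw) \<notin> \<int>"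
      by (intro AE_conjI AE_add_not_Ints)
    then show ?case by eventually_elim (use v in \<open>simp add: generic_def algebra_simps\<close>)
  qed
qed

lemma emeasure_nongeneric:
  assumes A: "A \<in> sets borel" and "\<And>u v. generic u v \<Longrightarrow> point u v \<notin> A"
  shows "emeasure position_measure A = 0"
proof -
  have "AE v in lborel. (\<integral>\<^sup>+u. indicator A (point u v) * indicator {0..1} u \<partial>lborel) * indicator {0..1} v = (0 :: ennreal)"
    using AE_generic
  proof eventually_elim
    case (elim v)
    have "(\<integral>\<^sup>+u. indicator A (point u v) * indicator {0..1} u \<partial>lborel) = (\<integral>\<^sup>+(u::real). (0 :: ennreal) \<partial>lborel)"
    proof (rule nn_integral_cong_AE)
      show "AE u in lborel. indicator A (point u v) * indicator {0..1} u = (0 :: ennreal)"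
        using elim by eventually_elim (use assms(2) in \<open>simp add: indicator_def\<close>)
    qed
    then show ?case by simp
  qed
  then have "(\<integral>\<^sup>+v. (\<integral>\<^sup>+u. indicator A (point u v) * indicator {0..1} u \<partial>lborel) * indicator {0..1} v \<partial>lborel)
     = (\<integral>\<^sup>+(v::real). (0 :: ennreal) \<partial>lborel)"
    by (rule nn_integral_cong_AE)
  then show ?thesis using emeasure_uniform_cell[OF A] by simp
qed

end

context triangle_lattice begin

lemma measurable_coordinates [measurable]:
  "pu \<in> borel_measurable borel" "pv \<in> borel_measurable borel" "pw \<in> borel_measurable borel"
  by (auto intro!: borel_measurable_continuous_onI continuous_intros)

lemma measurable_point [measurable (raw)]:
  assumes [measurable]: "f \<in> borel_measurable M" "g \<in> borel_measurable M"
  shows "(\<lambda>x. point (f x) (g x)) \<in> borel_measurable M"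
  unfolding point_def by measurable

lemma emeasure_position:
  assumes "A \<in> sets borel" "\<And>u v. point u v \<in> A \<longleftrightarrow> (u, v) \<in> R"
  shows "emeasure position_measure A
    = (\<integral>\<^sup>+v. (\<integral>\<^sup>+u. indicator R (u, v) * indicator {0..1} u \<partial>lborel) * indicator {0..1} v \<partial>lborel)"
proof -
  have "indicator A (point u v) = (indicator R (u, v) :: ennreal)" for u v
    using assms(2)[of u v] by (simp add: indicator_def)
  then show ?thesis using emeasure_uniform_cell[OF assms(1)] by simp
qed

text \<open>The two coordinates are independent.\<close>
lemma emeasure_bands_uv:
  assumes lr: "0 \<le> l + r" "l + r \<le> 1" "0 \<le> l' + r'" "l' + r' \<le> 1"
  shows "emeasure position_measure {z. pu z \<in> band l r \<and> pv z \<in> band l' r'} = ennreal ((l + r) * (l' + r'))"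
proof -
  have eq: "indicator {(u, v). u \<in> band l r \<and> v \<in> band l' r'} (u, v) * indicator {0..1} u
      = (indicator (band l' r') v * (indicator (band l r) (u + 0) * indicator {0..1} u) :: ennreal)" for u v :: real
    by (simp add: indicator_def)
  have inner: "(\<integral>\<^sup>+u. indicator (band l' r') v * (indicator (band l r) (u + 0) * indicator {0..1} u) \<partial>lborel)
      = indicator (band l' r') v * ennreal (l + r)" for v
  proof -
    have "(\<integral>\<^sup>+u. indicator (band l' r') v * (indicator (band l r) (u + 0) * indicator {0..1} u) \<partial>lborel)
      = indicator (band l' r') v * (\<integral>\<^sup>+u. indicator (band l r) (u + 0) * indicator {0..1} u \<partial>lborel)"
      by (rule nn_integral_cmult) measurable
    also have "(\<integral>\<^sup>+u. indicator (band l r) (u + 0) * indicator {0..1} u \<partial>lborel) = ennreal (l + r)"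
      using lr by (intro nn_integral_band) auto
    finally show ?thesis .
  qed
  have "emeasure position_measure {z. pu z \<in> band l r \<and> pv z \<in> band l' r'}
     = (\<integral>\<^sup>+v. (\<integral>\<^sup>+u. indicator (band l' r') v * (indicator (band l r) (u + 0) * indicator {0..1} u) \<partial>lborel) * indicator {0..1} v \<partial>lborel)"
    unfolding eq[symmetric] by (rule emeasure_position) auto
  also have "\<dots> = (\<integral>\<^sup>+v. ennreal (l + r) * (indicator (band l' r') (v + 0) * indicator {0..1} v) \<partial>lborel)"
    unfolding inner by (simp add: mult_ac)
  also have "\<dots> = ennreal (l + r) * (\<integral>\<^sup>+v. indicator (band l' r') (v + 0) * indicator {0..1} v \<partial>lborel)"
    by (rule nn_integral_cmult) measurable
  also have "(\<integral>\<^sup>+v. indicator (band l' r') (v + 0) * indicator {0..1} v \<partial>lborel) = ennreal (l' + r')"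
    using lr by (intro nn_integral_band) auto
  finally show ?thesis using lr by (simp add: ennreal_mult mult.commute)
qed

text \<open>Given \<open>v\<close>, the sum \<open>u + v\<close> is uniform modulo 1 whatever \<open>v\<close> is; so these two
  coordinates are independent as well.\<close>
lemma emeasure_bands_vw:
  assumes lr: "0 \<le> l + r" "l + r \<le> 1" "0 \<le> l' + r'" "l' + r' \<le> 1"
  shows "emeasure position_measure {z. pv z \<in> band l r \<and> pw z \<in> band l' r'} = ennreal ((l + r) * (l' + r'))"
proof -
  have eq: "indicator {(u, v). v \<in> band l r \<and> u + v \<in> band l' r'} (u, v) * indicator {0..1} u
      = (indicator (band l r) v * (indicator (band l' r') (u + v) * indicator {0..1} u) :: ennreal)" for u v :: real
    by (simp add: indicator_def)
  have inner: "(\<integral>\<^sup>+u. indicator (band l r) v * (indicator (band l' r') (u + v) * indicator {0..1} u) \<partial>lborel)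
      = indicator (band l r) v * ennreal (l' + r')" for v
  proof -
    have "(\<integral>\<^sup>+u. indicator (band l r) v * (indicator (band l' r') (u + v) * indicator {0..1} u) \<partial>lborel)
      = indicator (band l r) v * (\<integral>\<^sup>+u. indicator (band l' r') (u + v) * indicator {0..1} u \<partial>lborel)"
      by (rule nn_integral_cmult) measurable
    also have "(\<integral>\<^sup>+u. indicator (band l' r') (u + v) * indicator {0..1} u \<partial>lborel) = ennreal (l' + r')"
      using lr by (intro nn_integral_band) auto
    finally show ?thesis .
  qed
  have "emeasure position_measure {z. pv z \<in> band l r \<and> pw z \<in> band l' r'}
     = (\<integral>\<^sup>+v. (\<integral>\<^sup>+u. indicator (band l r) v * (indicator (band l' r') (u + v) * indicator {0..1} u) \<partial>lborel) * indicator {0..1} v \<partial>lborel)"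
    unfolding eq[symmetric] by (rule emeasure_position) auto
  also have "\<dots> = (\<integral>\<^sup>+v. ennreal (l' + r') * (indicator (band l r) (v + 0) * indicator {0..1} v) \<partial>lborel)"
    unfolding inner by (simp add: mult_ac)
  also have "\<dots> = ennreal (l' + r') * (\<integral>\<^sup>+v. indicator (band l r) (v + 0) * indicator {0..1} v \<partial>lborel)"
    by (rule nn_integral_cmult) measurable
  also have "(\<integral>\<^sup>+v. indicator (band l r) (v + 0) * indicator {0..1} v \<partial>lborel) = ennreal (l + r)"
    using lr by (intro nn_integral_band) auto
  finally show ?thesis using lr by (simp add: ennreal_mult mult.commute)
qed

lemma emeasure_bands_uw:
  assumes lr: "0 \<le> l + r" "l + r \<le> 1" "0 \<le> l' + r'" "l' + r' \<le> 1"
  shows "emeasure position_measure {z. pu z \<in> band l r \<and> pw z \<in> band l' r'} = ennreal ((l + r) * (l' + r'))"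
proof -
  have eq: "indicator {(u, v). u \<in> band l r \<and> u + v \<in> band l' r'} (u, v) * indicator {0..1} u
      = (indicator (band l r) u * indicator {0..1} u * indicator (band l' r') (v + u) :: ennreal)" for u v :: real
    by (simp add: indicator_def add.commute)
  have "emeasure position_measure {z. pu z \<in> band l r \<and> pw z \<in> band l' r'}
     = (\<integral>\<^sup>+v. (\<integral>\<^sup>+u. indicator (band l r) u * indicator {0..1} u * indicator (band l' r') (v + u) \<partial>lborel) * indicator {0..1} v \<partial>lborel)"
    unfolding eq[symmetric] by (rule emeasure_position) auto
  also have "\<dots> = (\<integral>\<^sup>+v. (\<integral>\<^sup>+u. (indicator (band l r) u * indicator {0..1} u) * (indicator (band l' r') (v + u) * indicator {0..1} v) \<partial>lborel) \<partial>lborel)"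
    unfolding mult.assoc[symmetric] by (intro nn_integral_cong nn_integral_multc[symmetric]) measurable
  also have "\<dots> = (\<integral>\<^sup>+u. (\<integral>\<^sup>+v. (indicator (band l r) u * indicator {0..1} u) * (indicator (band l' r') (v + u) * indicator {0..1} v) \<partial>lborel) \<partial>lborel)"
    by (rule nn_integral_lborel_swap) measurable
  also have "\<dots> = (\<integral>\<^sup>+u. ennreal (l' + r') * (indicator (band l r) (u + 0) * indicator {0..1} u) \<partial>lborel)"
  proof (rule nn_integral_cong)
    fix u :: real
    have "(\<integral>\<^sup>+v. (indicator (band l r) u * indicator {0..1} u) * (indicator (band l' r') (v + u) * indicator {0..1} v) \<partial>lborel)
      = (indicator (band l r) u * indicator {0..1} u) * (\<integral>\<^sup>+v. indicator (band l' r') (v + u) * indicator {0..1} v \<partial>lborel)"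
      by (rule nn_integral_cmult) measurable
    also have "(\<integral>\<^sup>+v. indicator (band l' r') (v + u) * indicator {0..1} v \<partial>lborel) = ennreal (l' + r')"
      using lr by (intro nn_integral_band) auto
    finally show "(\<integral>\<^sup>+v. (indicator (band l r) u * indicator {0..1} u) * (indicator (band l' r') (v + u) * indicator {0..1} v) \<partial>lborel)
      = ennreal (l' + r') * (indicator (band l r) (u + 0) * indicator {0..1} u)"
      by (simp add: mult_ac)
  qed
  also have "\<dots> = ennreal (l' + r') * (\<integral>\<^sup>+u. indicator (band l r) (u + 0) * indicator {0..1} u \<partial>lborel)"
    by (rule nn_integral_cmult) measurable
  also have "(\<integral>\<^sup>+u. indicator (band l r) (u + 0) * indicator {0..1} u \<partial>lborel) = ennreal (l + r)"
    using lr by (intro nn_integral_band) auto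
  finally show ?thesis using lr by (simp add: ennreal_mult mult.commute)
qed

lemma band_UNIV: "band 0 1 = UNIV"
proof -
  have "x \<in> band 0 1" for x
    unfolding band_def by (rule CollectI, rule exI[of _ "\<lceil>x\<rceil>"]) linarith
  then show ?thesis by auto
qed

end

context placed_body begin

lemma D_borel [measurable]: "D \<in> sets borel"
  using D(2) by (simp add: borel_compact)

lemma widths: "0 \<le> lu + ru" "0 \<le> lv + rv" "0 \<le> lw + rw"
  using extent_nonneg by linarith+

lemma emeasure_hit_two:
  "emeasure position_measure {z. pu z \<in> band lu ru \<and> pv z \<in> band lv rv} = ennreal ((lu + ru) * (lv + rv))"
  "emeasure position_measure {z. pu z \<in> band lu ru \<and> pw z \<in> band lw rw} = ennreal ((lu + ru) * (lw + rw))"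
  "emeasure position_measure {z. pv z \<in> band lv rv \<and> pw z \<in> band lw rw} = ennreal ((lv + rv) * (lw + rw))"
  by (rule emeasure_bands_uv emeasure_bands_uw emeasure_bands_vw; use widths extent_width in simp)+

text \<open>A single family is the case of two families in which the other band is the whole line.\<close>
lemma emeasure_hit_one:
  "emeasure position_measure {z. pu z \<in> band lu ru} = ennreal (lu + ru)"
  "emeasure position_measure {z. pv z \<in> band lv rv} = ennreal (lv + rv)"
  "emeasure position_measure {z. pw z \<in> band lw rw} = ennreal (lw + rw)"
  using widths extent_width emeasure_bands_uv[of lu ru 0 1] emeasure_bands_vw[of lv rv 0 1] emeasure_bands_uw[of 0 1 lw rw]
  by (simp_all add: band_UNIV)

text \<open>The length of the section at \<open>v\<close> of the rectangle of the positions that meet the lines of level 0 of the first two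
  families, after removal of the corners in which the line of level 0 of the third is missed.\<close>
definition section_length :: "real \<Rightarrow> real" where
  "section_length v = lu + ru - max 0 (v + (lu - lw)) - max 0 (ru - rw - v)"

lemma section_length_eq: "section_length v = min lu (lw - v) - max (- ru) (- rw - v)"
  by (auto simp: section_length_def)

lemma section_length_nonneg: "v \<in> {- rv..lv} \<Longrightarrow> max (- ru) (- rw - v) \<le> min lu (lw - v)"
  using extent_triangle extent_nonneg by auto

lemma has_integral_section_length:
  "(section_length has_integral (lu + ru) * (lv + rv) - (lu + lv - lw)\<^sup>2 / 2 - (ru + rv - rw)\<^sup>2 / 2) {- rv..lv}"
proof -
  have "((\<lambda>v. lu + ru) has_integral (lv - - rv) *\<^sub>R (lu + ru)) {- rv..lv}"
    using has_integral_const_real[of "lu + ru" "- rv" lv] extent_nonneg by simp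
  moreover have "((\<lambda>v. max 0 (v + (lu - lw))) has_integral (lv + (lu - lw))\<^sup>2 / 2) {- rv..lv}"
    using extent_triangle by (intro has_integral_max_increasing) auto
  moreover have "((\<lambda>v. max 0 (ru - rw - v)) has_integral (ru - rw - - rv)\<^sup>2 / 2) {- rv..lv}"
    using extent_triangle by (intro has_integral_max_decreasing) auto
  ultimately have "(section_length has_integral (lv - - rv) *\<^sub>R (lu + ru) - (lv + (lu - lw))\<^sup>2 / 2 - (ru - rw - - rv)\<^sup>2 / 2) {- rv..lv}"
    unfolding section_length_def[abs_def] by (intro has_integral_diff)
  then show ?thesis by (simp add: algebra_simps)
qed

lemma hit_uvw_nonneg:
  "(lu + lv - lw)\<^sup>2 / 2 + (ru + rv - rw)\<^sup>2 / 2 \<le> (lu + ru) * (lv + rv)"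
  using has_integral_nonneg[OF has_integral_section_length] section_length_nonneg
  by (simp add: section_length_eq)

text \<open>In the period that starts at \<open>(- ru, - rv)\<close> the first two bands cut out a rectangle. On it the third
  coordinate stays so small that its line can have level 0 only, so the third band removes exactly the two
  right isosceles corners with legs \<open>lu + lv - lw\<close> and \<open>ru + rv - rw\<close>.\<close>
lemma emeasure_hit_uvw:
  "emeasure position_measure {z. pu z \<in> band lu ru \<and> pv z \<in> band lv rv \<and> pw z \<in> band lw rw}
    = ennreal ((lu + ru) * (lv + rv) - (lu + lv - lw)\<^sup>2 / 2 - (ru + rv - rw)\<^sup>2 / 2)"
proof -
  let ?R = "{(u, v). u \<in> band lu ru \<and> v \<in> band lv rv \<and> u + v \<in> band lw rw}"
  have "{p \<in> space (borel \<Otimes>\<^sub>M borel). fst p \<in> band lu ru \<and> snd p \<in> band lv rv \<and> fst p + snd p \<in> band lw rw}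
      \<in> sets (borel \<Otimes>\<^sub>M borel)" by measurable
  also have "{p \<in> space (borel \<Otimes>\<^sub>M borel). fst p \<in> band lu ru \<and> snd p \<in> band lv rv \<and> fst p + snd p \<in> band lw rw} = ?R"
    by (auto simp: space_pair_measure)
  finally have R[measurable]: "?R \<in> sets (borel \<Otimes>\<^sub>M borel)" .
  have "emeasure position_measure {z. pu z \<in> band lu ru \<and> pv z \<in> band lv rv \<and> pw z \<in> band lw rw}
     = (\<integral>\<^sup>+v. (\<integral>\<^sup>+u. indicator ?R (u, v) * indicator {0..1} u \<partial>lborel) * indicator {0..1} v \<partial>lborel)"
    by (rule emeasure_position) auto
  also have "\<dots> = (\<integral>\<^sup>+v. (\<integral>\<^sup>+u. indicator ?R (u, v) * indicator {- ru..- ru + 1} u \<partial>lborel) * indicator {- rv..- rv + 1} v \<partial>lborel)"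
  proof (rule unit_square_shift)
    show "indicator ?R (u + 1, v) = (indicator ?R (u, v) :: ennreal)" for u v
      using band_periodic[of u lu ru] band_periodic[of "u + v" lw rw] by (simp add: indicator_def add_ac)
    show "indicator ?R (u, v + 1) = (indicator ?R (u, v) :: ennreal)" for u v
      using band_periodic[of v lv rv] band_periodic[of "u + v" lw rw] by (simp add: indicator_def add_ac)
  qed simp
  also have "\<dots> = (\<integral>\<^sup>+v. ennreal (section_length v) * indicator {- rv..lv} v \<partial>lborel)"
  proof (rule nn_integral_cong_AE)
    have "AE v in lborel. v \<noteq> - rv \<and> v \<noteq> 1 - rv" by (intro AE_conjI AE_lborel_singleton)
    then show "AE v in lborel. (\<integral>\<^sup>+u. indicator ?R (u, v) * indicator {- ru..- ru + 1} u \<partial>lborel) * indicator {- rv..- rv + 1} v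
       = ennreal (section_length v) * indicator {- rv..lv} v"
    proof eventually_elim
      case v: (elim v)
      consider "v \<in> {- rv..lv}" | "v \<notin> {- rv..- rv + 1}" | "v \<in> {- rv..- rv + 1}" "lv < v"
        by (metis atLeastAtMost_iff not_less)
      then show ?case
      proof cases
        case 1
        then have vb: "v \<in> band lv rv" "v \<in> {- rv..- rv + 1}"
          using v extent_width band_window[of rv v lv] by auto
        have "AE u in lborel. u \<noteq> - ru \<and> u \<noteq> 1 - ru \<and> u \<noteq> lu" by (intro AE_conjI AE_lborel_singleton)
        then have "AE u in lborel. indicator ?R (u, v) * indicator {- ru..- ru + 1} u
           = (indicator {max (- ru) (- rw - v)..min lu (lw - v)} u :: ennreal)"
        proof eventually_elim
          case u: (elim u)
          have "u \<in> band lu ru \<and> u + v \<in> band lw rw \<and> u \<in> {- ru..- ru + 1} \<longleftrightarrow> u \<in> {max (- ru) (- rw - v)..min lu (lw - v)}"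
          proof
            assume a: "u \<in> band lu ru \<and> u + v \<in> band lw rw \<and> u \<in> {- ru..- ru + 1}"
            then have ul: "u \<le> lu" using band_window[of ru u lu] u extent_width by auto
            obtain k :: int where k: "u + v - lw \<le> k" "k \<le> u + v + rw" using a by (auto simp: band_def)
            have "real_of_int k < 1" using k ul u 1 fits by auto
            moreover have "- 1 < real_of_int k" using k a u 1 fits by auto
            ultimately have "k = 0" by linarith
            with k a ul show "u \<in> {max (- ru) (- rw - v)..min lu (lw - v)}" by auto
          next
            assume a: "u \<in> {max (- ru) (- rw - v)..min lu (lw - v)}"
            then have "u + v \<in> band lw rw" by (auto simp: band_def intro!: exI[of _ 0])
            then show "u \<in> band lu ru \<and> u + v \<in> band lw rw \<and> u \<in> {- ru..- ru + 1}"
              using a u extent_width band_window[of ru u lu] by auto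
          qed
          then show ?case using vb by (auto simp: indicator_def)
        qed
        then have "(\<integral>\<^sup>+u. indicator ?R (u, v) * indicator {- ru..- ru + 1} u \<partial>lborel)
          = (\<integral>\<^sup>+u. indicator {max (- ru) (- rw - v)..min lu (lw - v)} u \<partial>lborel)"
          by (rule nn_integral_cong_AE)
        also have "\<dots> = ennreal (section_length v)" using section_length_nonneg[OF 1] by (simp add: section_length_eq)
        finally show ?thesis using 1 vb by simp
      next
        case 2
        then show ?thesis using extent_width by (auto simp: indicator_def)
      next
        case 3
        then have "v \<notin> band lv rv" using v extent_width band_window[of rv v lv] by auto
        then show ?thesis using 3 by simp
      qed
    qed
  qed
  also have "\<dots> = ennreal ((lu + ru) * (lv + rv) - (lu + lv - lw)\<^sup>2 / 2 - (ru + rv - rw)\<^sup>2 / 2)"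
  proof (rule nn_integral_has_integral_lebesgue'[OF _ has_integral_section_length])
    show "0 \<le> section_length v" if "v \<in> {- rv..lv}" for v
      using section_length_nonneg[OF that] by (simp add: section_length_eq)
  qed
  finally show ?thesis .
qed

lemma vertex_event_borel: "{z. \<exists>(i :: int) (j :: int). point i j \<in> (\<lambda>x. z + x) ` D} \<in> sets borel"
proof -
  have "point i j \<in> (\<lambda>x. z + x) ` D \<longleftrightarrow> point i j - z \<in> D" for i j z
    by (auto simp: image_iff intro!: bexI[of _ "point i j - z"])
  then show ?thesis by simp
qed

text \<open>In the same period only the vertex at the origin can be covered, and it is covered from the positions in the
  reflected body, which lies entirely in the period.\<close>
lemma emeasure_vertex:
  "emeasure position_measure {z. \<exists>(i :: int) (j :: int). point i j \<in> (\<lambda>x. z + x) ` D} = ennreal (measure lborel D / area)"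
proof -
  let ?R = "{p. \<exists>(i :: int) (j :: int). point (i - fst p) (j - snd p) \<in> D}"
  have "{p \<in> space (borel \<Otimes>\<^sub>M borel). \<exists>(i :: int) (j :: int). point (i - fst p) (j - snd p) \<in> D} \<in> sets (borel \<Otimes>\<^sub>M borel)"
    by measurable
  then have R[measurable]: "?R \<in> sets (borel \<Otimes>\<^sub>M borel)" by (simp add: space_pair_measure)
  have "emeasure position_measure {z. \<exists>(i :: int) (j :: int). point i j \<in> (\<lambda>x. z + x) ` D}
     = (\<integral>\<^sup>+v. (\<integral>\<^sup>+u. indicator ?R (u, v) * indicator {0..1} u \<partial>lborel) * indicator {0..1} v \<partial>lborel)"
    by (rule emeasure_position[OF vertex_event_borel]) (use vertex_inside_iff in simp)
  also have "\<dots> = (\<integral>\<^sup>+v. (\<integral>\<^sup>+u. indicator ?R (u, v) * indicator {- ru..- ru + 1} u \<partial>lborel) * indicator {- rv..- rv + 1} v \<partial>lborel)"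
  proof (rule unit_square_shift)
    have shift: "(u + of_int m, v + of_int n) \<in> ?R" if uv: "(u, v) \<in> ?R" for u v m n
    proof -
      obtain i j :: int where "point (i - u) (j - v) \<in> D" using uv by auto
      then have "point (of_int (i + m) - (u + of_int m)) (of_int (j + n) - (v + of_int n)) \<in> D" by simp
      then show ?thesis unfolding mem_Collect_eq fst_conv snd_conv by blast
    qed
    show "indicator ?R (u + 1, v) = (indicator ?R (u, v) :: ennreal)" for u v
      using shift[of u v 1 0] shift[of "u + 1" v "-1" 0] by (auto simp: indicator_def)
    show "indicator ?R (u, v + 1) = (indicator ?R (u, v) :: ennreal)" for u v
      using shift[of u v 0 1] shift[of u "v + 1" 0 "-1"] by (auto simp: indicator_def)
  qed simp
  also have "\<dots> = (\<integral>\<^sup>+v. (\<integral>\<^sup>+u. indicator D (- point u v) \<partial>lborel) \<partial>lborel)"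
  proof (rule nn_integral_cong_AE)
    have "AE v in lborel. v \<noteq> 1 - rv \<and> v \<noteq> - rv" by (intro AE_conjI AE_lborel_singleton)
    then show "AE v in lborel. (\<integral>\<^sup>+u. indicator ?R (u, v) * indicator {- ru..- ru + 1} u \<partial>lborel) * indicator {- rv..- rv + 1} v
      = (\<integral>\<^sup>+u. indicator D (- point u v) \<partial>lborel)"
    proof eventually_elim
      case v: (elim v)
      have "(\<integral>\<^sup>+u. indicator ?R (u, v) * indicator {- ru..- ru + 1} u \<partial>lborel) * indicator {- rv..- rv + 1} v
        = (\<integral>\<^sup>+u. (indicator ?R (u, v) * indicator {- ru..- ru + 1} u) * indicator {- rv..- rv + 1} v \<partial>lborel)"
        by (rule nn_integral_multc[symmetric]) measurable
      also have "\<dots> = (\<integral>\<^sup>+u. indicator D (- point u v) \<partial>lborel)"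
      proof (rule nn_integral_cong_AE)
        have "AE u in lborel. u \<noteq> 1 - ru \<and> u \<noteq> - ru" by (intro AE_conjI AE_lborel_singleton)
        then show "AE u in lborel. (indicator ?R (u, v) * indicator {- ru..- ru + 1} u) * indicator {- rv..- rv + 1} v
           = (indicator D (- point u v) :: ennreal)"
        proof eventually_elim
          case u: (elim u)
          have neg: "- point u v = point (0 - u) (0 - v)"
            by (rule coordinates_inject) (simp_all add: linear_neg linear_coordinates)
          have "(u, v) \<in> ?R \<and> u \<in> {- ru..- ru + 1} \<and> v \<in> {- rv..- rv + 1} \<longleftrightarrow> - point u v \<in> D"
          proof
            assume "(u, v) \<in> ?R \<and> u \<in> {- ru..- ru + 1} \<and> v \<in> {- rv..- rv + 1}"
            then obtain i j :: int where ij: "point (i - u) (j - v) \<in> D"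
              and uv: "u \<in> {- ru..- ru + 1}" "v \<in> {- rv..- rv + 1}" by auto
            note m = extent_mem[OF ij, simplified]
            have "real_of_int i < 1" "- 1 < real_of_int i" "real_of_int j < 1" "- 1 < real_of_int j"
              using m u v uv extent_width by auto
            then have "i = 0" "j = 0" by linarith+
            then show "- point u v \<in> D" using ij by (simp add: neg)
          next
            assume a: "- point u v \<in> D"
            note m = extent_mem[OF this, unfolded neg, simplified]
            have "(u, v) \<in> ?R" using a unfolding neg by (auto intro!: exI[of _ "0 :: int"])
            then show "(u, v) \<in> ?R \<and> u \<in> {- ru..- ru + 1} \<and> v \<in> {- rv..- rv + 1}"
              using m extent_width by auto
          qed
          then show ?case by (auto simp: indicator_def)
        qed
      qed
      finally show ?case .
    qed
  qed
  also have "\<dots> = emeasure lborel D / area"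
  proof -
    have "emeasure lborel D = (\<integral>\<^sup>+z. indicator D (cis pi * z) \<partial>lborel)"
      by (subst nn_integral_complex_rotation) simp_all
    also have "\<dots> = area * (\<integral>\<^sup>+v. (\<integral>\<^sup>+u. indicator D (- point u v) \<partial>lborel) \<partial>lborel)"
      by (subst nn_integral_point) simp_all
    finally show ?thesis
      using area_pos by (simp add: ennreal_mult_divide_eq mult.commute[of "ennreal area"])
  qed
  also have "\<dots> = ennreal (measure lborel D / area)"
  proof -
    have "emeasure lborel D = ennreal (measure lborel D)"
      using emeasure_bounded_finite[OF compact_imp_bounded[OF D(2)]] by (intro emeasure_eq_ennreal_measure) simp
    then show ?thesis using area_pos by (simp add: divide_ennreal)
  qed
  finally show ?thesis .
qed

end

section \<open>From lines and vertices to the number of triangles\<close>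

text \<open>Every probability is the expectation of a combination of indicators: on the possible values of the four indicators,
  where the last forces the other three, the indicator of \<open>Z = n\<close> is the combination with the coefficients given in each case.\<close>
lemma (in prob_space) count_distribution:
  fixes Z :: "'a \<Rightarrow> nat"
  assumes ev: "A \<in> events" "B \<in> events" "C \<in> events" "V \<in> events"
    and Z[measurable]: "Z \<in> measurable M (count_space UNIV)"
    and formula: "AE x in M. Z x = 1 + of_bool (x \<in> A) + of_bool (x \<in> B) + of_bool (x \<in> C) + 2 * of_bool (x \<in> V)"
    and V: "V \<subseteq> A \<inter> B \<inter> C"
  defines "s1 \<equiv> prob A + prob B + prob C"
    and "s2 \<equiv> prob (A \<inter> B) + prob (A \<inter> C) + prob (B \<inter> C)"
    and "s3 \<equiv> prob (A \<inter> B \<inter> C)"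
  shows "\<P>(x in M. Z x = 1) = 1 - s1 + s2 - s3"
    and "\<P>(x in M. Z x = 2) = s1 - 2 * s2 + 3 * s3"
    and "\<P>(x in M. Z x = 3) = s2 - 3 * s3"
    and "\<P>(x in M. Z x = 4) = s3 - prob V"
    and "\<P>(x in M. Z x = 5) = 0"
    and "\<P>(x in M. Z x = 6) = prob V"
    and "expectation (\<lambda>x. real (Z x)) = 1 + s1 + 2 * prob V"
proof -
  define comb :: "real \<Rightarrow> real \<Rightarrow> real \<Rightarrow> real \<Rightarrow> real \<Rightarrow> 'a \<Rightarrow> real" where
    "comb k0 k1 k2 k3 k4 x = k0 + k1 * (indicator A x + indicator B x + indicator C x)
      + k2 * (indicator (A \<inter> B) x + indicator (A \<inter> C) x + indicator (B \<inter> C) x)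
      + k3 * indicator (A \<inter> B \<inter> C) x + k4 * indicator V x" for k0 k1 k2 k3 k4 x
  have int: "integrable M (indicator X :: 'a \<Rightarrow> real)" if "X \<in> events" for X
    using that by (simp add: integrable_indicator_iff less_top[symmetric])
  have I: "A \<inter> B \<in> events" "A \<inter> C \<in> events" "B \<inter> C \<in> events" "A \<inter> B \<inter> C \<in> events"
    using ev by auto
  note ints = int[OF ev(1)] int[OF ev(2)] int[OF ev(3)] int[OF ev(4)] int[OF I(1)] int[OF I(2)] int[OF I(3)] int[OF I(4)]
  have ex: "expectation (indicator X) = prob X" if "X \<in> events" for X
    using that by simp
  have comb: "expectation (comb k0 k1 k2 k3 k4) = k0 + k1 * s1 + k2 * s2 + k3 * s3 + k4 * prob V" for k0 k1 k2 k3 k4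
    unfolding comb_def using ints
    by (simp add: ex ev I s1_def s2_def s3_def prob_space del: Bochner_Integration.integral_indicator)
  have comb_meas [measurable]: "comb k0 k1 k2 k3 k4 \<in> borel_measurable M" for k0 k1 k2 k3 k4
    unfolding comb_def using ev I by measurable
  have P: "\<P>(x in M. Z x = n) = k0 + k1 * s1 + k2 * s2 + k3 * s3 + k4 * prob V"
    if n: "\<And>p q r v. v \<longrightarrow> p \<and> q \<and> r \<Longrightarrow> of_bool (1 + of_bool p + of_bool q + of_bool r + 2 * of_bool v = n)
       = k0 + k1 * (of_bool p + of_bool q + of_bool r) + k2 * (of_bool (p \<and> q) + of_bool (p \<and> r) + of_bool (q \<and> r))
         + k3 * of_bool (p \<and> q \<and> r) + k4 * of_bool v" for n k0 k1 k2 k3 k4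
  proof -
    have "\<P>(x in M. Z x = n) = expectation (indicator {x \<in> space M. Z x = n})"
      by (subst ex) auto
    also have "\<dots> = expectation (comb k0 k1 k2 k3 k4)"
    proof (rule integral_cong_AE)
      show "AE x in M. indicator {x \<in> space M. Z x = n} x = comb k0 k1 k2 k3 k4 x"
        using formula AE_space
      proof eventually_elim
        case (elim x)
        have "x \<in> V \<longrightarrow> x \<in> A \<and> x \<in> B \<and> x \<in> C" using V by auto
        from n[OF this] elim show ?case
          by (simp add: comb_def indicator_def of_bool_def Int_iff conj_assoc)
      qed
    qed measurable
    finally show ?thesis unfolding comb .
  qed
  show "\<P>(x in M. Z x = 1) = 1 - s1 + s2 - s3" by (subst P[of 1 1 "-1" 1 "-1" 0]) auto
  show "\<P>(x in M. Z x = 2) = s1 - 2 * s2 + 3 * s3" by (subst P[of 2 0 1 "-2" 3 0]) auto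
  show "\<P>(x in M. Z x = 3) = s2 - 3 * s3" by (subst P[of 3 0 0 1 "-3" 0]) auto
  show "\<P>(x in M. Z x = 4) = s3 - prob V" by (subst P[of 4 0 0 0 1 "-1"]) auto
  show "\<P>(x in M. Z x = 5) = 0" by (subst P[of 5 0 0 0 0 0]) auto
  show "\<P>(x in M. Z x = 6) = prob V" by (subst P[of 6 0 0 0 0 1]) auto
  have "expectation (\<lambda>x. real (Z x)) = expectation (comb 1 1 0 0 2)"
  proof (rule integral_cong_AE)
    show "AE x in M. real (Z x) = comb 1 1 0 0 2 x"
      using formula by eventually_elim (simp add: comb_def indicator_def)
  qed measurable
  then show "expectation (\<lambda>x. real (Z x)) = 1 + s1 + 2 * prob V" unfolding comb by simp
qed

context triangle_lattice begin

abbreviation "throw \<equiv> throw_law a c \<alpha> \<beta>"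

lemma prob_space_position: "prob_space position_measure"
  using area_pos by (intro prob_space_uniform_measure) (simp_all add: emeasure_cell)

lemma prob_space_angle: "prob_space (uniform_measure lborel {0..2 * pi})"
  by (intro prob_space_uniform_measure) simp_all

lemma prob_space_throw_law: "prob_space throw"
proof -
  interpret X: prob_space position_measure by (rule prob_space_position)
  interpret Y: prob_space "uniform_measure lborel {0..2 * pi}" by (rule prob_space_angle)
  interpret XY: pair_prob_space position_measure "uniform_measure lborel {0..2 * pi}" ..
  show ?thesis unfolding throw_law_def by (rule XY.P.prob_space_axioms)
qed

lemma sets_throw_law [measurable_cong]: "sets throw = sets (borel \<Otimes>\<^sub>M borel)"
  unfolding throw_law_def by (intro sets_pair_measure_cong) simp_all

text \<open>Fubini: the probability is the mean over the direction of the probability for a fixed direction.\<close>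
lemma measure_throw_law:
  assumes E: "E \<in> sets (borel \<Otimes>\<^sub>M borel)" and m: "continuous_on {0..2 * pi} m"
    and slice: "\<And>\<phi>. \<phi> \<in> {0..2 * pi} \<Longrightarrow> 0 \<le> m \<phi> \<and>
       emeasure position_measure {z. (z, \<phi>) \<in> E} = ennreal (m \<phi>)"
  shows "measure throw E = integral {0..2 * pi} m / (2 * pi)"
proof -
  let ?P = position_measure and ?A = "uniform_measure lborel {0..2 * pi}"
  interpret X: prob_space ?P by (rule prob_space_position)
  interpret Y: prob_space ?A by (rule prob_space_angle)
  interpret XY: pair_prob_space ?P ?A ..
  have E': "E \<in> sets (?P \<Otimes>\<^sub>M ?A)" using E by (simp cong: sets_pair_measure_cong)
  have m_int: "(m has_integral integral {0..2 * pi} m) {0..2 * pi}"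
    using integrable_continuous_real[OF m] by (simp add: has_integral_integral)
  have "(\<lambda>\<phi>. emeasure ?P ((\<lambda>z. (z, \<phi>)) -` E)) \<in> borel_measurable ?A"
    by (rule XY.measurable_emeasure_Pair2[OF E'])
  then have meas: "(\<lambda>\<phi>. emeasure ?P ((\<lambda>z. (z, \<phi>)) -` E)) \<in> borel_measurable lborel"
    by simp
  have "emeasure throw E = (\<integral>\<^sup>+\<phi>. emeasure ?P ((\<lambda>z. (z, \<phi>)) -` E) \<partial>?A)"
    unfolding throw_law_def by (rule XY.emeasure_pair_measure_alt2[OF E'])
  also have "\<dots> = (\<integral>\<^sup>+\<phi>. emeasure ?P ((\<lambda>z. (z, \<phi>)) -` E) * indicator {0..2 * pi} \<phi> \<partial>lborel) / emeasure lborel {0..2 * pi}"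
    by (rule nn_integral_uniform_measure[OF meas]) simp
  also have "(\<integral>\<^sup>+\<phi>. emeasure ?P ((\<lambda>z. (z, \<phi>)) -` E) * indicator {0..2 * pi} \<phi> \<partial>lborel)
      = (\<integral>\<^sup>+\<phi>. ennreal (m \<phi>) * indicator {0..2 * pi} \<phi> \<partial>lborel)"
    using slice by (intro nn_integral_cong) (auto simp: indicator_def vimage_def)
  also have "\<dots> = ennreal (integral {0..2 * pi} m)"
    using slice m_int by (intro nn_integral_has_integral_lebesgue') auto
  also have "\<dots> / emeasure lborel {0..2 * pi} = ennreal (integral {0..2 * pi} m / (2 * pi))"
    using slice integral_nonneg[OF integrable_continuous_real[OF m]] by (simp add: divide_ennreal)
  finally show ?thesis
    using slice integral_nonneg[OF integrable_continuous_real[OF m]]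
    by (intro measure_eq_emeasure_eq_ennreal) simp_all
qed

end

section \<open>Correlations of the support function\<close>

lemma supp_range:
  assumes "convex A" "compact A" "A \<noteq> {}"
  shows "(\<lambda>z. Re (cis \<phi> * z)) ` A = {- supp A (\<phi> + pi)..supp A \<phi>}"
proof
  show "(\<lambda>z. Re (cis \<phi> * z)) ` A \<subseteq> {- supp A (\<phi> + pi)..supp A \<phi>}"
    using supp_ge supp_ge_opposite assms(2) by auto
  obtain z1 where z1: "z1 \<in> A" "Re (cis \<phi> * z1) = supp A \<phi>"
    using supp_attained[OF assms(2,3)] .
  obtain z2 where z2: "z2 \<in> A" "Re (cis (\<phi> + pi) * z2) = supp A (\<phi> + pi)"
    using supp_attained[OF assms(2,3)] .
  have z2': "Re (cis \<phi> * z2) = - supp A (\<phi> + pi)" using z2(2) by (simp add: cis_mult[symmetric])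
  have "connected ((\<lambda>z. Re (cis \<phi> * z)) ` A)"
    using assms by (intro connected_continuous_image continuous_intros convex_connected)
  from connectedD_interval[OF this imageI[OF z2(1)] imageI[OF z1(1)]]
  show "{- supp A (\<phi> + pi)..supp A \<phi>} \<subseteq> (\<lambda>z. Re (cis \<phi> * z)) ` A"
    unfolding z1(2) z2' by auto
qed

lemma supp_scaled_range:
  assumes "convex A" "compact A" "A \<noteq> {}" "0 < k"
  shows "(\<lambda>z. k * Re (cis \<phi> * z)) ` A = {- (k * supp A (\<phi> + pi))..k * supp A \<phi>}"
proof -
  have "(\<lambda>z. k * Re (cis \<phi> * z)) ` A = (*) k ` (\<lambda>z. Re (cis \<phi> * z)) ` A" by (simp add: image_image)
  also have "\<dots> = {k * - supp A (\<phi> + pi)..k * supp A \<phi>}"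
    unfolding supp_range[OF assms(1-3)] by (rule image_mult_atLeastAtMost[OF assms(4)])
  finally show ?thesis by simp
qed

text \<open>Common form of \<^const>\<open>J_fun\<close>, for the support function, and of twice \<^const>\<open>I_fun\<close>, for the width.\<close>
definition periodic_correlation :: "(real \<Rightarrow> real) \<Rightarrow> real \<Rightarrow> real" where
  "periodic_correlation f x = integral {0..2 * pi} (\<lambda>t. f t * f (t + x))"

lemma continuous_shift:
  assumes "continuous_on UNIV (f :: real \<Rightarrow> real)"
  shows "continuous_on X (\<lambda>t. f (t + x))"
  by (intro continuous_on_compose2[OF assms] continuous_intros) auto

lemma has_integral_shift_periodic:
  fixes f :: "real \<Rightarrow> real"
  assumes f: "continuous_on UNIV f" "\<And>x. f (x + 2 * pi) = f x"
  shows "((\<lambda>t. f (t + x)) has_integral integral {0..2 * pi} f) {0..2 * pi}"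
proof -
  have "(\<lambda>t. f (t + x)) integrable_on {0..2 * pi}"
    by (intro integrable_continuous_real continuous_shift f(1))
  moreover have "integral {0..2 * pi} (\<lambda>t. f (t + x)) = integral {0..2 * pi} f"
    by (rule periodic_integral_shift[OF f]) simp
  ultimately show ?thesis by (metis integrable_integral)
qed

lemma has_integral_correlation:
  fixes f :: "real \<Rightarrow> real"
  assumes f: "continuous_on UNIV f" "\<And>x. f (x + 2 * pi) = f x"
  shows "((\<lambda>t. f (t + x) * f (t + y)) has_integral periodic_correlation f (y - x)) {0..2 * pi}"
proof -
  have "((\<lambda>t. f (t + x) * f (t + x + (y - x))) has_integral integral {0..2 * pi} (\<lambda>t. f t * f (t + (y - x)))) {0..2 * pi}"
  proof (rule has_integral_shift_periodic)
    show "continuous_on UNIV (\<lambda>t. f t * f (t + (y - x)))"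
      using continuous_shift[OF f(1)] f(1) by (intro continuous_intros)
    show "f (t + 2 * pi) * f (t + 2 * pi + (y - x)) = f t * f (t + (y - x))" for t
      using f(2)[of t] f(2)[of "t + (y - x)"] by (simp add: add_ac)
  qed
  then show ?thesis by (simp add: periodic_correlation_def)
qed

lemma correlation_even:
  assumes f: "continuous_on UNIV f" "\<And>x. f (x + 2 * pi) = f x"
  shows "periodic_correlation f (- x) = periodic_correlation f x"
  using has_integral_unique[OF has_integral_correlation[OF f, of 0 x]] has_integral_correlation[OF f, of x 0]
  by (simp add: mult.commute)

lemma correlation_periodic:
  assumes "\<And>x. f (x + p) = f x"
  shows "periodic_correlation f (x + p) = periodic_correlation f x"
proof -
  have "f (t + (x + p)) = f (t + x)" for t using assms[of "t + x"] by (simp add: add_ac)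
  then show ?thesis by (simp add: periodic_correlation_def)
qed

lemma J_fun_eq: "J_fun s x = periodic_correlation s x"
  by (simp add: J_fun_def periodic_correlation_def)

lemma width_periodic: "(\<And>x. s (x + 2 * pi) = s x) \<Longrightarrow> width s (x + pi) = width s x"
  by (simp add: width_def add.assoc)

lemma continuous_width: "continuous_on UNIV s \<Longrightarrow> continuous_on UNIV (width s)"
  unfolding width_def by (intro continuous_intros continuous_shift)

text \<open>The width has period \<open>pi\<close>, so the full period counts everything twice.\<close>
lemma I_fun_eq:
  assumes s: "continuous_on UNIV s" "\<And>x. s (x + 2 * pi) = s x"
  shows "periodic_correlation (width s) x = 2 * I_fun s x"
proof -
  let ?h = "\<lambda>t. width s t * width s (t + x)"
  have c: "continuous_on UNIV ?h"
    using continuous_width[OF s(1)] continuous_shift[OF continuous_width[OF s(1)]] by (intro continuous_intros)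
  have "integral {0..2 * pi} ?h = integral {0..pi} ?h + integral {pi..2 * pi} ?h"
    using c by (intro Henstock_Kurzweil_Integration.integral_combine[symmetric] integrable_continuous_real)
      (auto intro: continuous_on_subset)
  also have "integral {pi..2 * pi} ?h = integral {0..pi} (\<lambda>t. ?h (t + pi))"
    using integral_shift_interval[OF c, of 0 pi pi] by simp
  also have "(\<lambda>t. ?h (t + pi)) = ?h"
  proof (rule ext)
    fix t
    have "t + pi + x = t + x + pi" by simp
    then show "?h (t + pi) = ?h t"
      using width_periodic[of s, OF s(2)] by (simp only:)
  qed
  finally show ?thesis by (simp add: periodic_correlation_def I_fun_def)
qed

section \<open>A body thrown at random\<close>

locale thrown_body = triangle_lattice +
  fixes K :: "complex set" and r e :: complex
  assumes body: "convex_body K" "r \<in> K" "e \<noteq> r"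
    and fits: "\<forall>\<phi>. 0 \<le> \<phi> \<and> \<phi> < 2 * pi \<longrightarrow> c_star (support_function K r e) \<alpha> \<beta> \<phi> \<le> c"
begin

definition "s = support_function K r e"
text \<open>The body with the reference point at the origin and \<open>\<sigma>\<close> along the positive axis.\<close>
definition "body0 = (\<lambda>p. (p - r) / sgn (e - r)) ` K"

lemma norm_sgn_axis: "norm (sgn (e - r)) = 1"
  using body(3) by (simp add: norm_sgn)

lemma body0: "convex body0" "compact body0" "body0 \<noteq> {}"
proof -
  have K: "convex K" "compact K" using body(1) by (auto simp: convex_body_def)
  have eq: "body0 = (\<lambda>p. p / sgn (e - r)) ` (\<lambda>p. - r + p) ` K"
    by (simp add: body0_def image_image)
  have "linear (\<lambda>p. p / sgn (e - r))"
    by (rule linearI) (simp_all add: add_divide_distrib scaleR_conv_of_real)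
  then show "convex body0" unfolding eq
    by (intro convex_linear_image convex_translation K)
  show "compact body0" unfolding body0_def using norm_sgn_axis
    by (intro compact_continuous_image continuous_intros K) auto
  show "body0 \<noteq> {}" using body(2) by (auto simp: body0_def)
qed

lemma s_eq: "s = supp body0"
  by (rule ext) (simp only: s_def support_function_def placed_def supp_def body0_def image_image add_0_left)

lemma s_periodic: "s (x + 2 * pi) = s x"
  by (simp add: s_eq supp_periodic)

lemma s_continuous: "continuous_on UNIV s"
  using body0 by (simp add: s_eq supp_continuous)

text \<open>The normalisation of the body changes the support function by a shift of the angle and by a trigonometric term
  with mean 0.\<close>
lemma perimeter_eq: "perimeter K = integral {0..2 * pi} s"
proof -
  have K: "convex K" "compact K" "interior K \<noteq> {}" using body(1) by (auto simp: convex_body_def)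
  have ne: "K \<noteq> {}" using body by auto
  obtain \<eta> where \<eta>: "sgn (e - r) = cis \<eta>"
    using norm_sgn_axis by (metis cis_Arg norm_zero sgn_sgn zero_neq_one)
  have s: "s \<phi> = supp K (\<phi> - \<eta>) - Re (cis (\<phi> - \<eta>) * r)" for \<phi>
  proof -
    have *: "Re (cis \<phi> * ((p - r) / sgn (e - r))) = Re (cis (\<phi> - \<eta>) * p) - Re (cis (\<phi> - \<eta>) * r)" for p
    proof -
      have "cis \<phi> * ((p - r) / sgn (e - r)) = cis (\<phi> - \<eta>) * p - cis (\<phi> - \<eta>) * r"
        by (simp add: \<eta> cis_divide[symmetric] diff_divide_distrib right_diff_distrib)
      then show ?thesis by simp
    qed
    obtain p where p: "p \<in> K" "Re (cis (\<phi> - \<eta>) * p) = supp K (\<phi> - \<eta>)" using supp_attained[OF K(2) ne] .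
    obtain q where q: "q \<in> body0" "Re (cis \<phi> * q) = s \<phi>"
      using supp_attained[OF body0(2,3)] unfolding s_eq .
    then obtain p' where p': "p' \<in> K" "q = (p' - r) / sgn (e - r)" by (auto simp: body0_def)
    have "(p - r) / sgn (e - r) \<in> body0" using p(1) by (auto simp: body0_def)
    from supp_ge[OF body0(2) this, of \<phi>] have "supp K (\<phi> - \<eta>) - Re (cis (\<phi> - \<eta>) * r) \<le> s \<phi>"
      unfolding * s_eq p(2) .
    moreover have "s \<phi> \<le> supp K (\<phi> - \<eta>) - Re (cis (\<phi> - \<eta>) * r)"
      using supp_ge[OF K(2) p'(1), of "\<phi> - \<eta>"] unfolding q(2)[symmetric] p'(2) * by simp
    ultimately show ?thesis by simp
  qed
  have sK: "continuous_on UNIV (supp K)" by (rule supp_continuous[OF K(2) ne])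
  have tr: "((\<lambda>\<phi>. Re (cis (\<phi> + (- \<eta>)) * r)) has_integral integral {0..2 * pi} (\<lambda>\<phi>. Re (cis \<phi> * r))) {0..2 * pi}"
    by (rule has_integral_shift_periodic) (auto intro!: continuous_intros simp: cis_mult[symmetric])
  have zero: "integral {0..2 * pi} (\<lambda>\<phi>. Re (cis \<phi> * r)) = 0"
  proof -
    have "((\<lambda>\<phi>. Re (cis \<phi> * r)) has_integral
        (Re r * sin (2 * pi) + Im r * cos (2 * pi)) - (Re r * sin 0 + Im r * cos 0)) {0..2 * pi}"
      by (intro fundamental_theorem_of_calculus)
        (auto intro!: derivative_eq_intros simp: mult.commute simp flip: has_real_derivative_iff_has_vector_derivative)
    then show ?thesis by (simp add: integral_unique)
  qed
  have "((\<lambda>\<phi>. supp K (\<phi> + (- \<eta>)) - Re (cis (\<phi> + (- \<eta>)) * r)) has_integral (integral {0..2 * pi} (supp K) - 0)) {0..2 * pi}"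
    using has_integral_shift_periodic[OF sK supp_periodic, of "- \<eta>"] tr unfolding zero by (intro has_integral_diff)
  then have "integral {0..2 * pi} s = integral {0..2 * pi} (supp K)"
    unfolding s by (simp add: s integral_unique)
  then show ?thesis using perimeter_eq_integral_supp[OF K] by simp
qed

lemma fits_all: "c_star s \<alpha> \<beta> t \<le> c"
proof -
  have per: "c_star s \<alpha> \<beta> (x + 2 * pi) = c_star s \<alpha> \<beta> x" for x
    using s_periodic[of x] s_periodic[of "x + \<alpha> + \<beta>"] s_periodic[of "x + \<alpha> + pi"]
    by (simp add: c_star_def add_ac)
  \<comment> \<open>The representative of \<open>t\<close> in the period for which the hypothesis is stated.\<close>
  define y where "y = t - of_int \<lfloor>t / (2 * pi)\<rfloor> * (2 * pi)"
  have "y = 2 * pi * frac (t / (2 * pi))" by (simp add: y_def frac_def field_simps)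
  then have "0 \<le> y" "y < 2 * pi" using frac_lt_1[of "t / (2 * pi)"] by auto
  then have "c_star s \<alpha> \<beta> y \<le> c" using fits by (simp add: s_def)
  moreover have "c_star s \<alpha> \<beta> (y + of_int \<lfloor>t / (2 * pi)\<rfloor> * (2 * pi)) = c_star s \<alpha> \<beta> y"
    by (rule periodic_add_int[of "c_star s \<alpha> \<beta>" "2 * pi"]) (rule per)
  ultimately show ?thesis by (simp add: y_def)
qed

text \<open>The direction is measured by the angle \<open>t\<close> from the outward normal of the side \<open>b\<close>, which is
  \<open>cis (\<alpha> + pi / 2)\<close>, to \<open>\<sigma>\<close>.\<close>
definition rotated :: "real \<Rightarrow> complex set" where
  "rotated t = (\<lambda>q. cis (t + \<alpha> + pi / 2) * q) ` body0"

text \<open>Each lattice coordinate is a multiple of the projection to the normal of the sides of one family. The normals are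
  \<open>cis (\<alpha> - pi / 2)\<close>, \<open>cis (pi / 2)\<close> and \<open>cis (pi / 2 - \<beta>)\<close>; the altitudes \<open>area / b\<close>,
  \<open>area / c\<close>, \<open>area / a\<close> set the scale.\<close>
lemma coordinates_rotated:
  "pu (cis (t + \<alpha> + pi / 2) * q) = (b / area) * Re (cis (t + pi) * q)"
  "pv (cis (t + \<alpha> + pi / 2) * q) = (c / area) * Re (cis (t + \<alpha>) * q)"
  "pw (cis (t + \<alpha> + pi / 2) * q) = (a / area) * Re (cis (t + \<alpha> + \<beta>) * q)"
proof -
  have 1: "Re (z * cis (- \<theta>)) = Re z * cos \<theta> + Im z * sin \<theta>" for z \<theta> by (simp add: algebra_simps)
  have "pu z = (b / area) * Re (z * cis (- (\<alpha> - pi / 2)))" for z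
    unfolding 1 by (simp add: pu_def cos_diff sin_diff)
  then have "pu (cis (t + \<alpha> + pi / 2) * q) = (b / area) * Re (q * (cis (t + \<alpha> + pi / 2) * cis (- (\<alpha> - pi / 2))))"
    by (simp only: mult_ac)
  also have "cis (t + \<alpha> + pi / 2) * cis (- (\<alpha> - pi / 2)) = cis (t + pi)" unfolding cis_mult by (simp add: add.commute)
  finally show "pu (cis (t + \<alpha> + pi / 2) * q) = (b / area) * Re (cis (t + pi) * q)" by (simp only: mult.commute)
  have "pv z = (c / area) * Re (z * cis (- (pi / 2)))" for z
    unfolding 1 by (simp add: pv_def)
  then have "pv (cis (t + \<alpha> + pi / 2) * q) = (c / area) * Re (q * (cis (t + \<alpha> + pi / 2) * cis (- (pi / 2))))"
    by (simp only: mult_ac)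
  also have "cis (t + \<alpha> + pi / 2) * cis (- (pi / 2)) = cis (t + \<alpha>)" unfolding cis_mult by simp
  finally show "pv (cis (t + \<alpha> + pi / 2) * q) = (c / area) * Re (cis (t + \<alpha>) * q)" by (simp only: mult.commute)
  have "pw z = (a / area) * Re (z * cis (- (pi / 2 - \<beta>)))" for z
    unfolding 1 by (simp add: pw_def cos_diff sin_diff)
  then have "pw (cis (t + \<alpha> + pi / 2) * q) = (a / area) * Re (q * (cis (t + \<alpha> + pi / 2) * cis (- (pi / 2 - \<beta>))))"
    by (simp only: mult_ac)
  also have "cis (t + \<alpha> + pi / 2) * cis (- (pi / 2 - \<beta>)) = cis (t + \<alpha> + \<beta>)" unfolding cis_mult by (simp add: add_ac)
  finally show "pw (cis (t + \<alpha> + pi / 2) * q) = (a / area) * Re (cis (t + \<alpha> + \<beta>) * q)" by (simp only: mult.commute)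
qed

text \<open>The extents of the rotated body: \<open>l\<close> for the negative and \<open>r\<close> for the positive direction of the coordinate
  named by the second letter.\<close>
definition "lu t = b / area * s t"
definition "ru t = b / area * s (t + pi)"
definition "lv t = c / area * s (t + \<alpha> + pi)"
definition "rv t = c / area * s (t + \<alpha>)"
definition "lw t = a / area * s (t + \<alpha> + \<beta> + pi)"
definition "rw t = a / area * s (t + \<alpha> + \<beta>)"

text \<open>Three of the extents belong to the outward normals of a lattice triangle; their sum is the size of the
  circumscribed triangle relative to the lattice.\<close>
lemma c_star_eq: "c * (lu t + lv t + rw t) = c_star s \<alpha> \<beta> t"
proof -
  have abc: "0 < a" "0 < b" "0 < c" by (rule triangle_facts)+
  have "c * (b / area) = 1 / sin \<alpha>" using abc sin_pos area_eq(1) by simp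
  moreover have "c * (a / area) = 1 / sin \<beta>" using abc sin_pos area_eq(2) by simp
  moreover have "c * (c / area) = cot \<alpha> + cot \<beta>"
  proof -
    have "c * (c / area) = c * (b * cos \<alpha>) / area + c * (a * cos \<beta>) / area"
      using projection_law by (metis add.commute add_divide_distrib distrib_left times_divide_eq_right)
    also have "c * (b * cos \<alpha>) / area = cot \<alpha>" using abc sin_pos by (simp add: area_eq(1) cot_def)
    also have "c * (a * cos \<beta>) / area = cot \<beta>" using abc sin_pos by (simp add: area_eq(2) cot_def)
    finally show ?thesis .
  qed
  moreover have "c * (lu t + lv t + rw t) = s t * (c * (b / area)) + s (t + \<alpha> + \<beta>) * (c * (a / area)) + s (t + \<alpha> + pi) * (c * (c / area))"
    by (simp add: lu_def lv_def rw_def algebra_simps)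
  ultimately show ?thesis by (simp only: c_star_def)
qed

text \<open>Half a turn exchanges the two sides of the body, and with them the two kinds of circumscribed triangles.\<close>
lemma shift_pi: "ru t = lu (t + pi)" "rv t = lv (t + pi)" "lw t = rw (t + pi)"
  "lu t = ru (t + pi)" "lv t = rv (t + pi)" "rw t = lw (t + pi)"
  using s_periodic[of t] s_periodic[of "t + \<alpha>"] s_periodic[of "t + \<alpha> + \<beta>"]
  by (simp_all add: lu_def ru_def lv_def rv_def lw_def rw_def add_ac)

lemma placed_body_rotated: "placed_body a b c \<alpha> \<beta> \<gamma> (rotated t) (lu t) (ru t) (lv t) (rv t) (lw t) (rw t)"
proof
  have lin: "linear (\<lambda>q. cis (t + \<alpha> + pi / 2) * q)"
    by (rule linearI) (simp_all add: algebra_simps)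
  show "convex (rotated t)" unfolding rotated_def by (intro convex_linear_image lin body0)
  show "compact (rotated t)" unfolding rotated_def by (intro compact_continuous_image continuous_intros body0)
  show "rotated t \<noteq> {}" using body0 by (simp add: rotated_def)
  have pos: "0 < a / area" "0 < b / area" "0 < c / area" using triangle_facts area_pos by simp_all
  show "pu ` rotated t = {- lu t..ru t}"
    unfolding rotated_def image_image coordinates_rotated supp_scaled_range[OF body0 pos(2)]
    using s_periodic[of t] by (simp add: lu_def ru_def s_eq add_ac)
  show "pv ` rotated t = {- lv t..rv t}"
    unfolding rotated_def image_image coordinates_rotated supp_scaled_range[OF body0 pos(3)]
    by (simp add: lv_def rv_def s_eq)
  show "pw ` rotated t = {- lw t..rw t}"
    unfolding rotated_def image_image coordinates_rotated supp_scaled_range[OF body0 pos(1)]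
    by (simp add: lw_def rw_def s_eq)
  have fit: "lu t + lv t + rw t \<le> 1" for t
  proof -
    have "c * (lu t + lv t + rw t) \<le> c * 1" using fits_all[of t] c_star_eq[of t] by simp
    then show ?thesis using triangle_facts(3) mult_le_cancel_left_pos by blast
  qed
  show "lu t + lv t + rw t \<le> 1" by (rule fit)
  show "ru t + rv t + lw t \<le> 1" unfolding shift_pi(1-3) by (rule fit)
qed

lemma measure_rotated: "measure lborel (rotated t) = measure lborel K"
proof -
  have K: "compact K" using body(1) by (auto simp: convex_body_def)
  obtain \<eta> where \<eta>: "sgn (e - r) = cis \<eta>"
    using norm_sgn_axis by (metis cis_Arg norm_zero sgn_sgn zero_neq_one)
  define \<mu> where "\<mu> = t + \<alpha> + pi / 2"
  let ?\<theta> = "\<eta> - \<mu>"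
  have rot: "rotated t = (\<lambda>q. cis \<mu> * q) ` body0" by (simp add: rotated_def \<mu>_def)
  have "z \<in> rotated t \<longleftrightarrow> r + cis ?\<theta> * z \<in> K" for z
  proof
    assume "z \<in> rotated t"
    then obtain p where p: "p \<in> K" "z = cis \<mu> * ((p - r) / sgn (e - r))"
      by (auto simp: rot body0_def)
    have "cis ?\<theta> * z = p - r" unfolding p(2) \<eta>
      by (simp add: cis_divide[symmetric] field_simps)
    then show "r + cis ?\<theta> * z \<in> K" using p by simp
  next
    assume "r + cis ?\<theta> * z \<in> K"
    moreover have "z = cis \<mu> * ((r + cis ?\<theta> * z - r) / sgn (e - r))"
      unfolding \<eta> by (simp add: cis_divide[symmetric] field_simps)
    ultimately show "z \<in> rotated t" unfolding rot body0_def by blast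
  qed
  then have ind: "indicator (rotated t) z = (indicator K (r + cis ?\<theta> * z) :: ennreal)" for z
    by (simp add: indicator_def)
  have Km[measurable]: "K \<in> sets borel" using K by (rule borel_compact)
  interpret placed_body a b c \<alpha> \<beta> \<gamma> "rotated t" "lu t" "ru t" "lv t" "rv t" "lw t" "rw t"
    by (rule placed_body_rotated)
  have "emeasure lborel (rotated t) = (\<integral>\<^sup>+z. indicator (rotated t) z \<partial>lborel)" by simp
  also have "\<dots> = (\<integral>\<^sup>+z. indicator K (r + cis ?\<theta> * z) \<partial>lborel)" unfolding ind ..
  also have "\<dots> = (\<integral>\<^sup>+z. indicator K (r + z) \<partial>lborel)"
    by (rule nn_integral_complex_rotation[of "\<lambda>z. indicator K (r + z)"]) simp
  also have "\<dots> = emeasure lborel K"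
    by (subst nn_integral_complex_translation) simp_all
  finally show ?thesis by (simp add: measure_def)
qed

end

context thrown_body begin

text \<open>The angle \<open>\<kappa>\<close> accounts for the choice of the fixed direction from which the angle of \<open>\<sigma>\<close> is measured.\<close>
definition posed :: "real \<Rightarrow> complex \<times> real \<Rightarrow> complex set" where
  "posed \<kappa> p = (\<lambda>x. fst p + x) ` rotated (snd p + \<kappa>)"

definition number_hit :: "real \<Rightarrow> complex \<times> real \<Rightarrow> nat" where
  "number_hit \<kappa> p = card (hit_index (posed \<kappa> p))"

definition event_u :: "real \<Rightarrow> (complex \<times> real) set" where
  "event_u \<kappa> = {p. pu (fst p) \<in> band (lu (snd p + \<kappa>)) (ru (snd p + \<kappa>))}"
definition event_v :: "real \<Rightarrow> (complex \<times> real) set" where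
  "event_v \<kappa> = {p. pv (fst p) \<in> band (lv (snd p + \<kappa>)) (rv (snd p + \<kappa>))}"
definition event_w :: "real \<Rightarrow> (complex \<times> real) set" where
  "event_w \<kappa> = {p. pw (fst p) \<in> band (lw (snd p + \<kappa>)) (rw (snd p + \<kappa>))}"
definition event_vertex :: "real \<Rightarrow> (complex \<times> real) set" where
  "event_vertex \<kappa> = {p. \<exists>(i :: int) (j :: int). point i j \<in> posed \<kappa> p}"

lemma measurable_s [measurable]: "s \<in> borel_measurable borel"
  by (rule borel_measurable_continuous_onI[OF s_continuous])

lemma measurable_extents [measurable]:
  "lu \<in> borel_measurable borel" "ru \<in> borel_measurable borel" "lv \<in> borel_measurable borel"
  "rv \<in> borel_measurable borel" "lw \<in> borel_measurable borel" "rw \<in> borel_measurable borel"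
  unfolding lu_def[abs_def] ru_def[abs_def] lv_def[abs_def] rv_def[abs_def] lw_def[abs_def] rw_def[abs_def]
  by measurable

lemma measurable_in_band:
  assumes [measurable]: "f \<in> borel_measurable M" "l \<in> borel_measurable M" "h \<in> borel_measurable M"
  shows "{p \<in> space M. f p \<in> band (l p) (h p)} \<in> sets M"
  unfolding band_def mem_Collect_eq by measurable

lemma sets_lines [measurable]:
  "event_u \<kappa> \<in> sets (borel \<Otimes>\<^sub>M borel)" "event_v \<kappa> \<in> sets (borel \<Otimes>\<^sub>M borel)" "event_w \<kappa> \<in> sets (borel \<Otimes>\<^sub>M borel)"
proof -
  have "{p \<in> space (borel \<Otimes>\<^sub>M borel). pu (fst p) \<in> band (lu (snd p + \<kappa>)) (ru (snd p + \<kappa>))} \<in> sets (borel \<Otimes>\<^sub>M borel)"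
    by (rule measurable_in_band) measurable
  then show "event_u \<kappa> \<in> sets (borel \<Otimes>\<^sub>M borel)" by (simp add: event_u_def space_pair_measure)
  have "{p \<in> space (borel \<Otimes>\<^sub>M borel). pv (fst p) \<in> band (lv (snd p + \<kappa>)) (rv (snd p + \<kappa>))} \<in> sets (borel \<Otimes>\<^sub>M borel)"
    by (rule measurable_in_band) measurable
  then show "event_v \<kappa> \<in> sets (borel \<Otimes>\<^sub>M borel)" by (simp add: event_v_def space_pair_measure)
  have "{p \<in> space (borel \<Otimes>\<^sub>M borel). pw (fst p) \<in> band (lw (snd p + \<kappa>)) (rw (snd p + \<kappa>))} \<in> sets (borel \<Otimes>\<^sub>M borel)"
    by (rule measurable_in_band) measurable
  then show "event_w \<kappa> \<in> sets (borel \<Otimes>\<^sub>M borel)" by (simp add: event_w_def space_pair_measure)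
qed

text \<open>The positions that meet a closed set form the projection of a closed set along the compact body.\<close>
lemma closed_meets:
  assumes T: "closed T"
  shows "closed {p. posed \<kappa> p \<inter> T \<noteq> {}}"
proof -
  let ?C = "{x :: complex \<times> complex \<times> real. fst (snd x) + cis (snd (snd x) + \<kappa> + \<alpha> + pi / 2) * fst x \<in> T}"
  have "closed ?C"
  proof -
    have "closed ((\<lambda>x :: complex \<times> complex \<times> real. fst (snd x) + cis (snd (snd x) + \<kappa> + \<alpha> + pi / 2) * fst x) -` T)"
      by (intro closed_vimage T continuous_intros)
    then show ?thesis by (simp add: vimage_def)
  qed
  then have "closed {p. \<exists>q. q \<in> body0 \<and> (q, p) \<in> ?C}"
    by (rule closed_compact_projection[OF body0(2)])
  also have "{p. \<exists>q. q \<in> body0 \<and> (q, p) \<in> ?C} = {p. posed \<kappa> p \<inter> T \<noteq> {}}"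
    by (force simp: posed_def rotated_def)
  finally show ?thesis .
qed

lemma sets_meets: "closed T \<Longrightarrow> {p. posed \<kappa> p \<inter> T \<noteq> {}} \<in> sets (borel \<Otimes>\<^sub>M borel)"
  using borel_closed[OF closed_meets] unfolding borel_prod .

lemma sets_vertex [measurable]: "event_vertex \<kappa> \<in> sets (borel \<Otimes>\<^sub>M borel)"
proof -
  have "event_vertex \<kappa> = (\<Union>i :: int. \<Union>j :: int. {p. posed \<kappa> p \<inter> {point i j} \<noteq> {}})"
    by (auto simp: event_vertex_def)
  also have "\<dots> \<in> sets (borel \<Otimes>\<^sub>M borel)"
  proof (intro sets.countable_UN image_subsetI)
    show "{p. posed \<kappa> p \<inter> {point i j} \<noteq> {}} \<in> sets (borel \<Otimes>\<^sub>M borel)" for i j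
      by (rule sets_meets) simp
  qed
  finally show ?thesis .
qed

lemma measurable_number_hit [measurable]: "number_hit \<kappa> \<in> measurable (borel \<Otimes>\<^sub>M borel) (count_space UNIV)"
proof -
  have "(\<lambda>p. card (to_nat ` hit_index (posed \<kappa> p))) \<in> measurable (borel \<Otimes>\<^sub>M borel) (count_space UNIV)"
  proof (rule measurable_card)
    fix n :: nat
    \<comment> \<open>The indices are encoded as natural numbers, where the cardinality of a random set is measurable.\<close>
    let ?x = "from_nat n :: int \<times> int \<times> int"
    have "{p \<in> space (borel \<Otimes>\<^sub>M borel). n \<in> to_nat ` hit_index (posed \<kappa> p)}
       = (if to_nat ?x = n \<and> ?x \<in> tri_index then {p. posed \<kappa> p \<inter> tri ?x \<noteq> {}} else {})"
    proof -
      have "n \<in> to_nat ` H \<longleftrightarrow> to_nat ?x = n \<and> ?x \<in> H" for H :: "(int \<times> int \<times> int) set"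
      proof
        assume "n \<in> to_nat ` H"
        then obtain x where "x \<in> H" "n = to_nat x" by blast
        then show "to_nat ?x = n \<and> ?x \<in> H" by simp
      next
        assume "to_nat ?x = n \<and> ?x \<in> H"
        then show "n \<in> to_nat ` H" by (intro image_eqI[of _ _ ?x]) simp_all
      qed
      then show ?thesis by (auto simp: hit_index_def space_pair_measure)
    qed
    then show "{p \<in> space (borel \<Otimes>\<^sub>M borel). n \<in> to_nat ` hit_index (posed \<kappa> p)} \<in> sets (borel \<Otimes>\<^sub>M borel)"
      using sets_meets[OF closed_tri] by auto
  qed
  moreover have "card (to_nat ` hit_index S) = card (hit_index S)" for S
    by (rule card_image) (rule inj_on_subset[OF inj_to_nat], simp)
  ultimately show ?thesis unfolding number_hit_def[abs_def] by simp
qed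

text \<open>In every direction the exceptional positions are not generic, so they form a null set, and Fubini applies.\<close>
lemma number_hit_AE:
  "AE p in throw. number_hit \<kappa> p = 1 + of_bool (p \<in> event_u \<kappa>) + of_bool (p \<in> event_v \<kappa>)
     + of_bool (p \<in> event_w \<kappa>) + 2 * of_bool (p \<in> event_vertex \<kappa>)"
proof -
  interpret T: prob_space "throw" by (rule prob_space_throw_law)
  let ?f = "\<lambda>p. 1 + of_bool (p \<in> event_u \<kappa>) + of_bool (p \<in> event_v \<kappa>) + of_bool (p \<in> event_w \<kappa>) + 2 * of_bool (p \<in> event_vertex \<kappa>) :: nat"
  let ?N = "{p. number_hit \<kappa> p \<noteq> ?f p}"
  have real_f: "real (?f p) = 1 + indicator (event_u \<kappa>) p + indicator (event_v \<kappa>) p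
      + indicator (event_w \<kappa>) p + 2 * indicator (event_vertex \<kappa>) p" for p
    by (simp add: indicator_def)
  have [measurable]: "(\<lambda>p. real (number_hit \<kappa> p)) \<in> borel_measurable (borel \<Otimes>\<^sub>M borel)"
    by (rule measurable_compose[OF measurable_number_hit]) simp
  have "{p \<in> space (borel \<Otimes>\<^sub>M borel). real (number_hit \<kappa> p) \<noteq> 1 + indicator (event_u \<kappa>) p + indicator (event_v \<kappa>) p
      + indicator (event_w \<kappa>) p + 2 * indicator (event_vertex \<kappa>) p} \<in> sets (borel \<Otimes>\<^sub>M borel)"
    by measurable
  also have "{p \<in> space (borel \<Otimes>\<^sub>M borel). real (number_hit \<kappa> p) \<noteq> 1 + indicator (event_u \<kappa>) p + indicator (event_v \<kappa>) p
      + indicator (event_w \<kappa>) p + 2 * indicator (event_vertex \<kappa>) p} = ?N"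
    unfolding real_f[symmetric] of_nat_eq_iff by (simp add: space_pair_measure)
  finally have N: "?N \<in> sets (borel \<Otimes>\<^sub>M borel)" .
  have "measure throw ?N = integral {0..2 * pi} (\<lambda>_. 0) / (2 * pi)"
  proof (rule measure_throw_law[OF N])
    fix \<phi> :: real
    interpret B: placed_body a b c \<alpha> \<beta> \<gamma> "rotated (\<phi> + \<kappa>)" "lu (\<phi> + \<kappa>)" "ru (\<phi> + \<kappa>)" "lv (\<phi> + \<kappa>)" "rv (\<phi> + \<kappa>)" "lw (\<phi> + \<kappa>)" "rw (\<phi> + \<kappa>)"
      by (rule placed_body_rotated)
    have "emeasure position_measure {z. (z, \<phi>) \<in> ?N} = 0"
    proof (rule B.emeasure_nongeneric)
      have "(\<lambda>z. (z, \<phi>)) -` ?N \<inter> space borel \<in> sets borel"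
        by (rule measurable_sets[OF _ N]) measurable
      then show "{z. (z, \<phi>) \<in> ?N} \<in> sets borel" by (simp add: vimage_def)
      fix u v assume "B.generic u v"
      from B.card_hit_index_generic[OF this] show "point u v \<notin> {z. (z, \<phi>) \<in> ?N}"
        by (simp add: number_hit_def posed_def event_u_def event_v_def event_w_def event_vertex_def)
    qed
    then show "0 \<le> (0 :: real) \<and> emeasure position_measure {z. (z, \<phi>) \<in> ?N} = ennreal 0"
      by simp
  qed simp
  then have "?N \<in> null_sets throw"
    using N by (simp add: null_sets_def T.emeasure_eq_measure sets_throw_law)
  then show ?thesis by (rule AE_I') (rule Collect_mono, rule impI, erule conjunct2)
qed

lemma vertex_subset: "event_vertex \<kappa> \<subseteq> event_u \<kappa> \<inter> event_v \<kappa> \<inter> event_w \<kappa>"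
proof
  fix p assume p: "p \<in> event_vertex \<kappa>"
  interpret B: placed_body a b c \<alpha> \<beta> \<gamma> "rotated (snd p + \<kappa>)" "lu (snd p + \<kappa>)" "ru (snd p + \<kappa>)" "lv (snd p + \<kappa>)" "rv (snd p + \<kappa>)" "lw (snd p + \<kappa>)" "rw (snd p + \<kappa>)"
    by (rule placed_body_rotated)
  have "B.vertex_inside (pu (fst p)) (pv (fst p))"
    using p by (simp add: event_vertex_def posed_def)
  from B.vertex_inside_in_bands[OF this] show "p \<in> event_u \<kappa> \<inter> event_v \<kappa> \<inter> event_w \<kappa>"
    by (simp add: event_u_def event_v_def event_w_def pw_eq)
qed

lemma widths_eq: "lu t + ru t = b / area * width s t" "lv t + rv t = c / area * width s (t + \<alpha>)"
  "lw t + rw t = a / area * width s (t + \<alpha> + \<beta>)"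
  by (simp_all add: lu_def ru_def lv_def rv_def lw_def rw_def width_def algebra_simps)

lemma continuous_extents:
  "continuous_on X (\<lambda>\<phi>. lu (\<phi> + \<kappa>))" "continuous_on X (\<lambda>\<phi>. ru (\<phi> + \<kappa>))" "continuous_on X (\<lambda>\<phi>. lv (\<phi> + \<kappa>))"
  "continuous_on X (\<lambda>\<phi>. rv (\<phi> + \<kappa>))" "continuous_on X (\<lambda>\<phi>. lw (\<phi> + \<kappa>))" "continuous_on X (\<lambda>\<phi>. rw (\<phi> + \<kappa>))"
  unfolding lu_def ru_def lv_def rv_def lw_def rw_def add.assoc
  by (intro continuous_intros continuous_shift[OF s_continuous])+

abbreviation "U \<equiv> integral {0..2 * pi} s"

lemma has_integral_width: "((\<lambda>\<phi>. width s (\<phi> + x)) has_integral 2 * U) {0..2 * pi}"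
proof -
  have "((\<lambda>\<phi>. s (\<phi> + x) + s (\<phi> + (x + pi))) has_integral U + U) {0..2 * pi}"
    by (intro has_integral_add has_integral_shift_periodic s_continuous s_periodic)
  then show ?thesis by (simp add: width_def add.assoc)
qed

lemma width_nonneg: "0 \<le> lu t + ru t" "0 \<le> lv t + rv t" "0 \<le> lw t + rw t"
proof -
  interpret B: placed_body a b c \<alpha> \<beta> \<gamma> "rotated t" "lu t" "ru t" "lv t" "rv t" "lw t" "rw t"
    by (rule placed_body_rotated)
  show "0 \<le> lu t + ru t" "0 \<le> lv t + rv t" "0 \<le> lw t + rw t" by (rule B.widths)+
qed

lemma has_integral_width_product:
  "((\<lambda>\<phi>. width s (\<phi> + x) * width s (\<phi> + y)) has_integral 2 * I_fun s (y - x)) {0..2 * pi}"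
proof -
  have "width s (x + 2 * pi) = width s x" for x
    using width_periodic[of s, OF s_periodic, of x] width_periodic[of s, OF s_periodic, of "x + pi"] by (simp add: add.assoc)
  from has_integral_correlation[OF continuous_width[OF s_continuous] this] show ?thesis
    by (simp add: I_fun_eq[OF s_continuous s_periodic])
qed

lemma I_even: "I_fun s (- x) = I_fun s x"
proof -
  have "width s (x + 2 * pi) = width s x" for x
    using width_periodic[of s, OF s_periodic, of x] width_periodic[of s, OF s_periodic, of "x + pi"] by (simp add: add.assoc)
  from correlation_even[OF continuous_width[OF s_continuous] this, of x] show ?thesis
    by (simp add: I_fun_eq[OF s_continuous s_periodic])
qed

text \<open>The angles \<open>\<alpha> + \<beta>\<close> and \<open>\<gamma>\<close> are supplementary, and the correlation of the width is even and has period \<open>pi\<close>.\<close>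
lemma I_supplement: "I_fun s (\<alpha> + \<beta>) = I_fun s \<gamma>"
proof -
  have "\<alpha> + \<beta> = - \<gamma> + pi" using triangle_facts by simp
  moreover have "I_fun s (- \<gamma> + pi) = I_fun s (- \<gamma>)"
    using correlation_periodic[of "width s" pi "- \<gamma>", OF width_periodic[of s, OF s_periodic]]
    by (simp add: I_fun_eq[OF s_continuous s_periodic])
  ultimately show ?thesis by (simp add: I_even)
qed

lemma J_even: "J_fun s (- x) = J_fun s x" and J_period: "J_fun s (x + 2 * pi) = J_fun s x"
  using correlation_even[OF s_continuous s_periodic] correlation_periodic[of s "2 * pi", OF s_periodic]
  by (simp_all add: J_fun_eq)

lemma has_integral_product:
  "((\<lambda>\<phi>. s (\<phi> + x) * s (\<phi> + y)) has_integral J_fun s (y - x)) {0..2 * pi}"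
  using has_integral_correlation[OF s_continuous s_periodic] by (simp add: J_fun_eq)

lemma slice_measures:
  fixes \<phi> \<kappa> :: real
  defines "t \<equiv> \<phi> + \<kappa>" and "P \<equiv> position_measure"
  shows "emeasure P {z. (z, \<phi>) \<in> event_u \<kappa>} = ennreal (lu t + ru t)"
    and "emeasure P {z. (z, \<phi>) \<in> event_v \<kappa>} = ennreal (lv t + rv t)"
    and "emeasure P {z. (z, \<phi>) \<in> event_w \<kappa>} = ennreal (lw t + rw t)"
    and "emeasure P {z. (z, \<phi>) \<in> event_u \<kappa> \<inter> event_v \<kappa>} = ennreal ((lu t + ru t) * (lv t + rv t))"
    and "emeasure P {z. (z, \<phi>) \<in> event_u \<kappa> \<inter> event_w \<kappa>} = ennreal ((lu t + ru t) * (lw t + rw t))"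
    and "emeasure P {z. (z, \<phi>) \<in> event_v \<kappa> \<inter> event_w \<kappa>} = ennreal ((lv t + rv t) * (lw t + rw t))"
    and "emeasure P {z. (z, \<phi>) \<in> event_u \<kappa> \<inter> event_v \<kappa> \<inter> event_w \<kappa>}
      = ennreal ((lu t + ru t) * (lv t + rv t) - (lu t + lv t - lw t)\<^sup>2 / 2 - (ru t + rv t - rw t)\<^sup>2 / 2)"
    and "emeasure P {z. (z, \<phi>) \<in> event_vertex \<kappa>} = ennreal (measure lborel K / area)"
    and "(lu t + lv t - lw t)\<^sup>2 / 2 + (ru t + rv t - rw t)\<^sup>2 / 2 \<le> (lu t + ru t) * (lv t + rv t)"
proof -
  interpret B: placed_body a b c \<alpha> \<beta> \<gamma> "rotated t" "lu t" "ru t" "lv t" "rv t" "lw t" "rw t"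
    by (rule placed_body_rotated)
  show "emeasure P {z. (z, \<phi>) \<in> event_u \<kappa>} = ennreal (lu t + ru t)"
    using B.emeasure_hit_one(1) by (simp add: event_u_def t_def P_def)
  show "emeasure P {z. (z, \<phi>) \<in> event_v \<kappa>} = ennreal (lv t + rv t)"
    using B.emeasure_hit_one(2) by (simp add: event_v_def t_def P_def)
  show "emeasure P {z. (z, \<phi>) \<in> event_w \<kappa>} = ennreal (lw t + rw t)"
    using B.emeasure_hit_one(3) by (simp add: event_w_def t_def P_def)
  show "emeasure P {z. (z, \<phi>) \<in> event_u \<kappa> \<inter> event_v \<kappa>} = ennreal ((lu t + ru t) * (lv t + rv t))"
    using B.emeasure_hit_two(1) by (simp add: event_u_def event_v_def t_def P_def)
  show "emeasure P {z. (z, \<phi>) \<in> event_u \<kappa> \<inter> event_w \<kappa>} = ennreal ((lu t + ru t) * (lw t + rw t))"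
    using B.emeasure_hit_two(2) by (simp add: event_u_def event_w_def t_def P_def)
  show "emeasure P {z. (z, \<phi>) \<in> event_v \<kappa> \<inter> event_w \<kappa>} = ennreal ((lv t + rv t) * (lw t + rw t))"
    using B.emeasure_hit_two(3) by (simp add: event_v_def event_w_def t_def P_def)
  show "emeasure P {z. (z, \<phi>) \<in> event_u \<kappa> \<inter> event_v \<kappa> \<inter> event_w \<kappa>}
      = ennreal ((lu t + ru t) * (lv t + rv t) - (lu t + lv t - lw t)\<^sup>2 / 2 - (ru t + rv t - rw t)\<^sup>2 / 2)"
    using B.emeasure_hit_uvw by (simp add: event_u_def event_v_def event_w_def t_def P_def conj_assoc)
  show "emeasure P {z. (z, \<phi>) \<in> event_vertex \<kappa>} = ennreal (measure lborel K / area)"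
    using B.emeasure_vertex measure_rotated[of t] by (simp add: event_vertex_def posed_def t_def P_def)
  show "(lu t + lv t - lw t)\<^sup>2 / 2 + (ru t + rv t - rw t)\<^sup>2 / 2 \<le> (lu t + ru t) * (lv t + rv t)"
    by (rule B.hit_uvw_nonneg)
qed

lemma throw_prob:
  assumes "E \<in> sets (borel \<Otimes>\<^sub>M borel)"
    and "\<And>\<phi>. emeasure position_measure {z. (z, \<phi>) \<in> E} = ennreal (m \<phi>)"
    and "\<And>\<phi>. 0 \<le> m \<phi>"
    and "continuous_on {0..2 * pi} m"
    and "(m has_integral y) {0..2 * pi}"
  shows "measure throw E = y / (2 * pi)"
  using measure_throw_law[OF assms(1,4)] assms(2,3,5) by (simp add: integral_unique)

lemma prob_one_line:
  "measure throw (event_u \<kappa>) = b * U / (pi * area)"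
  "measure throw (event_v \<kappa>) = c * U / (pi * area)"
  "measure throw (event_w \<kappa>) = a * U / (pi * area)"
proof -
  have "measure throw (event_u \<kappa>) = (b / area * (2 * U)) / (2 * pi)"
  proof (rule throw_prob[OF sets_lines(1) slice_measures(1) width_nonneg(1)])
    show "((\<lambda>\<phi>. lu (\<phi> + \<kappa>) + ru (\<phi> + \<kappa>)) has_integral b / area * (2 * U)) {0..2 * pi}"
      unfolding widths_eq by (intro has_integral_mult_right has_integral_width)
  qed (intro continuous_intros continuous_extents)
  then show "measure throw (event_u \<kappa>) = b * U / (pi * area)" by simp
  have "measure throw (event_v \<kappa>) = (c / area * (2 * U)) / (2 * pi)"
  proof (rule throw_prob[OF sets_lines(2) slice_measures(2) width_nonneg(2)])
    show "((\<lambda>\<phi>. lv (\<phi> + \<kappa>) + rv (\<phi> + \<kappa>)) has_integral c / area * (2 * U)) {0..2 * pi}"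
      unfolding widths_eq add.assoc by (intro has_integral_mult_right has_integral_width)
  qed (intro continuous_intros continuous_extents)
  then show "measure throw (event_v \<kappa>) = c * U / (pi * area)" by simp
  have "measure throw (event_w \<kappa>) = (a / area * (2 * U)) / (2 * pi)"
  proof (rule throw_prob[OF sets_lines(3) slice_measures(3) width_nonneg(3)])
    show "((\<lambda>\<phi>. lw (\<phi> + \<kappa>) + rw (\<phi> + \<kappa>)) has_integral a / area * (2 * U)) {0..2 * pi}"
      unfolding widths_eq add.assoc by (intro has_integral_mult_right has_integral_width)
  qed (intro continuous_intros continuous_extents)
  then show "measure throw (event_w \<kappa>) = a * U / (pi * area)" by simp
qed

lemma prob_two_lines:
  "measure throw (event_u \<kappa> \<inter> event_v \<kappa>) = b * c * I_fun s \<alpha> / (pi * area\<^sup>2)"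
  "measure throw (event_u \<kappa> \<inter> event_w \<kappa>) = a * b * I_fun s \<gamma> / (pi * area\<^sup>2)"
  "measure throw (event_v \<kappa> \<inter> event_w \<kappa>) = c * a * I_fun s \<beta> / (pi * area\<^sup>2)"
proof -
  have prod: "((\<lambda>\<phi>. p * width s (\<phi> + x) * (q * width s (\<phi> + y))) has_integral p * q * (2 * I_fun s (y - x))) {0..2 * pi}" for p q x y
  proof -
    have "((\<lambda>\<phi>. p * q * (width s (\<phi> + x) * width s (\<phi> + y))) has_integral p * q * (2 * I_fun s (y - x))) {0..2 * pi}"
      by (intro has_integral_mult_right has_integral_width_product)
    then show ?thesis by (simp only: mult_ac)
  qed
  have m: "measure throw (event_u \<kappa> \<inter> event_v \<kappa>) = (b / area * (c / area) * (2 * I_fun s \<alpha>)) / (2 * pi)"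
  proof (rule throw_prob[OF _ slice_measures(4)])
    show "((\<lambda>\<phi>. (lu (\<phi> + \<kappa>) + ru (\<phi> + \<kappa>)) * (lv (\<phi> + \<kappa>) + rv (\<phi> + \<kappa>))) has_integral b / area * (c / area) * (2 * I_fun s \<alpha>)) {0..2 * pi}"
      unfolding widths_eq add.assoc using prod[of "b / area" \<kappa> "c / area" "\<kappa> + \<alpha>"] by simp
  qed (use width_nonneg sets_lines in \<open>auto intro!: continuous_intros continuous_extents\<close>)
  show "measure throw (event_u \<kappa> \<inter> event_v \<kappa>) = b * c * I_fun s \<alpha> / (pi * area\<^sup>2)"
    unfolding m by (simp add: power2_eq_square mult_ac)
  have m: "measure throw (event_u \<kappa> \<inter> event_w \<kappa>) = (b / area * (a / area) * (2 * I_fun s \<gamma>)) / (2 * pi)"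
  proof (rule throw_prob[OF _ slice_measures(5)])
    show "((\<lambda>\<phi>. (lu (\<phi> + \<kappa>) + ru (\<phi> + \<kappa>)) * (lw (\<phi> + \<kappa>) + rw (\<phi> + \<kappa>))) has_integral b / area * (a / area) * (2 * I_fun s \<gamma>)) {0..2 * pi}"
      unfolding widths_eq add.assoc using prod[of "b / area" \<kappa> "a / area" "\<kappa> + (\<alpha> + \<beta>)"] by (simp add: I_supplement)
  qed (use width_nonneg sets_lines in \<open>auto intro!: continuous_intros continuous_extents\<close>)
  show "measure throw (event_u \<kappa> \<inter> event_w \<kappa>) = a * b * I_fun s \<gamma> / (pi * area\<^sup>2)"
    unfolding m by (simp add: power2_eq_square mult_ac)
  have m: "measure throw (event_v \<kappa> \<inter> event_w \<kappa>) = (c / area * (a / area) * (2 * I_fun s \<beta>)) / (2 * pi)"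
  proof (rule throw_prob[OF _ slice_measures(6)])
    show "((\<lambda>\<phi>. (lv (\<phi> + \<kappa>) + rv (\<phi> + \<kappa>)) * (lw (\<phi> + \<kappa>) + rw (\<phi> + \<kappa>))) has_integral c / area * (a / area) * (2 * I_fun s \<beta>)) {0..2 * pi}"
      unfolding widths_eq add.assoc using prod[of "c / area" "\<kappa> + \<alpha>" "a / area" "\<kappa> + (\<alpha> + \<beta>)"] by simp
  qed (use width_nonneg sets_lines in \<open>auto intro!: continuous_intros continuous_extents\<close>)
  show "measure throw (event_v \<kappa> \<inter> event_w \<kappa>) = c * a * I_fun s \<beta> / (pi * area\<^sup>2)"
    unfolding m by (simp add: power2_eq_square mult_ac)
qed

lemma prob_vertex: "measure throw (event_vertex \<kappa>) = measure lborel K / area"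
proof -
  have "measure throw (event_vertex \<kappa>) = (measure lborel K / area * (2 * pi)) / (2 * pi)"
  proof (rule throw_prob[OF sets_vertex slice_measures(8)])
    show "((\<lambda>\<phi>. measure lborel K / area) has_integral measure lborel K / area * (2 * pi)) {0..2 * pi}"
      using has_integral_const_real[of "measure lborel K / area" 0 "2 * pi"] by (simp add: mult.commute)
  qed (use area_pos in auto)
  then show ?thesis by simp
qed

text \<open>In the polynomial of \<open>emeasure_hit_uvw\<close> the products of extents on equal sides of the first two coordinates
  cancel. The remaining products pair outward normals of two sides of the triangle, one of them reversed; the angle between
  these is the angle of the triangle enclosed by the two sides.\<close>
lemma prob_three_lines:
  "measure throw (event_u \<kappa> \<inter> event_v \<kappa> \<inter> event_w \<kappa>)
    = (b * c * J_fun s \<alpha> + c * a * J_fun s \<beta> + a * b * J_fun s \<gamma>) / (pi * area\<^sup>2)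
      - (a\<^sup>2 + b\<^sup>2 + c\<^sup>2) * J_fun s 0 / (2 * pi * area\<^sup>2)"
proof -
  define m where "m t = (lu t + ru t) * (lv t + rv t) - (lu t + lv t - lw t)\<^sup>2 / 2 - (ru t + rv t - rw t)\<^sup>2 / 2" for t
  define A B C where "A = a / area" and "B = b / area" and "C = c / area"
  \<comment> \<open>The squares expand to the products of two values of the support function.\<close>
  have m_eq: "m t = B * C * (s t * s (t + \<alpha>)) + B * C * (s (t + pi) * s (t + (\<alpha> + pi)))
      + A * B * (s t * s (t + (\<alpha> + \<beta> + pi))) + C * A * (s (t + (\<alpha> + pi)) * s (t + (\<alpha> + \<beta> + pi)))
      + A * B * (s (t + pi) * s (t + (\<alpha> + \<beta>))) + C * A * (s (t + \<alpha>) * s (t + (\<alpha> + \<beta>)))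
      - B\<^sup>2 / 2 * (s t * s t) - B\<^sup>2 / 2 * (s (t + pi) * s (t + pi))
      - C\<^sup>2 / 2 * (s (t + (\<alpha> + pi)) * s (t + (\<alpha> + pi))) - C\<^sup>2 / 2 * (s (t + \<alpha>) * s (t + \<alpha>))
      - A\<^sup>2 / 2 * (s (t + (\<alpha> + \<beta> + pi)) * s (t + (\<alpha> + \<beta> + pi))) - A\<^sup>2 / 2 * (s (t + (\<alpha> + \<beta>)) * s (t + (\<alpha> + \<beta>)))" for t
    unfolding m_def lu_def ru_def lv_def rv_def lw_def rw_def A_def[symmetric] B_def[symmetric] C_def[symmetric] add.assoc
    by (simp add: power2_eq_square field_simps)
  have P: "((\<lambda>\<phi>. k * (s (\<phi> + \<kappa> + x) * s (\<phi> + \<kappa> + y))) has_integral k * J_fun s (y - x)) {0..2 * pi}" for k x y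
    using has_integral_mult_right[OF has_integral_product[of "\<kappa> + x" "\<kappa> + y"], of k] by (simp add: add.assoc)
  have J\<gamma>1: "J_fun s (\<alpha> + \<beta> + pi) = J_fun s \<gamma>"
  proof -
    have "\<alpha> + \<beta> + pi = - \<gamma> + 2 * pi" using triangle_facts by simp
    then show ?thesis by (simp only: J_period J_even)
  qed
  have J\<gamma>2: "J_fun s (\<alpha> + \<beta> - pi) = J_fun s \<gamma>"
  proof -
    have "\<alpha> + \<beta> - pi = - \<gamma>" using triangle_facts by simp
    then show ?thesis by (simp only: J_even)
  qed
  have "((\<lambda>\<phi>. m (\<phi> + \<kappa>)) has_integral
     B * C * J_fun s \<alpha> + B * C * J_fun s \<alpha> + A * B * J_fun s \<gamma> + C * A * J_fun s \<beta> + A * B * J_fun s \<gamma> + C * A * J_fun s \<beta>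
     - B\<^sup>2 / 2 * J_fun s 0 - B\<^sup>2 / 2 * J_fun s 0 - C\<^sup>2 / 2 * J_fun s 0 - C\<^sup>2 / 2 * J_fun s 0
     - A\<^sup>2 / 2 * J_fun s 0 - A\<^sup>2 / 2 * J_fun s 0) {0..2 * pi}"
    unfolding m_eq
    using P[of "B * C" 0 \<alpha>] P[of "B * C" pi "\<alpha> + pi"] P[of "A * B" 0 "\<alpha> + \<beta> + pi"] P[of "C * A" "\<alpha> + pi" "\<alpha> + \<beta> + pi"]
      P[of "A * B" pi "\<alpha> + \<beta>"] P[of "C * A" \<alpha> "\<alpha> + \<beta>"] P[of "B\<^sup>2 / 2" 0 0] P[of "B\<^sup>2 / 2" pi pi]
      P[of "C\<^sup>2 / 2" "\<alpha> + pi" "\<alpha> + pi"] P[of "C\<^sup>2 / 2" \<alpha> \<alpha>] P[of "A\<^sup>2 / 2" "\<alpha> + \<beta> + pi" "\<alpha> + \<beta> + pi"] P[of "A\<^sup>2 / 2" "\<alpha> + \<beta>" "\<alpha> + \<beta>"]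
    by (intro has_integral_add has_integral_diff) (simp_all only: add_0_right diff_zero diff_self J\<gamma>1 J\<gamma>2 add_diff_cancel_right add_diff_cancel_left' add_diff_cancel_right')
  then have "((\<lambda>\<phi>. m (\<phi> + \<kappa>)) has_integral
      2 * (B * C * J_fun s \<alpha> + C * A * J_fun s \<beta> + A * B * J_fun s \<gamma>) - (A\<^sup>2 + B\<^sup>2 + C\<^sup>2) * J_fun s 0) {0..2 * pi}"
    by (simp add: algebra_simps)
  then have "measure throw (event_u \<kappa> \<inter> event_v \<kappa> \<inter> event_w \<kappa>)
    = (2 * (B * C * J_fun s \<alpha> + C * A * J_fun s \<beta> + A * B * J_fun s \<gamma>) - (A\<^sup>2 + B\<^sup>2 + C\<^sup>2) * J_fun s 0) / (2 * pi)"
  proof (rule throw_prob[rotated -1])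
    show "emeasure position_measure {z. (z, \<phi>) \<in> event_u \<kappa> \<inter> event_v \<kappa> \<inter> event_w \<kappa>} = ennreal (m (\<phi> + \<kappa>))" for \<phi>
      unfolding m_def by (rule slice_measures(7))
    show "0 \<le> m (\<phi> + \<kappa>)" for \<phi>
      using slice_measures(9)[of \<phi> \<kappa>] unfolding m_def by linarith
    show "continuous_on {0..2 * pi} (\<lambda>\<phi>. m (\<phi> + \<kappa>))"
      unfolding m_def by (intro continuous_intros continuous_extents) simp_all
  qed (intro sets.Int sets_lines)
  moreover have "B * C * J_fun s \<alpha> + C * A * J_fun s \<beta> + A * B * J_fun s \<gamma>
      = (b * c * J_fun s \<alpha> + c * a * J_fun s \<beta> + a * b * J_fun s \<gamma>) / area\<^sup>2"
    by (simp add: A_def B_def C_def power2_eq_square add_divide_distrib)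
  moreover have "(A\<^sup>2 + B\<^sup>2 + C\<^sup>2) * J_fun s 0 = (a\<^sup>2 + b\<^sup>2 + c\<^sup>2) * J_fun s 0 / area\<^sup>2"
    by (simp add: A_def B_def C_def power_divide add_divide_distrib[symmetric])
  moreover have "(2 * (x / q) - y / q) / (2 * pi) = x / (pi * q) - y / (2 * pi * q)" for x y q :: real
    by (simp add: diff_divide_distrib mult.commute)
  ultimately show ?thesis by (simp only:)
qed

end

section \<open>The distribution of the number of triangles\<close>

lemma unit_complex_eq_cis:
  assumes "norm \<nu> = 1"
  shows "\<exists>\<kappa>. \<nu> = cis (\<theta> + \<kappa>)"
proof -
  have "\<nu> \<noteq> 0" using assms by auto
  then have "\<nu> = cis (\<theta> + (Arg \<nu> - \<theta>))" using assms by (simp add: cis_Arg sgn_eq)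
  then show ?thesis by blast
qed

context thrown_body begin

lemma placed_eq_posed:
  assumes "\<nu> = cis (\<alpha> + pi / 2 + \<kappa>)"
  shows "placed K r e z (\<nu> * cis \<phi>) = posed \<kappa> (z, \<phi>)"
proof -
  have "\<nu> * cis \<phi> = cis (\<phi> + \<kappa> + \<alpha> + pi / 2)"
    unfolding assms cis_mult by (simp add: add_ac)
  then show ?thesis
    by (simp add: placed_def posed_def rotated_def body0_def image_image)
qed

end


theorem theorem1:
  fixes a b c \<alpha> \<beta> \<gamma> Q u F :: real
    and K :: "complex set" and r e \<nu> :: complex
    and s I J f\<^sub>1 f\<^sub>2 f\<^sub>3 :: "real \<Rightarrow> real"
    and M :: "'m measure" and X :: "'m \<Rightarrow> complex" and \<Phi> :: "'m \<Rightarrow> real"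
    and Z :: "'m \<Rightarrow> nat" and p :: "nat \<Rightarrow> real"
  assumes triangle: "triangle_data a b c \<alpha> \<beta> \<gamma>"
    and Q: "Q = a * b * sin \<gamma>"
    and body: "convex_body K" "r \<in> K" "e \<noteq> r"
    and u: "u = perimeter K"
    and F: "F = measure lborel K"
    and s: "s = support_function K r e"
    and fits: "\<forall>\<phi>. 0 \<le> \<phi> \<and> \<phi> < 2 * pi \<longrightarrow> c_star s \<alpha> \<beta> \<phi> \<le> c"
    and I: "I = I_fun s"
    and J: "J = J_fun s"
    and f1: "\<And>x. f\<^sub>1 x = I x - J x"
    and f2: "\<And>x. f\<^sub>2 x = 2 * I x - 3 * J x"
    and f3: "\<And>x. f\<^sub>3 x = I x - 3 * J x"
    and \<nu>_perp_b: "norm \<nu> = 1" "\<nu> \<bullet> cis \<alpha> = 0"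
    and prob: "prob_space M"
    and rv: "X \<in> borel_measurable M" "\<Phi> \<in> borel_measurable M"
    and law: "distr M (borel \<Otimes>\<^sub>M borel) (\<lambda>\<omega>. (X \<omega>, \<Phi> \<omega>)) = throw_law a c \<alpha> \<beta>"
    and Z: "\<And>\<omega>. Z \<omega> = triangles_hit (lattice_triangles a b c \<alpha> \<beta> \<gamma>)
                              (placed K r e (X \<omega>) (\<nu> * cis (\<Phi> \<omega>)))"
    and p: "\<And>i. p i = \<P>(\<omega> in M. Z \<omega> = i)"
  shows
    "p 1 = 1 - (a + b + c) * u / (pi * Q) + (a\<^sup>2 + b\<^sup>2 + c\<^sup>2) * J 0 / (2 * pi * Q\<^sup>2)
             + (b * c * f\<^sub>1 \<alpha> + c * a * f\<^sub>1 \<beta> + a * b * f\<^sub>1 \<gamma>) / (pi * Q\<^sup>2) \<and>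
     p 2 = (a + b + c) * u / (pi * Q) - 3 * (a\<^sup>2 + b\<^sup>2 + c\<^sup>2) * J 0 / (2 * pi * Q\<^sup>2)
             - (b * c * f\<^sub>2 \<alpha> + c * a * f\<^sub>2 \<beta> + a * b * f\<^sub>2 \<gamma>) / (pi * Q\<^sup>2) \<and>
     p 3 = 3 * (a\<^sup>2 + b\<^sup>2 + c\<^sup>2) * J 0 / (2 * pi * Q\<^sup>2)
             + (b * c * f\<^sub>3 \<alpha> + c * a * f\<^sub>3 \<beta> + a * b * f\<^sub>3 \<gamma>) / (pi * Q\<^sup>2) \<and>
     p 4 = (b * c * J \<alpha> + c * a * J \<beta> + a * b * J \<gamma>) / (pi * Q\<^sup>2)
             - (a\<^sup>2 + b\<^sup>2 + c\<^sup>2) * J 0 / (2 * pi * Q\<^sup>2) - F / Q \<and>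
     p 5 = 0 \<and>
     p 6 = F / Q \<and>
     prob_space.expectation M (\<lambda>\<omega>. real (Z \<omega>)) = 1 + (a + b + c) * u / (pi * Q) + 2 * F / Q"
proof -
  interpret B: thrown_body a b c \<alpha> \<beta> \<gamma> K r e
    by unfold_locales (use triangle body fits s in auto)
  interpret M: prob_space M by (rule prob)
  let ?T = "throw_law a c \<alpha> \<beta>"
  interpret T: prob_space ?T by (rule B.prob_space_throw_law)
  note rv [measurable]
  \<comment> \<open>The direction from which the angle of \<open>\<sigma>\<close> is measured, as the outward normal of the side \<open>b\<close> turned by \<open>\<kappa>\<close>.\<close>
  obtain \<kappa> where \<nu>: "\<nu> = cis (\<alpha> + pi / 2 + \<kappa>)" using unit_complex_eq_cis[OF \<nu>_perp_b(1)] by blast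
  have Z_eq: "Z \<omega> = B.number_hit \<kappa> (X \<omega>, \<Phi> \<omega>)" for \<omega>
    unfolding Z B.placed_eq_posed[OF \<nu>] B.triangles_hit_eq B.number_hit_def ..
  have throw: "(\<lambda>\<omega>. (X \<omega>, \<Phi> \<omega>)) \<in> measurable M (borel \<Otimes>\<^sub>M borel)" by measurable
  have space_T: "space ?T = UNIV" by (simp add: law[symmetric] space_pair_measure)
  have p_eq: "p i = \<P>(x in ?T. B.number_hit \<kappa> x = i)" for i
  proof -
    have "{x \<in> space (borel \<Otimes>\<^sub>M borel). B.number_hit \<kappa> x = i} \<in> sets (borel \<Otimes>\<^sub>M borel)" by measurable
    then have "{x. B.number_hit \<kappa> x = i} \<in> sets (borel \<Otimes>\<^sub>M borel)" by (simp add: space_pair_measure)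
    from measure_distr[OF throw this] show ?thesis
      unfolding law p Z_eq space_T by (simp add: vimage_def Int_def conj_commute)
  qed
  have E_eq: "M.expectation (\<lambda>\<omega>. real (Z \<omega>)) = T.expectation (\<lambda>x. real (B.number_hit \<kappa> x))"
    unfolding law[symmetric] Z_eq by (rule integral_distr[OF throw, symmetric]) measurable
  have ev: "B.event_u \<kappa> \<in> T.events" "B.event_v \<kappa> \<in> T.events" "B.event_w \<kappa> \<in> T.events" "B.event_vertex \<kappa> \<in> T.events"
    unfolding B.sets_throw_law by (rule B.sets_lines B.sets_vertex)+
  have Z_meas: "B.number_hit \<kappa> \<in> measurable ?T (count_space UNIV)"
    using B.measurable_number_hit by (simp cong: measurable_cong_sets add: B.sets_throw_law)
  note count = T.count_distribution[OF ev Z_meas B.number_hit_AE B.vertex_subset]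
  have Q_eq: "Q = B.area" by (simp add: Q B.area_def)
  have Q_pos: "0 < Q" using B.area_pos by (simp add: Q_eq)
  have u_eq: "u = integral {0..2 * pi} B.s" by (simp add: u B.perimeter_eq)
  have s_eq: "B.s = s" by (simp add: s B.s_def)
  \<comment> \<open>The sums of inclusion and exclusion over one, two and three families of lines.\<close>
  define S1 S2 S3 where "S1 = (a + b + c) * u / (pi * Q)"
    and "S2 = (b * c * I \<alpha> + c * a * I \<beta> + a * b * I \<gamma>) / (pi * Q\<^sup>2)"
    and "S3 = (b * c * J \<alpha> + c * a * J \<beta> + a * b * J \<gamma>) / (pi * Q\<^sup>2) - (a\<^sup>2 + b\<^sup>2 + c\<^sup>2) * J 0 / (2 * pi * Q\<^sup>2)"
  have S1: "T.prob (B.event_u \<kappa>) + T.prob (B.event_v \<kappa>) + T.prob (B.event_w \<kappa>) = S1"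
    unfolding B.prob_one_line u_eq[symmetric] Q_eq[symmetric] S1_def
    by (simp add: add_divide_distrib[symmetric] algebra_simps)
  have S2: "T.prob (B.event_u \<kappa> \<inter> B.event_v \<kappa>) + T.prob (B.event_u \<kappa> \<inter> B.event_w \<kappa>) + T.prob (B.event_v \<kappa> \<inter> B.event_w \<kappa>) = S2"
    unfolding B.prob_two_lines s_eq I[symmetric] Q_eq[symmetric] S2_def
    by (simp add: add_divide_distrib)
  have S3: "T.prob (B.event_u \<kappa> \<inter> B.event_v \<kappa> \<inter> B.event_w \<kappa>) = S3"
    unfolding B.prob_three_lines s_eq J[symmetric] Q_eq[symmetric] S3_def ..
  have V: "T.prob (B.event_vertex \<kappa>) = F / Q"
    unfolding B.prob_vertex Q_eq F ..
  have vals: "p 1 = 1 - S1 + S2 - S3" "p 2 = S1 - 2 * S2 + 3 * S3" "p 3 = S2 - 3 * S3" "p 4 = S3 - F / Q"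
    "p 5 = 0" "p 6 = F / Q" "M.expectation (\<lambda>\<omega>. real (Z \<omega>)) = 1 + S1 + 2 * (F / Q)"
    unfolding p_eq E_eq count S1 S2 S3 V by simp_all
  have f: "(b * c * f\<^sub>1 \<alpha> + c * a * f\<^sub>1 \<beta> + a * b * f\<^sub>1 \<gamma>) / (pi * Q\<^sup>2)
        = S2 - (b * c * J \<alpha> + c * a * J \<beta> + a * b * J \<gamma>) / (pi * Q\<^sup>2)"
    "(b * c * f\<^sub>2 \<alpha> + c * a * f\<^sub>2 \<beta> + a * b * f\<^sub>2 \<gamma>) / (pi * Q\<^sup>2)
        = 2 * S2 - 3 * ((b * c * J \<alpha> + c * a * J \<beta> + a * b * J \<gamma>) / (pi * Q\<^sup>2))"
    "(b * c * f\<^sub>3 \<alpha> + c * a * f\<^sub>3 \<beta> + a * b * f\<^sub>3 \<gamma>) / (pi * Q\<^sup>2)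
        = S2 - 3 * ((b * c * J \<alpha> + c * a * J \<beta> + a * b * J \<gamma>) / (pi * Q\<^sup>2))"
    unfolding S2_def f1 f2 f3 times_divide_eq_right diff_divide_distrib[symmetric]
    by (simp_all add: algebra_simps)
  have three: "3 * (a\<^sup>2 + b\<^sup>2 + c\<^sup>2) * J 0 / (2 * pi * Q\<^sup>2) = 3 * ((a\<^sup>2 + b\<^sup>2 + c\<^sup>2) * J 0 / (2 * pi * Q\<^sup>2))"
    by simp
  show ?thesis
    unfolding vals f three S1_def[symmetric] S3_def by (intro conjI) simp_all
qed

end
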